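(* Let $n\ge 1$ be an integer, and let \[ 0<\alpha<n,\quad 1<q_1\le p_1<\infty,\quad 1<q_2\le p_2<\infty,\quad 1\le t\le s<\infty . \] Define $p$ and $q$ by \[ \frac1p=\frac1{p_1}+\frac1{p_2},\qquad \frac1q=\frac1{q_1}+\frac1{q_2}. \] Assume that \[ \frac1s=\frac1p-\frac{\alpha}{n},\qquad \frac qp=\frac ts,\qquad s<\min(q_1,q_2). \] Then there is a constant $C>0$, depending only on $n,\alpha,p_1,p_2,q_1,q_2,s,t$, such that for all non-negative $f_1\in\mathcal{M}^{p_1}_{q_1}(\mathbb{R}^n)$ and non-negative $f_2\in\mathcal{M}^{p_2}_{q_2}(\mathbb{R}^n)$, \[ \|\mathcal{J}_\alpha[f_1,f_2]\|_{\mathcal{M}^s_t}\le C\,\|f_1\|_{\mathcal{M}^{p_1}_{q_1}}\|f_2\|_{\mathcal{M}^{p_2}_{q_2}}. \]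
   Context: A dyadic cube in $\mathbb{R}^n$ is a set of the form $Q_{jk}=\prod_{i=1}^n[2^{-j}k_i,2^{-j}(k_i+1))$ with $j\in\mathbb{Z}$ and $k=(k_1,\dots,k_n)\in\mathbb{Z}^n$. For $1\le q\le p<\infty$ and a measurable function $f$ on $\mathbb{R}^n$, the Morrey norm is \[ \|f\|_{\mathcal{M}^p_q}=\sup\left\{|Q|^{\frac1p-\frac1q}\|f\|_{L^q(Q)} : Q \text{ is a dyadic cube in } \mathbb{R}^n\right\}, \] where $|Q|$ is the Lebesgue measure of $Q$. The Morrey space $\mathcal{M}^p_q(\mathbb{R}^n)$ is the set of all measurable functions $f$ with $\|f\|_{\mathcal{M}^p_q}<\infty$. For $0<\alpha<n$ and non-negative measurable functions $f_1,f_2$ on $\mathbb{R}^n$, the bilinear fractional integral operator of Grafakos type is \[ \mathcal{J}_\alpha[f_1,f_2](x)=\int_{\mathbb{R}^n}\frac{f_1(x+y)f_2(x-y)}{|y|^{n-\alpha}}\,dy\in[0,\infty]\qquad(x\in\mathbb{R}^n). \] *)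

theory Defs
  imports "HOL-Analysis.Analysis"
begin

definition dyadic_cube :: "int \<Rightarrow> int ^ 'n \<Rightarrow> (real ^ 'n) set" where
  "dyadic_cube j k =
     {x. \<forall>i. 2 powi (- j) * real_of_int (k $ i) \<le> x $ i
           \<and> x $ i < 2 powi (- j) * (real_of_int (k $ i) + 1)}"

definition dyadic_cubes :: "(real ^ 'n) set set" where
  "dyadic_cubes = {dyadic_cube j k | j k. True}"

(* Real powers on [0, infinity]; only positive exponents are used, for which
   0 is sent to 0 and infinity to infinity. *)
definition ennreal_powr :: "ennreal \<Rightarrow> real \<Rightarrow> ennreal" where
  "ennreal_powr a r = (if a = \<infinity> then \<infinity> else ennreal (enn2real a powr r))"

definition Lq_norm_on :: "real \<Rightarrow> (real ^ 'n) set \<Rightarrow> (real ^ 'n \<Rightarrow> ennreal) \<Rightarrow> ennreal" where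
  "Lq_norm_on q Q F = ennreal_powr (\<integral>\<^sup>+x\<in>Q. ennreal_powr (F x) q \<partial>lebesgue) (1 / q)"

(* The Morrey norm depends on a function only through its absolute value, so it is defined on
   [0, infinity]-valued functions; this makes it applicable to the fractional integral, which
   may be infinite. A real function f enters as |f|. *)
definition morrey_norm :: "real \<Rightarrow> real \<Rightarrow> (real ^ 'n \<Rightarrow> ennreal) \<Rightarrow> ennreal" where
  "morrey_norm p q F =
     (SUP Q\<in>dyadic_cubes. ennreal (measure lebesgue Q powr (1 / p - 1 / q)) * Lq_norm_on q Q F)"

definition morrey_space :: "real \<Rightarrow> real \<Rightarrow> (real ^ 'n \<Rightarrow> real) set" where
  "morrey_space p q =
     {f \<in> borel_measurable lebesgue. morrey_norm p q (\<lambda>x. ennreal \<bar>f x\<bar>) < \<infinity>}"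

(* Meant for non-negative f1 and f2. At y = 0 the integrand takes the value 0 (division by zero),
   which does not affect the integral. *)
definition bilinear_frac_int ::
    "real \<Rightarrow> (real ^ 'n \<Rightarrow> real) \<Rightarrow> (real ^ 'n \<Rightarrow> real) \<Rightarrow> real ^ 'n \<Rightarrow> ennreal" where
  "bilinear_frac_int \<alpha> f1 f2 x =
     (\<integral>\<^sup>+y. ennreal (f1 (x + y) * f2 (x - y) / norm y powr (real CARD('n) - \<alpha>)) \<partial>lebesgue)"

end

theory Submission
  imports Defs
begin

text \<open>
  Let Q be a dyadic cube of side 2^L, let h be the fractional integral truncated at a finite height and
  restricted to Q, and test the untruncated integral against g = h^(t-1), so that the integral of h^t is at
  most the trilinear form of f1, f2 and g. The kernel is dominated by the sum over
  the scales l of 2^(l(\<alpha>-n)) times the indicator of the ball of radius 2^l, and at a single scale Hoelder's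
  inequality with exponents a and b = a/(a-1), where s < a < q1, bounds the trilinear form
  by the L^a norm of f1, the L^1 norm of f2 and the L^b norm of g.

  For l \<ge> L this and the Morrey bounds give a convergent geometric series because s < a.
  For l \<le> L the form is first averaged over balls of radius 2^l, which produces local averages of
  f1^a, f2 and g^b. The product of the first two is at most both 2^(-ln/p) (Morrey) and a product D of
  maximal functions, so summing over l as in Hedberg's inequality leaves the integral of D^(p/s) against
  a maximal function of g. Since q/p = t/s, Hoelder's inequality with weights p/(s q1), p/(s q2) and 1 - 1/t
  applies to it, and the maximal theorem on f1, f2 localized near Q finishes the estimate.
\<close>

section \<open>Powers on the extended nonnegative reals\<close>

text \<open>The factors f1(x+y) and f2(x-y) share the same y and q may be smaller than 1, so for
  fixed x a mean of their product over y is in general not controlled by means of f1 and f2. Duality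
  removes this obstacle: integrating in x as well, against g, decouples the functions, because any
  two of the forms x+y, x-y, x are independent coordinates. The truncation serves one purpose: with
  X the integral of h^t, the dual estimate reads X \<le> R X^(1-1/t), and cancelling a power of X
  requires X to be positive and finite. With \<gamma> = n/p, the hypothesis on s says 1 -
  \<alpha>/\<gamma> = p/s. Hence the exponents in Hedberg's inequality, \<alpha>/\<gamma> on the
  Morrey constants and p/s on the maximal functions, sum to 1 and the final bound has degree one in
  each function. The maximal theorem is applied with exponents q1/a, q2 and, for t > 1, t/((t-1)b);
  the last exceeds 1 because t < a. Morrey functions need not have finite L^q norm on the whole
  space, which is why f1 and f2 are cut to a ball before it is used.\<close>

notation ennreal_powr (infixr "powe" 80)

lemma ennreal_powr_top [simp]: "top powe r = top"
  by (simp add: ennreal_powr_def)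

lemma ennreal_powr_ennreal: "x \<ge> 0 \<Longrightarrow> ennreal x powe r = ennreal (x powr r)"
  by (simp add: ennreal_powr_def)

lemma ennreal_powr_zero [simp]: "0 powe r = 0"
  by (simp add: ennreal_powr_def)

lemma ennreal_powr_one_left [simp]: "1 powe r = 1"
  by (simp add: ennreal_powr_def)

lemma ennreal_powr_one [simp]: "x powe 1 = x"
  by (cases x) (simp_all add: ennreal_powr_ennreal)

lemma ennreal_powr_eq_0_iff [simp]: "x powe r = 0 \<longleftrightarrow> x = 0"
  by (cases x) (simp_all add: ennreal_powr_ennreal)

lemma ennreal_powr_eq_top_iff [simp]: "x powe r = top \<longleftrightarrow> x = top"
  by (cases x) (simp_all add: ennreal_powr_ennreal)

lemma ennreal_powr_less_top_iff [simp]: "x powe r < top \<longleftrightarrow> x < top"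
  by (simp add: less_top[symmetric])

lemma ennreal_powr_mono: "x \<le> y \<Longrightarrow> r \<ge> 0 \<Longrightarrow> x powe r \<le> y powe r"
  by (cases x; cases y) (auto simp: ennreal_powr_ennreal top_unique intro!: ennreal_leI powr_mono2)

lemma ennreal_powr_mult: "(x * y) powe r = x powe r * y powe r"
proof (cases "x = 0 \<or> y = 0 \<or> x = top \<or> y = top")
  case True
  then show ?thesis by (auto simp: ennreal_top_mult ennreal_mult_top)
next
  case False
  then show ?thesis
    by (cases x; cases y)
      (simp_all add: ennreal_powr_ennreal powr_mult flip: ennreal_mult)
qed

lemma ennreal_powr_powr: "(x powe r) powe s = x powe (r * s)"
  by (cases x) (simp_all add: ennreal_powr_ennreal powr_powr)

lemma ennreal_powr_add: "x powe (r + s) = x powe r * x powe s"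
  by (cases x) (simp_all add: ennreal_powr_ennreal powr_add ennreal_mult)

lemma ennreal_powr_measurable [measurable]:
  assumes [measurable]: "f \<in> borel_measurable M"
  shows "(\<lambda>x. f x powe r) \<in> borel_measurable M"
  unfolding ennreal_powr_def by measurable

lemma ennreal_powr_indicator [simp]: "indicator A x powe r = (indicator A x :: ennreal)"
  by (simp split: split_indicator)

lemma ennreal_powr_cmult_inverse:
  assumes "0 < x" "x < top" shows "x powe (- r) * x powe r = 1"
  using assms by (cases x) (simp_all add: ennreal_powr_ennreal powr_minus flip: ennreal_mult)

section \<open>Hoelder's inequality for functions with values in [0, infinity]\<close>

lemma ennreal_weighted_geom_mean:
  assumes "0 < \<theta>" "\<theta> < 1"
  shows "x powe \<theta> * y powe (1 - \<theta>) \<le> ennreal \<theta> * x + ennreal (1 - \<theta>) * y"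
proof (cases "x = top \<or> y = top")
  case True
  then show ?thesis using assms by (auto simp: ennreal_mult_top)
next
  case False
  then obtain u v where u: "x = ennreal u" "u \<ge> 0" "y = ennreal v" "v \<ge> 0"
    by (cases x; cases y) auto
  have "u powr \<theta> * v powr (1 - \<theta>) \<le> \<theta> * u + (1 - \<theta>) * v"
    using Youngs_inequality_0[of "\<theta>" "1 - \<theta>" u v] u assms by (cases "u = 0 \<or> v = 0") auto
  then show ?thesis using u assms
    by (simp add: ennreal_powr_ennreal flip: ennreal_mult ennreal_plus)
qed

text \<open>Both factors are scaled to total integral 1 and the weighted arithmetic-geometric mean
  inequality is integrated. Zero and infinite totals are split off because the scaling divides by
  them; a zero total makes the integrand vanish almost everywhere, in agreement with
  \<open>0 * top = 0\<close> on the right.\<close>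

lemma nn_integral_Hoelder:
  fixes f g :: "'a \<Rightarrow> ennreal"
  assumes [measurable]: "f \<in> borel_measurable M" "g \<in> borel_measurable M"
    and \<theta>: "0 < \<theta>" "\<theta> < 1"
  shows "(\<integral>\<^sup>+x. f x powe \<theta> * g x powe (1 - \<theta>) \<partial>M) \<le> (\<integral>\<^sup>+x. f x \<partial>M) powe \<theta> * (\<integral>\<^sup>+x. g x \<partial>M) powe (1 - \<theta>)"
proof -
  define A where "A = (\<integral>\<^sup>+x. f x \<partial>M)"
  define B where "B = (\<integral>\<^sup>+x. g x \<partial>M)"
  consider "A = 0" | "B = 0" | "A > 0" "B > 0" "A = top \<or> B = top" | "0 < A" "A < top" "0 < B" "B < top"
    by (metis less_top zero_less_iff_neq_zero)
  then show ?thesis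
  proof cases
    case 1
    then have "AE x in M. f x = 0" by (simp add: A_def nn_integral_0_iff_AE)
    then have "(\<integral>\<^sup>+x. f x powe \<theta> * g x powe (1 - \<theta>) \<partial>M) = (\<integral>\<^sup>+x. 0 \<partial>M)"
      by (intro nn_integral_cong_AE) auto
    then show ?thesis by simp
  next
    case 2
    then have "AE x in M. g x = 0" by (simp add: B_def nn_integral_0_iff_AE)
    then have "(\<integral>\<^sup>+x. f x powe \<theta> * g x powe (1 - \<theta>) \<partial>M) = (\<integral>\<^sup>+x. 0 \<partial>M)"
      by (intro nn_integral_cong_AE) auto
    then show ?thesis by simp
  next
    case 3
    then have "A powe \<theta> * B powe (1 - \<theta>) = top"
      by (auto simp: ennreal_mult_eq_top_iff zero_less_iff_neq_zero)
    then show ?thesis by (simp add: A_def B_def)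
  next
    case 4
    let ?c = "A powe \<theta> * B powe (1 - \<theta>)"
    have inv: "A powe (-1) * A = 1" "B powe (-1) * B = 1"
      using ennreal_powr_cmult_inverse[of A 1] ennreal_powr_cmult_inverse[of B 1] 4 by auto
    have eq: "f x powe \<theta> * g x powe (1 - \<theta>)
        = ?c * ((A powe (-1) * f x) powe \<theta> * (B powe (-1) * g x) powe (1 - \<theta>))" for x
    proof -
      have "?c * ((A powe (-1) * f x) powe \<theta> * (B powe (-1) * g x) powe (1 - \<theta>))
        = (A powe (-\<theta>) * A powe \<theta>) * (B powe (-(1-\<theta>)) * B powe (1 - \<theta>)) * (f x powe \<theta> * g x powe (1 - \<theta>))"
        by (simp add: ennreal_powr_mult ennreal_powr_powr mult_ac)
      then show ?thesis using 4 by (simp only: ennreal_powr_cmult_inverse) simp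
    qed
    have "(\<integral>\<^sup>+x. f x powe \<theta> * g x powe (1 - \<theta>) \<partial>M)
      \<le> (\<integral>\<^sup>+x. ?c * (ennreal \<theta> * (A powe (-1) * f x) + ennreal (1 - \<theta>) * (B powe (-1) * g x)) \<partial>M)"
      unfolding eq by (intro nn_integral_mono mult_left_mono ennreal_weighted_geom_mean \<theta>) auto
    also have "\<dots> = ?c * (ennreal \<theta> * (A powe (-1) * A) + ennreal (1 - \<theta>) * (B powe (-1) * B))"
      by (simp add: nn_integral_cmult nn_integral_add A_def[symmetric] B_def[symmetric])
    also have "\<dots> = ?c"
      using \<theta> by (simp only: inv) (simp flip: ennreal_plus)
    finally show ?thesis by (simp add: A_def B_def)
  qed
qed

text \<open>The two-function inequality is used twice, with g and h first merged under the relative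
  weights b/(b+c) and c/(b+c).\<close>

lemma nn_integral_Hoelder3:
  fixes f g h :: "'a \<Rightarrow> ennreal"
  assumes [measurable]: "f \<in> borel_measurable M" "g \<in> borel_measurable M" "h \<in> borel_measurable M"
    and pos: "0 < a" "0 < b" "0 < c" and sum: "a + b + c = 1"
  shows "(\<integral>\<^sup>+x. f x powe a * g x powe b * h x powe c \<partial>M)
    \<le> (\<integral>\<^sup>+x. f x \<partial>M) powe a * (\<integral>\<^sup>+x. g x \<partial>M) powe b * (\<integral>\<^sup>+x. h x \<partial>M) powe c"
proof -
  have a: "1 - a = b + c" using sum by simp
  have bc: "b / (b + c) * (b + c) = b" "c / (b + c) * (b + c) = c" "1 - b / (b + c) = c / (b + c)"
    using pos by (simp_all add: field_simps)
  have bc0: "b + c \<noteq> 0" using pos by simp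
  have "(\<integral>\<^sup>+x. f x powe a * g x powe b * h x powe c \<partial>M)
     = (\<integral>\<^sup>+x. f x powe a * (g x powe (b / (b + c)) * h x powe (c / (b + c))) powe (1 - a) \<partial>M)"
    by (simp add: a ennreal_powr_mult ennreal_powr_powr bc bc0 mult.assoc)
  also have "\<dots> \<le> (\<integral>\<^sup>+x. f x \<partial>M) powe a *
      (\<integral>\<^sup>+x. g x powe (b / (b + c)) * h x powe (c / (b + c)) \<partial>M) powe (1 - a)"
    using pos sum by (intro nn_integral_Hoelder) auto
  also have "\<dots> \<le> (\<integral>\<^sup>+x. f x \<partial>M) powe a *
      ((\<integral>\<^sup>+x. g x \<partial>M) powe (b / (b + c)) * (\<integral>\<^sup>+x. h x \<partial>M) powe (c / (b + c))) powe (1 - a)"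
    using pos sum nn_integral_Hoelder[of g M h "b / (b + c)"] unfolding bc
    by (intro mult_left_mono ennreal_powr_mono) (auto simp: field_simps)
  also have "\<dots> = (\<integral>\<^sup>+x. f x \<partial>M) powe a * (\<integral>\<^sup>+x. g x \<partial>M) powe b * (\<integral>\<^sup>+x. h x \<partial>M) powe c"
    by (simp add: a ennreal_powr_mult ennreal_powr_powr bc bc0 mult.assoc)
  finally show ?thesis .
qed

section \<open>Sums over dyadic scales\<close>

text \<open>Sums over integer scales are written as integrals over \<open>count_space UNIV\<close>:
  they always make sense in [0, infinity], and Tonelli exchanges them with Lebesgue
  integrals.\<close>

lemma nn_integral_geometric_atMost:
  assumes "0 < \<beta>"
  shows "(\<integral>\<^sup>+l. ennreal (2 powr (\<beta> * real_of_int l)) * indicator {..m} l \<partial>count_space UNIV)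
     = ennreal (1 / (1 - 2 powr (-\<beta>))) * ennreal (2 powr (\<beta> * real_of_int m))"
proof -
  have q: "2 powr (-\<beta>) < 1" using assms by (simp add: powr_less_one)
  have bij: "bij_betw (\<lambda>i. m - int i) UNIV {..m}"
    by (rule bij_betwI[where g="\<lambda>l. nat (m - l)"]) auto
  have "(\<integral>\<^sup>+l. ennreal (2 powr (\<beta> * real_of_int l)) * indicator {..m} l \<partial>count_space UNIV)
      = (\<integral>\<^sup>+l. ennreal (2 powr (\<beta> * real_of_int l)) \<partial>count_space {..m})"
    by (simp add: nn_integral_count_space_indicator)
  also have "\<dots> = (\<integral>\<^sup>+i. ennreal (2 powr (\<beta> * real_of_int (m - int i))) \<partial>count_space UNIV)"
    by (rule nn_integral_bij_count_space[OF bij, symmetric])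
  also have "\<dots> = (\<integral>\<^sup>+i. ennreal (2 powr (\<beta> * m)) * ennreal ((2 powr (-\<beta>)) ^ i) \<partial>count_space UNIV)"
    by (intro nn_integral_cong)
      (auto simp flip: ennreal_mult powr_realpow powr_add simp: powr_powr algebra_simps powr_realpow[symmetric])
  also have "\<dots> = ennreal (2 powr (\<beta> * m)) * (\<Sum>i. ennreal ((2 powr (-\<beta>)) ^ i))"
    by (simp add: nn_integral_cmult nn_integral_count_space_nat)
  also have "(\<Sum>i. ennreal ((2 powr (-\<beta>)) ^ i)) = ennreal (1 / (1 - 2 powr (-\<beta>)))"
    using q by (intro sums_unique[symmetric] ) (auto intro!: geometric_sums)
  finally show ?thesis by (simp add: mult.commute)
qed

text \<open>The threshold is an arbitrary positive real, since the balancing scale in Hedberg's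
  inequality is not a power of 2; rounding \<open>log 2 X\<close> down reduces it to the previous
  sum.\<close>

lemma nn_integral_geometric_le:
  assumes \<beta>: "0 < \<beta>" and X: "0 < X"
  shows "(\<integral>\<^sup>+l. ennreal (2 powr (\<beta> * real_of_int l)) * indicator {l. 2 powr real_of_int l \<le> X} l \<partial>count_space UNIV)
     \<le> ennreal (1 / (1 - 2 powr (-\<beta>))) * ennreal (X powr \<beta>)"
proof -
  have set_eq: "{l. 2 powr real_of_int l \<le> X} = {..\<lfloor>log 2 X\<rfloor>}"
    using X by (auto simp: le_floor_iff le_log_iff)
  have "2 powr (real_of_int \<lfloor>log 2 X\<rfloor>) \<le> X"
    using X by (simp flip: le_log_iff)
  then have "(2 powr (real_of_int \<lfloor>log 2 X\<rfloor>)) powr \<beta> \<le> X powr \<beta>"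
    using \<beta> by (intro powr_mono2) auto
  then have "2 powr (\<beta> * real_of_int \<lfloor>log 2 X\<rfloor>) \<le> X powr \<beta>"
    by (simp add: powr_powr mult.commute)
  then show ?thesis
    unfolding set_eq nn_integral_geometric_atMost[OF \<beta>]
    by (intro mult_left_mono ennreal_leI) auto
qed

lemma nn_integral_geometric_ge:
  assumes \<beta>: "0 < \<beta>" and X: "0 < X"
  shows "(\<integral>\<^sup>+l. ennreal (2 powr (- \<beta> * real_of_int l)) * indicator {l. X \<le> 2 powr real_of_int l} l \<partial>count_space UNIV)
     \<le> ennreal (1 / (1 - 2 powr (-\<beta>))) * ennreal (X powr (- \<beta>))"
proof -
  have bij: "bij_betw (uminus :: int \<Rightarrow> int) UNIV UNIV"
    by (rule bij_betwI[where g=uminus]) auto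
  have "(\<integral>\<^sup>+l. ennreal (2 powr (- \<beta> * real_of_int l)) * indicator {l. X \<le> 2 powr real_of_int l} l \<partial>count_space UNIV)
    = (\<integral>\<^sup>+l. ennreal (2 powr (- \<beta> * real_of_int (- l))) * indicator {l. X \<le> 2 powr real_of_int l} (- l) \<partial>count_space UNIV)"
    by (rule nn_integral_bij_count_space[OF bij, symmetric])
  also have "\<dots> = (\<integral>\<^sup>+l. ennreal (2 powr (\<beta> * real_of_int l)) * indicator {l. 2 powr real_of_int l \<le> 1 / X} l \<partial>count_space UNIV)"
    using X by (intro nn_integral_cong) (auto simp: powr_minus field_simps split: split_indicator)
  also have "\<dots> \<le> ennreal (1 / (1 - 2 powr (-\<beta>))) * ennreal ((1 / X) powr \<beta>)"
    using X by (intro nn_integral_geometric_le \<beta>) auto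
  also have "(1 / X) powr \<beta> = X powr (- \<beta>)"
    using X by (simp add: powr_divide powr_minus_divide)
  finally show ?thesis .
qed

text \<open>The threshold may be 0 or infinite, because in the maximal theorem it is a multiple of a
  value of f. When it is infinite, so is the right-hand side, the constant of the series being
  positive.\<close>

lemma nn_integral_geometric_less:
  assumes \<beta>: "0 < \<beta>"
  shows "(\<integral>\<^sup>+l. ennreal (2 powr (\<beta> * real_of_int l)) * indicator {l. ennreal (2 powr real_of_int l) < X} l \<partial>count_space UNIV)
     \<le> ennreal (1 / (1 - 2 powr (-\<beta>))) * X powe \<beta>"
proof (cases "X = 0 \<or> X = top")
  case True
  moreover have "2 powr (-\<beta>) < 1" using \<beta> by (simp add: powr_less_one)
  ultimately show ?thesis by (auto simp: ennreal_mult_top)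
next
  case False
  then obtain x where x: "X = ennreal x" "x > 0"
    by (cases X) (auto simp: less_le)
  have "(\<integral>\<^sup>+l. ennreal (2 powr (\<beta> * real_of_int l)) * indicator {l. ennreal (2 powr real_of_int l) < X} l \<partial>count_space UNIV)
    \<le> (\<integral>\<^sup>+l. ennreal (2 powr (\<beta> * real_of_int l)) * indicator {l. 2 powr real_of_int l \<le> x} l \<partial>count_space UNIV)"
    using x by (intro nn_integral_mono) (auto simp: ennreal_less_iff split: split_indicator)
  also have "\<dots> \<le> ennreal (1 / (1 - 2 powr (-\<beta>))) * ennreal (x powr \<beta>)"
    by (rule nn_integral_geometric_le) (use \<beta> x in auto)
  finally show ?thesis using x by (simp add: ennreal_powr_ennreal)
qed

text \<open>Hedberg's trick: the two bounds are balanced at the scale 2^l = (K/D)^(1/\<gamma>).\<close>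

lemma nn_integral_Hedberg:
  assumes \<alpha>: "0 < \<alpha>" "\<alpha> < \<gamma>" and K: "K < top"
  shows "(\<integral>\<^sup>+l. ennreal (2 powr (\<alpha> * real_of_int l)) * min (K * ennreal (2 powr (- \<gamma> * real_of_int l))) D \<partial>count_space UNIV)
     \<le> ennreal (1 / (1 - 2 powr (-\<alpha>)) + 1 / (1 - 2 powr (-(\<gamma> - \<alpha>)))) * (K powe (\<alpha> / \<gamma>) * D powe (1 - \<alpha> / \<gamma>))"
    (is "?L \<le> ennreal (?c1 + ?c2) * _")
proof -
  have q: "2 powr (-\<alpha>) < 1" "2 powr (-(\<gamma> - \<alpha>)) < 1" using \<alpha> by (simp_all add: powr_less_one)
  consider "K = 0" | "D = 0" | "D = top" "K \<noteq> 0" | k d where "K = ennreal k" "D = ennreal d" "k > 0" "d > 0"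
    using K by (cases K; cases D) (auto simp: less_le)
  then show ?thesis
  proof cases
    case 1
    then show ?thesis by simp
  next
    case 2
    then show ?thesis by simp
  next
    case 3
    then have "K powe (\<alpha> / \<gamma>) * D powe (1 - \<alpha> / \<gamma>) = top"
      by (simp add: ennreal_mult_eq_top_iff)
    moreover have "?c1 + ?c2 > 0" using q by (simp add: add_pos_pos)
    ultimately show ?thesis by (simp only: ennreal_mult_top) simp
  next
    case 4
    define X where "X = (k / d) powr (1 / \<gamma>)"
    have X: "X > 0" using 4 by (simp add: X_def)
    have "?L \<le> (\<integral>\<^sup>+l. ennreal d * (ennreal (2 powr (\<alpha> * real_of_int l)) * indicator {l. 2 powr real_of_int l \<le> X} l)
       + ennreal k * (ennreal (2 powr (- (\<gamma> - \<alpha>) * real_of_int l)) * indicator {l. X \<le> 2 powr real_of_int l} l) \<partial>count_space UNIV)"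
    proof (rule nn_integral_mono)
      fix l :: int
      show "ennreal (2 powr (\<alpha> * real_of_int l)) * min (K * ennreal (2 powr (- \<gamma> * real_of_int l))) D
        \<le> ennreal d * (ennreal (2 powr (\<alpha> * real_of_int l)) * indicator {l. 2 powr real_of_int l \<le> X} l)
         + ennreal k * (ennreal (2 powr (- (\<gamma> - \<alpha>) * real_of_int l)) * indicator {l. X \<le> 2 powr real_of_int l} l)"
        (is "?a * _ \<le> ?r1 + ?r2")
      proof (cases "2 powr real_of_int l \<le> X")
        case True
        have "?a * min (K * ennreal (2 powr (- \<gamma> * real_of_int l))) D \<le> ?a * D"
          by (intro mult_left_mono) auto
        also have "\<dots> = ?r1" using True 4 by (simp add: mult.commute)
        finally show ?thesis by (simp add: add_increasing2)
      next
        case False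
        have "?a * min (K * ennreal (2 powr (- \<gamma> * real_of_int l))) D \<le> ?a * (K * ennreal (2 powr (- \<gamma> * real_of_int l)))"
          by (intro mult_left_mono) auto
        also have "\<dots> = ennreal k * ennreal (2 powr (\<alpha> * real_of_int l) * 2 powr (- \<gamma> * real_of_int l))"
          using 4 by (simp add: mult_ac ennreal_mult)
        also have "2 powr (\<alpha> * real_of_int l) * 2 powr (- \<gamma> * real_of_int l) = 2 powr (- (\<gamma> - \<alpha>) * real_of_int l)"
          by (simp add: algebra_simps flip: powr_add)
        also have "ennreal k * ennreal (2 powr (- (\<gamma> - \<alpha>) * real_of_int l)) = ?r2" using False by simp
        finally show ?thesis by (simp add: add_increasing)
      qed
    qed
    also have "\<dots> = ennreal d * (\<integral>\<^sup>+l. ennreal (2 powr (\<alpha> * real_of_int l)) * indicator {l. 2 powr real_of_int l \<le> X} l \<partial>count_space UNIV)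
       + ennreal k * (\<integral>\<^sup>+l. ennreal (2 powr (- (\<gamma> - \<alpha>) * real_of_int l)) * indicator {l. X \<le> 2 powr real_of_int l} l \<partial>count_space UNIV)"
      by (simp add: nn_integral_add nn_integral_cmult)
    also have "\<dots> \<le> ennreal d * (ennreal ?c1 * ennreal (X powr \<alpha>)) + ennreal k * (ennreal ?c2 * ennreal (X powr (- (\<gamma> - \<alpha>))))"
      using \<alpha> X by (intro add_mono mult_left_mono nn_integral_geometric_le nn_integral_geometric_ge) auto
    also have "\<dots> = ennreal (d * (?c1 * X powr \<alpha>) + k * (?c2 * X powr (- (\<gamma> - \<alpha>))))"
    proof -
      have "ennreal d * (ennreal a * ennreal x) + ennreal k * (ennreal b * ennreal y) = ennreal (d * (a * x) + k * (b * y))"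
        if "a \<ge> 0" "b \<ge> 0" "x \<ge> 0" "y \<ge> 0" for a b x y
        using that 4 by (simp add: ennreal_mult ennreal_plus)
      from this[of ?c1 ?c2] show ?thesis using q by simp
    qed
    also have "d * (?c1 * X powr \<alpha>) + k * (?c2 * X powr (- (\<gamma> - \<alpha>))) = (?c1 + ?c2) * (k powr (\<alpha> / \<gamma>) * d powr (1 - \<alpha> / \<gamma>))"
    proof -
      have "X powr \<alpha> = k powr (\<alpha> / \<gamma>) * d powr (- \<alpha> / \<gamma>)"
        using 4 by (simp add: X_def powr_powr powr_divide powr_minus field_simps)
      then have 1: "d * X powr \<alpha> = k powr (\<alpha> / \<gamma>) * d powr (1 - \<alpha> / \<gamma>)"
        using 4 by (simp add: powr_diff powr_minus field_simps)
      have "X powr (- (\<gamma> - \<alpha>)) = X powr \<alpha> * X powr (-\<gamma>)"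
        by (simp flip: powr_add)
      also have "X powr (-\<gamma>) = d / k"
        using 4 \<alpha> by (simp add: X_def powr_powr powr_minus)
      finally have 2: "k * X powr (- (\<gamma> - \<alpha>)) = d * X powr \<alpha>"
        using 4 by simp
      show ?thesis using 1 2 by (simp add: algebra_simps)
    qed
    finally show ?thesis
      using 4 q by (simp add: ennreal_powr_ennreal ennreal_mult)
  qed
qed

section \<open>Affine changes of variables and the trilinear Hoelder inequality\<close>

lemma nn_integral_lborel_affine:
  fixes t :: "'a::euclidean_space"
  assumes [measurable]: "f \<in> borel_measurable borel" and "c \<noteq> 0"
  shows "(\<integral>\<^sup>+x. f x \<partial>lborel) = ennreal (\<bar>c\<bar> ^ DIM('a)) * (\<integral>\<^sup>+x. f (t + c *\<^sub>R x) \<partial>lborel)"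
  by (subst lborel_affine[OF assms(2), of t])
    (simp add: nn_integral_density nn_integral_distr nn_integral_cmult)

lemma nn_integral_lborel_shift:
  fixes t :: "'a::euclidean_space"
  assumes "f \<in> borel_measurable borel"
  shows "(\<integral>\<^sup>+x. f (x + t) \<partial>lborel) = (\<integral>\<^sup>+x. f x \<partial>lborel)"
  using nn_integral_lborel_affine[OF assms, of 1 t] by (simp add: add.commute)

lemma nn_integral_lborel_reflect:
  fixes t :: "'a::euclidean_space"
  assumes "f \<in> borel_measurable borel"
  shows "(\<integral>\<^sup>+x. f (t - x) \<partial>lborel) = (\<integral>\<^sup>+x. f x \<partial>lborel)"
  using nn_integral_lborel_affine[OF assms, of "-1" t] by simp

text \<open>Write f2 as f2^(1/a) f2^(1/b), pair the first part with f1 and the second with g.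
  Hoelder on the product space leaves two double integrals, each of which separates after a linear
  change of variables. Since 1/a + 1 + 1/b = 2 matches the two integrations, no power of a length
  enters.\<close>

lemma nn_integral_trilinear:
  fixes f1 f2 g :: "'a::euclidean_space \<Rightarrow> ennreal"
  assumes [measurable]: "f1 \<in> borel_measurable borel" "f2 \<in> borel_measurable borel" "g \<in> borel_measurable borel"
    and a: "1 < a" and b: "1 / a + 1 / b = 1"
  shows "(\<integral>\<^sup>+x. \<integral>\<^sup>+y. f1 (x + y) * f2 (x - y) * g x \<partial>lborel \<partial>lborel)
    \<le> (\<integral>\<^sup>+x. f1 x powe a \<partial>lborel) powe (1 / a) * (\<integral>\<^sup>+x. f2 x \<partial>lborel) * (\<integral>\<^sup>+x. g x powe b \<partial>lborel) powe (1 / b)"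
proof -
  have b': "1 / b = 1 - 1 / a" using b by simp
  have "b \<noteq> 0" using b a by auto
  let ?M = "lborel \<Otimes>\<^sub>M lborel :: ('a \<times> 'a) measure"
  let ?F = "\<lambda>(x, y). f1 (x + y) powe a * f2 (x - y)"
  let ?G = "\<lambda>(x, y). f2 (x - y) * g x powe b"
  have F[measurable]: "?F \<in> borel_measurable ?M" and G[measurable]: "?G \<in> borel_measurable ?M"
    by measurable
  have f2: "f2 z = f2 z powe (1 / a) * f2 z powe (1 / b)" for z
    by (simp add: b flip: ennreal_powr_add)
  have eq: "f1 (x + y) * f2 (x - y) * g x = (?F (x, y)) powe (1 / a) * (?G (x, y)) powe (1 - 1 / a)" for x y
    unfolding b'[symmetric] using a \<open>b \<noteq> 0\<close>
    by (subst f2[of "x - y"]) (simp add: ennreal_powr_mult ennreal_powr_powr mult_ac)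
  have "(\<integral>\<^sup>+z. ?F z \<partial>?M) = (\<integral>\<^sup>+y. \<integral>\<^sup>+x. f1 (x + y) powe a * f2 (x - y) \<partial>lborel \<partial>lborel)"
    by (subst lborel_pair.nn_integral_snd[symmetric, OF F]) simp
  also have "\<dots> = (\<integral>\<^sup>+y. \<integral>\<^sup>+x. f1 x powe a * f2 (x - 2 *\<^sub>R y) \<partial>lborel \<partial>lborel)"
  \<comment> \<open>For fixed y, shifting x by y makes the factor with f1 independent of y.\<close>
  proof (rule nn_integral_cong)
    fix y :: 'a
    show "(\<integral>\<^sup>+x. f1 (x + y) powe a * f2 (x - y) \<partial>lborel) = (\<integral>\<^sup>+x. f1 x powe a * f2 (x - 2 *\<^sub>R y) \<partial>lborel)"
      using nn_integral_lborel_shift[of "\<lambda>x. f1 x powe a * f2 (x - 2 *\<^sub>R y)" y]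
      by (simp add: scaleR_2 algebra_simps)
  qed
  also have "\<dots> = (\<integral>\<^sup>+x. \<integral>\<^sup>+y. f1 x powe a * f2 (x - 2 *\<^sub>R y) \<partial>lborel \<partial>lborel)"
    by (rule lborel_pair.Fubini') measurable
  also have "\<dots> = (\<integral>\<^sup>+x. f1 x powe a * (\<integral>\<^sup>+y. f2 (x - 2 *\<^sub>R y) \<partial>lborel) \<partial>lborel)"
    by (simp add: nn_integral_cmult)
  also have "\<dots> \<le> (\<integral>\<^sup>+x. f1 x powe a * (\<integral>\<^sup>+y. f2 y \<partial>lborel) \<partial>lborel)"
  \<comment> \<open>The substitution of x - 2y for the variable produces the factor 2^(-n), which is
    bounded by 1.\<close>
  proof (rule nn_integral_mono, rule mult_left_mono)
    fix x :: 'a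
    have "(\<integral>\<^sup>+y. f2 y \<partial>lborel) = ennreal (2 ^ DIM('a)) * (\<integral>\<^sup>+y. f2 (x - 2 *\<^sub>R y) \<partial>lborel)"
      using nn_integral_lborel_affine[of f2 "-2" x] by simp
    moreover have "1 * (\<integral>\<^sup>+y. f2 (x - 2 *\<^sub>R y) \<partial>lborel) \<le> ennreal (2 ^ DIM('a)) * (\<integral>\<^sup>+y. f2 (x - 2 *\<^sub>R y) \<partial>lborel)"
      by (intro mult_right_mono) auto
    ultimately show "(\<integral>\<^sup>+y. f2 (x - 2 *\<^sub>R y) \<partial>lborel) \<le> (\<integral>\<^sup>+y. f2 y \<partial>lborel)" by simp
  qed auto
  also have "\<dots> = (\<integral>\<^sup>+x. f1 x powe a \<partial>lborel) * (\<integral>\<^sup>+y. f2 y \<partial>lborel)"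
    by (simp add: nn_integral_multc)
  finally have F_le: "(\<integral>\<^sup>+z. ?F z \<partial>?M) \<le> (\<integral>\<^sup>+x. f1 x powe a \<partial>lborel) * (\<integral>\<^sup>+y. f2 y \<partial>lborel)" .
  have "(\<integral>\<^sup>+z. ?G z \<partial>?M) = (\<integral>\<^sup>+x. \<integral>\<^sup>+y. f2 (x - y) * g x powe b \<partial>lborel \<partial>lborel)"
    by (subst lborel.nn_integral_fst[symmetric, OF G]) simp
  also have "\<dots> = (\<integral>\<^sup>+x. f2 x \<partial>lborel) * (\<integral>\<^sup>+x. g x powe b \<partial>lborel)"
    by (simp add: nn_integral_multc nn_integral_cmult nn_integral_lborel_reflect)
  finally have G_eq: "(\<integral>\<^sup>+z. ?G z \<partial>?M) = (\<integral>\<^sup>+x. f2 x \<partial>lborel) * (\<integral>\<^sup>+x. g x powe b \<partial>lborel)" .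
  have "(\<integral>\<^sup>+x. \<integral>\<^sup>+y. f1 (x + y) * f2 (x - y) * g x \<partial>lborel \<partial>lborel)
     = (\<integral>\<^sup>+z. ?F z powe (1 / a) * ?G z powe (1 - 1 / a) \<partial>?M)"
    unfolding eq by (rule lborel.nn_integral_fst) measurable
  also have "\<dots> \<le> (\<integral>\<^sup>+z. ?F z \<partial>?M) powe (1 / a) * (\<integral>\<^sup>+z. ?G z \<partial>?M) powe (1 - 1 / a)"
    using a by (intro nn_integral_Hoelder) auto
  also have "\<dots> \<le> ((\<integral>\<^sup>+x. f1 x powe a \<partial>lborel) * (\<integral>\<^sup>+y. f2 y \<partial>lborel)) powe (1 / a)
     * ((\<integral>\<^sup>+x. f2 x \<partial>lborel) * (\<integral>\<^sup>+x. g x powe b \<partial>lborel)) powe (1 - 1 / a)"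
    unfolding G_eq using a by (intro mult_right_mono ennreal_powr_mono F_le) auto
  also have "\<dots> = (\<integral>\<^sup>+x. f1 x powe a \<partial>lborel) powe (1 / a) *
      ((\<integral>\<^sup>+x. f2 x \<partial>lborel) powe (1 / a) * (\<integral>\<^sup>+x. f2 x \<partial>lborel) powe (1 / b)) * (\<integral>\<^sup>+x. g x powe b \<partial>lborel) powe (1 / b)"
    unfolding b'[symmetric] by (simp add: ennreal_powr_mult mult_ac)
  also have "(\<integral>\<^sup>+x. f2 x \<partial>lborel) powe (1 / a) * (\<integral>\<^sup>+x. f2 x \<partial>lborel) powe (1 / b) = (\<integral>\<^sup>+x. f2 x \<partial>lborel)"
    by (simp add: b flip: ennreal_powr_add)
  finally show ?thesis .
qed

section \<open>The maximal operator\<close>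

text \<open>The ball moves with z; written as a condition on \<open>dist z w\<close>, its indicator
  is jointly measurable, so the integral is measurable in z.\<close>

lemma nn_integral_cball_measurable [measurable]:
  fixes f :: "'a::euclidean_space \<Rightarrow> ennreal"
  assumes [measurable]: "f \<in> borel_measurable borel"
  shows "(\<lambda>z. \<integral>\<^sup>+w\<in>cball z r. f w \<partial>lborel) \<in> borel_measurable borel"
proof -
  have "(\<lambda>z. \<integral>\<^sup>+w. f w * (if dist z w \<le> r then 1 else 0) \<partial>lborel) \<in> borel_measurable borel"
    by measurable
  also have "(\<lambda>z. \<integral>\<^sup>+w. f w * (if dist z w \<le> r then 1 else 0) \<partial>lborel) = (\<lambda>z. \<integral>\<^sup>+w\<in>cball z r. f w \<partial>lborel)"
    by (intro ext nn_integral_cong) (auto split: split_indicator)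
  finally show ?thesis .
qed

text \<open>The averages are normalized by the scale 2^(l n) instead of the volume of the ball.
  Bounding the scales by L makes the Vitali covering lemma applicable.\<close>

definition dyadic_average :: "int \<Rightarrow> ('a::euclidean_space \<Rightarrow> ennreal) \<Rightarrow> 'a \<Rightarrow> ennreal" where
  "dyadic_average l f z = ennreal (2 powr (- real DIM('a) * real_of_int l))
      * (\<integral>\<^sup>+w\<in>cball z (2 powr real_of_int l). f w \<partial>lborel)"

lemma dyadic_average_measurable [measurable]:
  assumes [measurable]: "f \<in> borel_measurable borel"
  shows "dyadic_average l f \<in> borel_measurable borel"
  unfolding dyadic_average_def[abs_def] by measurable

lemma dyadic_average_mono:
  assumes "\<And>w. f w \<le> g w"
  shows "dyadic_average l f z \<le> dyadic_average l g z"
  unfolding dyadic_average_def by (intro mult_left_mono nn_integral_mono mult_right_mono assms) auto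

definition dyadic_maximal :: "int \<Rightarrow> ('a::euclidean_space \<Rightarrow> ennreal) \<Rightarrow> 'a \<Rightarrow> ennreal" where
  "dyadic_maximal L f z = (SUP l\<in>{..L}. dyadic_average l f z)"

lemma dyadic_maximal_measurable [measurable]:
  assumes [measurable]: "f \<in> borel_measurable borel"
  shows "dyadic_maximal L f \<in> borel_measurable borel"
  unfolding dyadic_maximal_def[abs_def] by (rule borel_measurable_SUP) (auto intro: dyadic_average_measurable assms)

lemma dyadic_maximal_upper: "l \<le> L \<Longrightarrow> dyadic_average l f z \<le> dyadic_maximal L f z"
  unfolding dyadic_maximal_def by (intro SUP_upper) auto

lemma emeasure_cball_dyadic:
  fixes z :: "'a::euclidean_space"
  shows "emeasure lborel (cball z (2 powr real_of_int l)) = ennreal (unit_ball_vol (real DIM('a)) * 2 powr (real DIM('a) * real_of_int l))"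
  by (simp add: emeasure_cball powr_power mult.commute)

text \<open>The volume of the unit ball stands where genuine averages would give 1, because of the
  normalization by 2^(ln). In the maximal theorem this controls the part of f with small
  values.\<close>

lemma dyadic_maximal_le_const:
  fixes z :: "'a::euclidean_space"
  assumes "\<And>w. f w \<le> ennreal c"
  shows "dyadic_maximal L f z \<le> ennreal (unit_ball_vol (real DIM('a)) * c)"
  unfolding dyadic_maximal_def dyadic_average_def
proof (rule SUP_least)
  fix l assume "l \<in> {..L}"
  have "(\<integral>\<^sup>+w\<in>cball z (2 powr real_of_int l). f w \<partial>lborel) \<le> (\<integral>\<^sup>+w\<in>cball z (2 powr real_of_int l). ennreal c \<partial>lborel)"
    by (intro nn_integral_mono mult_right_mono assms) auto
  also have "\<dots> = ennreal c * ennreal (unit_ball_vol (real DIM('a)) * 2 powr (real DIM('a) * real_of_int l))"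
    by (simp add: nn_integral_cmult_indicator emeasure_cball_dyadic)
  finally have "ennreal (2 powr (- real DIM('a) * real_of_int l)) * (\<integral>\<^sup>+w\<in>cball z (2 powr real_of_int l). f w \<partial>lborel)
     \<le> ennreal (2 powr (- real DIM('a) * real_of_int l)) * (ennreal c * ennreal (unit_ball_vol (real DIM('a)) * 2 powr (real DIM('a) * real_of_int l)))"
    by (intro mult_left_mono) auto
  also have "\<dots> = ennreal (2 powr (- real DIM('a) * real_of_int l) * 2 powr (real DIM('a) * real_of_int l) * unit_ball_vol (real DIM('a))) * ennreal c"
    by (simp add: ennreal_mult mult_ac)
  also have "\<dots> = ennreal (unit_ball_vol (real DIM('a)) * c)"
    by (simp add: ennreal_mult' flip: powr_add)
  finally show "ennreal (2 powr (- real DIM('a) * real_of_int l)) * (\<integral>\<^sup>+w\<in>cball z (2 powr real_of_int l). f w \<partial>lborel)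
     \<le> ennreal (unit_ball_vol (real DIM('a)) * c)" .
qed

lemma dyadic_maximal_add_le:
  assumes [measurable]: "f \<in> borel_measurable borel" "g \<in> borel_measurable borel"
  shows "dyadic_maximal L (\<lambda>w. f w + g w) z \<le> dyadic_maximal L f z + dyadic_maximal L g (z::'a::euclidean_space)"
  unfolding dyadic_maximal_def[of L "\<lambda>w. f w + g w"] dyadic_average_def
proof (rule SUP_least)
  fix l assume "l \<in> {..L}"
  then have "l \<le> L" by simp
  have [measurable]: "cball z (2 powr real_of_int l) \<in> sets borel" by simp
  have "ennreal (2 powr (- real DIM('a) * real_of_int l)) * (\<integral>\<^sup>+w\<in>cball z (2 powr real_of_int l). (f w + g w) \<partial>lborel)
    = ennreal (2 powr (- real DIM('a) * real_of_int l)) * (\<integral>\<^sup>+w\<in>cball z (2 powr real_of_int l). f w \<partial>lborel)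
    + ennreal (2 powr (- real DIM('a) * real_of_int l)) * (\<integral>\<^sup>+w\<in>cball z (2 powr real_of_int l). g w \<partial>lborel)"
    unfolding distrib_right distrib_left[symmetric] by (subst nn_integral_add) auto
  also have "\<dots> \<le> dyadic_maximal L f z + dyadic_maximal L g z"
    by (intro add_mono dyadic_maximal_upper[unfolded dyadic_average_def] \<open>l \<le> L\<close>)
  finally show "ennreal (2 powr (- real DIM('a) * real_of_int l)) * (\<integral>\<^sup>+w\<in>cball z (2 powr real_of_int l). (f w + g w) \<partial>lborel)
    \<le> dyadic_maximal L f z + dyadic_maximal L g z" .
qed

lemma dyadic_maximal_mono:
  assumes "\<And>w. f w \<le> g w"
  shows "dyadic_maximal L f z \<le> dyadic_maximal L g z"
  unfolding dyadic_maximal_def by (intro SUP_mono' dyadic_average_mono assms)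

section \<open>Vitali covering and the weak type estimate\<close>

lemma emeasure_UN_le_count_space:
  assumes "countable C" and [measurable]: "\<And>j. j \<in> C \<Longrightarrow> A j \<in> sets M"
  shows "emeasure M (\<Union>j\<in>C. A j) \<le> (\<integral>\<^sup>+j. emeasure M (A j) \<partial>count_space C)"
proof -
  have [measurable]: "(\<Union>j\<in>C. A j) \<in> sets M"
    using assms by (intro sets.countable_UN') auto
  have "emeasure M (\<Union>j\<in>C. A j) = (\<integral>\<^sup>+x. indicator (\<Union>j\<in>C. A j) x \<partial>M)"
    by simp
  also have "\<dots> \<le> (\<integral>\<^sup>+x. \<integral>\<^sup>+j. indicator (A j) x \<partial>count_space C \<partial>M)"
  proof (rule nn_integral_mono)
    fix x
    show "indicator (\<Union>j\<in>C. A j) x \<le> (\<integral>\<^sup>+j. indicator (A j) x \<partial>count_space C)"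
    proof (cases "x \<in> (\<Union>j\<in>C. A j)")
      case True
      then obtain j where "j \<in> C" "x \<in> A j" by auto
      then show ?thesis using nn_integral_ge_point[of j C "\<lambda>j. indicator (A j) x"] True by simp
    qed simp
  qed
  also have "\<dots> = (\<integral>\<^sup>+j. \<integral>\<^sup>+x. indicator (A j) x \<partial>M \<partial>count_space C)"
    using assms by (intro nn_integral_count_space_nn_integral) auto
  also have "\<dots> = (\<integral>\<^sup>+j. emeasure M (A j) \<partial>count_space C)"
    by (intro nn_integral_cong) simp
  finally show ?thesis .
qed

lemma nn_integral_disjoint_le:
  fixes f :: "'a \<Rightarrow> ennreal"
  assumes "countable C" and [measurable]: "\<And>j. j \<in> C \<Longrightarrow> A j \<in> sets M"
    and disj: "pairwise (\<lambda>i j. disjnt (A i) (A j)) C" and [measurable]: "f \<in> borel_measurable M"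
  shows "(\<integral>\<^sup>+j. (\<integral>\<^sup>+x\<in>A j. f x \<partial>M) \<partial>count_space C) \<le> (\<integral>\<^sup>+x. f x \<partial>M)"
proof -
  have "(\<integral>\<^sup>+j. (\<integral>\<^sup>+x\<in>A j. f x \<partial>M) \<partial>count_space C) = (\<integral>\<^sup>+x. \<integral>\<^sup>+j. f x * indicator (A j) x \<partial>count_space C \<partial>M)"
    using assms(1) by (intro nn_integral_count_space_nn_integral[symmetric]) auto
  also have "\<dots> \<le> (\<integral>\<^sup>+x. f x \<partial>M)"
  proof (rule nn_integral_mono)
    fix x
    have "(\<integral>\<^sup>+j. indicator (A j) x \<partial>count_space C) \<le> (1::ennreal)"
    proof (cases "\<exists>j\<in>C. x \<in> A j")
      case True
      then obtain i where i: "i \<in> C" "x \<in> A i" by auto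
      have "(\<integral>\<^sup>+j. indicator (A j) x \<partial>count_space C) \<le> (\<integral>\<^sup>+j. indicator {i} j \<partial>count_space C)"
        using disj i by (intro nn_integral_mono) (auto simp: pairwise_def disjnt_iff split: split_indicator)
      also have "\<dots> = 1" using i by (simp add: nn_integral_indicator)
      finally show ?thesis .
    next
      case False
      then have "(\<integral>\<^sup>+j. indicator (A j) x \<partial>count_space C) = (\<integral>\<^sup>+j. (0::ennreal) \<partial>count_space C)"
        by (intro nn_integral_cong) auto
      then show ?thesis by simp
    qed
    then show "(\<integral>\<^sup>+j. f x * indicator (A j) x \<partial>count_space C) \<le> f x"
      using mult_left_mono[of _ 1 "f x"] by (simp add: nn_integral_cmult)
  qed
  finally show ?thesis .
qed

text \<open>Each point of the level set is the centre of a ball of radius at most 2^L whose average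
  exceeds X. Vitali selects countably many disjoint ones whose fivefold enlargements cover the set.
  X times the volume of an enlargement is at most 5^n times the unit ball volume times the integral
  of f over the small ball, and over disjoint balls these integrals add up to at most the
  whole.\<close>

lemma dyadic_maximal_weak_type:
  fixes f :: "'a::euclidean_space \<Rightarrow> ennreal"
  assumes [measurable]: "f \<in> borel_measurable borel"
  shows "X * emeasure lborel {z. X < dyadic_maximal L f z}
    \<le> ennreal (5 ^ DIM('a) * unit_ball_vol (real DIM('a))) * (\<integral>\<^sup>+x. f x \<partial>lborel)"
proof -
  let ?n = "real DIM('a)"
  let ?v = "unit_ball_vol (real DIM('a))"
  let ?E = "{z. X < dyadic_maximal L f z}"
  have "\<forall>z\<in>?E. \<exists>l\<le>L. X < ennreal (2 powr (- ?n * real_of_int l)) * (\<integral>\<^sup>+w\<in>cball z (2 powr real_of_int l). f w \<partial>lborel)"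
    by (auto simp: dyadic_maximal_def dyadic_average_def less_SUP_iff)
  then obtain l where l: "\<And>z. z \<in> ?E \<Longrightarrow> l z \<le> L"
    "\<And>z. z \<in> ?E \<Longrightarrow> X < ennreal (2 powr (- ?n * real_of_int (l z))) * (\<integral>\<^sup>+w\<in>cball z (2 powr real_of_int (l z)). f w \<partial>lborel)"
    by metis
  define r where "r z = 2 powr real_of_int (l z)" for z
  obtain C where C: "countable C" "C \<subseteq> ?E" "pairwise (\<lambda>i j. disjnt (cball i (r i)) (cball j (r j))) C"
     "\<And>i. i \<in> ?E \<Longrightarrow> \<exists>j. j \<in> C \<and> \<not> disjnt (cball i (r i)) (cball j (r j)) \<and> cball i (r i) \<subseteq> ball j (5 * r j)"
    using Vitali_covering_lemma_cballs_balls[of ?E r "2 powr real_of_int L" "\<lambda>z. z"] l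
    by (auto simp: r_def)
  have "?E \<subseteq> (\<Union>j\<in>C. cball j (5 * r j))"
  proof
    fix z assume "z \<in> ?E"
    from C(4)[OF this] obtain j where j: "j \<in> C" "cball z (r z) \<subseteq> ball j (5 * r j)" by auto
    have "z \<in> cball z (r z)" by (simp add: r_def)
    then show "z \<in> (\<Union>j\<in>C. cball j (5 * r j))" using j by fastforce
  qed
  then have "emeasure lborel ?E \<le> emeasure lborel (\<Union>j\<in>C. cball j (5 * r j))"
    using C(1) by (intro emeasure_mono) (auto intro!: sets.countable_UN')
  also have "\<dots> \<le> (\<integral>\<^sup>+j. emeasure lborel (cball j (5 * r j)) \<partial>count_space C)"
    using C(1) by (intro emeasure_UN_le_count_space) auto
  also have "X * \<dots> = (\<integral>\<^sup>+j. X * emeasure lborel (cball j (5 * r j)) \<partial>count_space C)"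
    by (simp add: nn_integral_cmult)
  also have "\<dots> \<le> (\<integral>\<^sup>+j. ennreal (5 ^ DIM('a) * ?v) * (\<integral>\<^sup>+w\<in>cball j (r j). f w \<partial>lborel) \<partial>count_space C)"
  proof (rule nn_integral_mono)
    fix j assume "j \<in> space (count_space C)"
    then have "j \<in> ?E" using C(2) by auto
    have "X * emeasure lborel (cball j (5 * r j)) \<le> (ennreal (2 powr (- ?n * real_of_int (l j))) * (\<integral>\<^sup>+w\<in>cball j (r j). f w \<partial>lborel)) * emeasure lborel (cball j (5 * r j))"
      using l(2)[OF \<open>j \<in> ?E\<close>] by (intro mult_right_mono) (auto simp: r_def)
    also have em: "emeasure lborel (cball j (5 * r j)) = ennreal (5 ^ DIM('a) * ?v) * ennreal (2 powr (?n * real_of_int (l j)))"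
      by (simp add: emeasure_cball r_def powr_power power_mult_distrib mult_ac flip: ennreal_mult)
    also have "ennreal (2 powr (- ?n * real_of_int (l j))) * (\<integral>\<^sup>+w\<in>cball j (r j). f w \<partial>lborel) * \<dots>
       = ennreal (2 powr (- ?n * real_of_int (l j)) * 2 powr (?n * real_of_int (l j))) * (ennreal (5 ^ DIM('a) * ?v) * (\<integral>\<^sup>+w\<in>cball j (r j). f w \<partial>lborel))"
      by (simp only: ennreal_mult powr_ge_zero mult_ac)
    also have "2 powr (- ?n * real_of_int (l j)) * 2 powr (?n * real_of_int (l j)) = 1"
      by (simp flip: powr_add)
    finally show "X * emeasure lborel (cball j (5 * r j)) \<le> ennreal (5 ^ DIM('a) * ?v) * (\<integral>\<^sup>+w\<in>cball j (r j). f w \<partial>lborel)"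
      by (simp only: em ennreal_1 mult_1)
  qed
  also have "\<dots> = ennreal (5 ^ DIM('a) * ?v) * (\<integral>\<^sup>+j. (\<integral>\<^sup>+w\<in>cball j (r j). f w \<partial>lborel) \<partial>count_space C)"
    by (simp add: nn_integral_cmult)
  also have "\<dots> \<le> ennreal (5 ^ DIM('a) * ?v) * (\<integral>\<^sup>+x. f x \<partial>lborel)"
    using C by (intro mult_left_mono nn_integral_disjoint_le) auto
  finally show ?thesis by (simp add: mult_left_mono)
qed

text \<open>A dyadic substitute for the layer-cake formula: for finite positive X the single k with
  2^k < X \<le> 2^(k+1) already contributes enough.\<close>

lemma ennreal_powr_le_layers:
  assumes u: "0 < u"
  shows "X powe u \<le> (\<integral>\<^sup>+k. ennreal (2 powr (u * (real_of_int k + 1))) * indicator {k. ennreal (2 powr real_of_int k) < X} k \<partial>count_space UNIV)"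
    (is "_ \<le> (\<integral>\<^sup>+k. ?F k \<partial>_)")
proof (cases X)
  case (real x)
  show ?thesis
  proof (cases "x = 0")
    case True
    then show ?thesis using real by simp
  next
    case False
    then have x: "x > 0" using real by simp
    \<comment> \<open>Rounding up and subtracting 1, rather than rounding down, gives the strict
      inequality 2^k < x required by the level sets.\<close>
    define k where "k = \<lceil>log 2 x\<rceil> - 1"
    have "real_of_int k < log 2 x" "log 2 x \<le> real_of_int k + 1"
      unfolding k_def by linarith+
    then have k: "2 powr real_of_int k < x" "x \<le> 2 powr (real_of_int k + 1)"
      using x by (simp_all add: less_log_iff log_le_iff)
    have "x powr u \<le> (2 powr (real_of_int k + 1)) powr u"
      using k x u by (intro powr_mono2) auto
    then have "X powe u \<le> ?F k"
      using real k by (simp add: ennreal_powr_ennreal ennreal_less_iff powr_powr mult.commute ennreal_leI)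
    also have "\<dots> \<le> (\<integral>\<^sup>+k. ?F k \<partial>count_space UNIV)"
      by (rule nn_integral_ge_point) simp
    finally show ?thesis .
  qed
next
  case top
  \<comment> \<open>An infinite value lies above every level, and each of the infinitely many levels
    k \<ge> 0 contributes at least 1.\<close>
  have "top = emeasure (count_space UNIV) {0::int..}"
    using infinite_Ici[of "0::int"] by simp
  also have "\<dots> = (\<integral>\<^sup>+k. indicator {0::int..} k \<partial>count_space UNIV)"
    by simp
  also have "\<dots> \<le> (\<integral>\<^sup>+k. ?F k \<partial>count_space UNIV)"
    using u top by (intro nn_integral_mono) (auto simp: ge_one_powr_ge_zero split: split_indicator)
  finally show ?thesis by (simp add: top_unique)
qed

text \<open>Marcinkiewicz interpolation over dyadic levels. At level 2^k only the part of f above a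
  multiple of 2^k matters, and the weak type estimate is applied to it. For fixed w the levels that
  see f(w) form a geometric series in 2^((u-1)k), convergent because u > 1 and of size f(w)^(u-1).
  Neither constant depends on L, so one C serves all bounds on the scales.\<close>

theorem dyadic_maximal_strong_type:
  assumes u: "1 < u"
  obtains C where "0 < C" and
    "\<And>L (f::'a::euclidean_space \<Rightarrow> ennreal). f \<in> borel_measurable borel \<Longrightarrow>
       (\<integral>\<^sup>+z. dyadic_maximal L f z powe u \<partial>lborel) \<le> ennreal C * (\<integral>\<^sup>+z. f z powe u \<partial>lborel)"
proof -
  let ?v = "unit_ball_vol (real DIM('a))"
  have v: "?v > 0" by simp
  \<comment> \<open>The factor \<open>2 powr (u + 1)\<close> collects 2^u from the layers and 2 from
    using the weak type estimate at half the level.\<close>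
  define c1 where "c1 = 2 powr (u + 1) * (5 ^ DIM('a) * ?v)"
  define c2 where "c2 = 1 / (1 - 2 powr (-(u - 1)))"
  have c1: "c1 > 0" using v by (simp add: c1_def)
  have "2 powr (-(u - 1)) < 1" using u by (intro powr_less_one) auto
  then have c2: "c2 > 0" by (simp add: c2_def)
  show ?thesis
  proof (rule that)
    show "0 < c1 * c2 * (2 * ?v) powr (u - 1)" using c1 c2 less_imp_neq[OF v] by simp
    fix L and f :: "'a \<Rightarrow> ennreal"
    assume [measurable]: "f \<in> borel_measurable borel"
    define M where "M = dyadic_maximal L f"
    have [measurable]: "M \<in> borel_measurable borel" by (simp add: M_def)
    \<comment> \<open>f is cut at 2^k / (2 ?v): by \<open>dyadic_maximal_le_const\<close> the part
      below the cut has maximal function at most 2^k / 2, which leaves half of the level for the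
      other part.\<close>
    define S where "S k = {w. ennreal (2 powr real_of_int k) < ennreal (2 * ?v) * f w}" for k :: int
    have [measurable]: "S k \<in> sets borel" for k by (simp add: S_def)
    have level: "ennreal (2 powr (u * (real_of_int k + 1))) * emeasure lborel {z. ennreal (2 powr real_of_int k) < M z}
        \<le> ennreal c1 * (ennreal (2 powr ((u - 1) * real_of_int k)) * (\<integral>\<^sup>+w\<in>S k. f w \<partial>lborel))" for k :: int
    proof -
      let ?X = "ennreal (2 powr real_of_int k / 2)"
      have fle: "f w \<le> f w * indicator (S k) w + ennreal (2 powr real_of_int k / (2 * ?v))" for w
      proof (cases "w \<in> S k")
        case False
        then have *: "ennreal (2 * ?v) * f w \<le> ennreal (2 powr real_of_int k)" by (simp add: S_def)
        then have "f w \<noteq> top" using less_imp_neq[OF v] by (auto simp: ennreal_mult_top top_unique)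
        then obtain y where y: "f w = ennreal y" "y \<ge> 0" by (cases "f w") auto
        then have "2 * ?v * y \<le> 2 powr real_of_int k"
          using * v by (simp flip: ennreal_mult)
        then have "y \<le> 2 powr real_of_int k / (2 * ?v)" using v by (simp add: field_simps)
        then show ?thesis using False y by (simp add: ennreal_leI)
      qed simp
      have M_le: "M z \<le> dyadic_maximal L (\<lambda>w. f w * indicator (S k) w) z + ?X" for z
      proof -
        have "M z \<le> dyadic_maximal L (\<lambda>w. f w * indicator (S k) w + ennreal (2 powr real_of_int k / (2 * ?v))) z"
          unfolding M_def by (rule dyadic_maximal_mono) (rule fle)
        also have "\<dots> \<le> dyadic_maximal L (\<lambda>w. f w * indicator (S k) w) z + dyadic_maximal L (\<lambda>w. ennreal (2 powr real_of_int k / (2 * ?v))) z"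
          by (rule dyadic_maximal_add_le) auto
        also have "dyadic_maximal L (\<lambda>w. ennreal (2 powr real_of_int k / (2 * ?v))) z \<le> ennreal (?v * (2 powr real_of_int k / (2 * ?v)))"
          by (rule dyadic_maximal_le_const) simp
        also have "?v * (2 powr real_of_int k / (2 * ?v)) = 2 powr real_of_int k / 2" using less_imp_neq[OF v] by (simp add: field_simps)
        finally show ?thesis by (simp add: add_left_mono)
      qed
      have "{z. ennreal (2 powr real_of_int k) < M z} \<subseteq> {z. ?X < dyadic_maximal L (\<lambda>w. f w * indicator (S k) w) z}"
      proof safe
        fix z assume "ennreal (2 powr real_of_int k) < M z"
        also note M_le[of z]
        also have "ennreal (2 powr real_of_int k) = ?X + ?X" by (simp flip: ennreal_plus)
        finally show "?X < dyadic_maximal L (\<lambda>w. f w * indicator (S k) w) z"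
          by (meson add_right_mono not_le)
      qed
      then have "?X * emeasure lborel {z. ennreal (2 powr real_of_int k) < M z}
        \<le> ?X * emeasure lborel {z. ?X < dyadic_maximal L (\<lambda>w. f w * indicator (S k) w) z}"
        by (intro mult_left_mono emeasure_mono) auto
      also have "\<dots> \<le> ennreal (5 ^ DIM('a) * ?v) * (\<integral>\<^sup>+w\<in>S k. f w \<partial>lborel)"
        by (rule dyadic_maximal_weak_type) measurable
      finally have weak: "?X * emeasure lborel {z. ennreal (2 powr real_of_int k) < M z} \<le> \<dots>" .
      \<comment> \<open>One factor 2^k / 2 is set aside for the weak type estimate; the remaining
        2^((u-1)k) is summed later.\<close>
      have p: "2 powr (u * (real_of_int k + 1)) = 2 powr (u + 1) * 2 powr ((u - 1) * real_of_int k) * (2 powr real_of_int k / 2)"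
      proof -
        have "2 powr real_of_int k / 2 = 2 powr (real_of_int k - 1)" by (simp add: powr_diff)
        then show ?thesis by (simp add: algebra_simps flip: powr_add)
      qed
      have "ennreal (2 powr (u * (real_of_int k + 1))) * emeasure lborel {z. ennreal (2 powr real_of_int k) < M z}
        = ennreal (2 powr (u + 1) * 2 powr ((u - 1) * real_of_int k)) * (?X * emeasure lborel {z. ennreal (2 powr real_of_int k) < M z})"
        unfolding p by (subst ennreal_mult) (auto simp only: mult.assoc powr_ge_zero mult_nonneg_nonneg divide_nonneg_nonneg zero_le_numeral)
      also have "\<dots> \<le> ennreal (2 powr (u + 1) * 2 powr ((u - 1) * real_of_int k)) * (ennreal (5 ^ DIM('a) * ?v) * (\<integral>\<^sup>+w\<in>S k. f w \<partial>lborel))"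
        by (intro mult_left_mono weak) auto
      also have "\<dots> = ennreal c1 * (ennreal (2 powr ((u - 1) * real_of_int k)) * (\<integral>\<^sup>+w\<in>S k. f w \<partial>lborel))"
        by (simp add: c1_def ennreal_mult mult_ac)
      finally show ?thesis .
    qed
    have "(\<integral>\<^sup>+k. \<integral>\<^sup>+w. ennreal (2 powr ((u - 1) * real_of_int k)) * (f w * indicator (S k) w) \<partial>lborel \<partial>count_space UNIV)
       = (\<integral>\<^sup>+w. \<integral>\<^sup>+k. ennreal (2 powr ((u - 1) * real_of_int k)) * (f w * indicator (S k) w) \<partial>count_space UNIV \<partial>lborel)"
      by (rule nn_integral_count_space_nn_integral[symmetric]) auto
    also have "\<dots> = (\<integral>\<^sup>+w. f w * (\<integral>\<^sup>+k. ennreal (2 powr ((u - 1) * real_of_int k)) * indicator {k. ennreal (2 powr real_of_int k) < ennreal (2 * ?v) * f w} k \<partial>count_space UNIV) \<partial>lborel)"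
      by (intro nn_integral_cong, subst nn_integral_cmult[symmetric]) (auto simp: S_def indicator_def mult_ac)
    also have "\<dots> \<le> (\<integral>\<^sup>+w. f w * (ennreal c2 * (ennreal (2 * ?v) * f w) powe (u - 1)) \<partial>lborel)"
      unfolding c2_def using u by (intro nn_integral_mono mult_left_mono nn_integral_geometric_less) auto
    also have "\<dots> = (\<integral>\<^sup>+w. ennreal (c2 * (2 * ?v) powr (u - 1)) * f w powe u \<partial>lborel)"
    proof (intro nn_integral_cong)
      fix w
      have "f w powe u = f w powe 1 * f w powe (u - 1)" by (simp flip: ennreal_powr_add del: ennreal_powr_one)
      moreover have "(ennreal (2 * ?v) * f w) powe (u - 1) = ennreal ((2 * ?v) powr (u - 1)) * f w powe (u - 1)"
        using v by (subst ennreal_powr_mult) (simp add: ennreal_powr_ennreal del: ennreal_mult')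
      ultimately show "f w * (ennreal c2 * (ennreal (2 * ?v) * f w) powe (u - 1)) = ennreal (c2 * (2 * ?v) powr (u - 1)) * f w powe u"
        using c2 by (simp add: ennreal_mult mult_ac)
    qed
    also have "\<dots> = ennreal (c2 * (2 * ?v) powr (u - 1)) * (\<integral>\<^sup>+w. f w powe u \<partial>lborel)"
      by (simp add: nn_integral_cmult)
    finally have inner: "(\<integral>\<^sup>+k. \<integral>\<^sup>+w. ennreal (2 powr ((u - 1) * real_of_int k)) * (f w * indicator (S k) w) \<partial>lborel \<partial>count_space UNIV)
      \<le> ennreal (c2 * (2 * ?v) powr (u - 1)) * (\<integral>\<^sup>+w. f w powe u \<partial>lborel)" .
    have "(\<integral>\<^sup>+z. M z powe u \<partial>lborel)
      \<le> (\<integral>\<^sup>+z. \<integral>\<^sup>+k. ennreal (2 powr (u * (real_of_int k + 1))) * indicator {z. ennreal (2 powr real_of_int k) < M z} z \<partial>count_space UNIV \<partial>lborel)"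
    proof (rule nn_integral_mono)
      fix z
      have "M z powe u \<le> (\<integral>\<^sup>+k. ennreal (2 powr (u * (real_of_int k + 1))) * indicator {k. ennreal (2 powr real_of_int k) < M z} k \<partial>count_space UNIV)"
        using u by (intro ennreal_powr_le_layers) auto
      then show "M z powe u \<le> (\<integral>\<^sup>+k. ennreal (2 powr (u * (real_of_int k + 1))) * indicator {z. ennreal (2 powr real_of_int k) < M z} z \<partial>count_space UNIV)"
        by (simp add: indicator_def)
    qed
    also have "\<dots> = (\<integral>\<^sup>+k. \<integral>\<^sup>+z. ennreal (2 powr (u * (real_of_int k + 1))) * indicator {z. ennreal (2 powr real_of_int k) < M z} z \<partial>lborel \<partial>count_space UNIV)"
      by (rule nn_integral_count_space_nn_integral) auto
    also have "\<dots> = (\<integral>\<^sup>+k. ennreal (2 powr (u * (real_of_int k + 1))) * emeasure lborel {z. ennreal (2 powr real_of_int k) < M z} \<partial>count_space UNIV)"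
      by (intro nn_integral_cong nn_integral_cmult_indicator) auto
    also have "\<dots> \<le> (\<integral>\<^sup>+k. ennreal c1 * (ennreal (2 powr ((u - 1) * real_of_int k)) * (\<integral>\<^sup>+w\<in>S k. f w \<partial>lborel)) \<partial>count_space UNIV)"
      by (intro nn_integral_mono level)
    also have "\<dots> = ennreal c1 * (\<integral>\<^sup>+k. \<integral>\<^sup>+w. ennreal (2 powr ((u - 1) * real_of_int k)) * (f w * indicator (S k) w) \<partial>lborel \<partial>count_space UNIV)"
      by (simp add: nn_integral_cmult)
    also have "\<dots> \<le> ennreal c1 * (ennreal (c2 * (2 * ?v) powr (u - 1)) * (\<integral>\<^sup>+w. f w powe u \<partial>lborel))"
      by (intro mult_left_mono inner) simp
    finally show "(\<integral>\<^sup>+z. dyadic_maximal L f z powe u \<partial>lborel) \<le> ennreal (c1 * c2 * (2 * ?v) powr (u - 1)) * (\<integral>\<^sup>+z. f z powe u \<partial>lborel)"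
      using c1 c2 by (simp add: M_def ennreal_mult mult_ac)
  qed
qed

section \<open>The trilinear form at a single scale\<close>

lemma nn_integral_cball_eq_average:
  fixes z :: "'a::euclidean_space"
  shows "(\<integral>\<^sup>+w\<in>cball z (2 powr real_of_int l). f w \<partial>lborel)
    = ennreal (2 powr (real DIM('a) * real_of_int l)) * dyadic_average l f z"
  unfolding dyadic_average_def
  by (simp add: mult.assoc[symmetric] ennreal_mult[symmetric] powr_add[symmetric])

text \<open>Hoelder's inequality against the indicator of B, with weight a/q.\<close>

lemma nn_integral_Jensen_restrict:
  assumes [measurable]: "f \<in> borel_measurable M" "B \<in> sets M" and "0 < a" "a \<le> q"
  shows "(\<integral>\<^sup>+w\<in>B. f w powe a \<partial>M) \<le> (\<integral>\<^sup>+w\<in>B. f w powe q \<partial>M) powe (a / q) * emeasure M B powe (1 - a / q)"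
\<comment> \<open>Hoelder needs a/q < 1. For a = q the last factor is a zeroth power, which is 0 at
  0 by the convention for \<open>powr\<close>, so a null set B must be treated apart.\<close>
proof (cases "a = q")
  case True
  show ?thesis
  proof (cases "emeasure M B = 0")
    case True
    then have "B \<in> null_sets M" by auto
    then have "(\<integral>\<^sup>+w\<in>B. f w powe a \<partial>M) = 0" by (rule nn_integral_null_set)
    then show ?thesis by simp
  next
    case False
    have "(1::ennreal) \<le> emeasure M B powe 0"
      using False by (cases "emeasure M B") (auto simp: ennreal_powr_ennreal)
    then show ?thesis using \<open>a = q\<close> \<open>0 < a\<close> mult_left_mono[of 1 "emeasure M B powe 0" "\<integral>\<^sup>+w\<in>B. f w powe a \<partial>M"] by simp
  qed
next
  case False
  have "(\<integral>\<^sup>+w\<in>B. f w powe a \<partial>M) = (\<integral>\<^sup>+w. (f w powe q * indicator B w) powe (a / q) * indicator B w powe (1 - a / q) \<partial>M)"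
    using assms by (intro nn_integral_cong) (auto simp: ennreal_powr_powr split: split_indicator)
  also have "\<dots> \<le> (\<integral>\<^sup>+w. f w powe q * indicator B w \<partial>M) powe (a / q) * (\<integral>\<^sup>+w. indicator B w \<partial>M) powe (1 - a / q)"
    using assms False by (intro nn_integral_Hoelder) auto
  finally show ?thesis by simp
qed

text \<open>With the normalization by 2^(ln) a ball has mass equal to the unit ball volume instead
  of 1; this is the origin of the constant in Jensen's inequality.\<close>

lemma dyadic_average_Jensen:
  fixes z :: "'a::euclidean_space"
  assumes [measurable]: "f \<in> borel_measurable borel" and a: "0 < a" "a \<le> q"
  shows "dyadic_average l (\<lambda>w. f w powe a) z powe (1 / a)
     \<le> ennreal (unit_ball_vol (real DIM('a)) powr (1 / a - 1 / q)) * dyadic_average l (\<lambda>w. f w powe q) z powe (1 / q)"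
proof -
  let ?v = "unit_ball_vol (real DIM('a))"
  let ?B = "cball z (2 powr real_of_int l)"
  define N where "N = 2 powr (- real DIM('a) * real_of_int l)"
  have N: "N > 0" and v: "?v > 0" by (simp_all add: N_def)
  define I where "I = (\<integral>\<^sup>+w\<in>?B. f w powe q \<partial>lborel)"
  have B: "emeasure lborel ?B = ennreal (?v / N)"
    unfolding emeasure_cball_dyadic N_def by (simp add: powr_minus field_simps)
  have "(\<integral>\<^sup>+w\<in>?B. f w powe a \<partial>lborel) \<le> I powe (a / q) * ennreal (?v / N) powe (1 - a / q)"
    using nn_integral_Jensen_restrict[of f lborel ?B a q] a unfolding B I_def by simp
  then have "dyadic_average l (\<lambda>w. f w powe a) z \<le> ennreal N * (I powe (a / q) * ennreal (?v / N) powe (1 - a / q))"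
    unfolding dyadic_average_def N_def[symmetric] by (rule mult_left_mono) simp
  also have "ennreal N = ennreal N powe (a / q) * ennreal N powe (1 - a / q)"
    by (simp flip: ennreal_powr_add)
  also have "\<dots> * (I powe (a / q) * ennreal (?v / N) powe (1 - a / q)) = (ennreal N * I) powe (a / q) * (ennreal N * ennreal (?v / N)) powe (1 - a / q)"
    by (simp add: ennreal_powr_mult mult_ac)
  also have "ennreal N * ennreal (?v / N) = ennreal ?v"
    using N v by (simp flip: ennreal_mult)
  finally have "dyadic_average l (\<lambda>w. f w powe a) z powe (1 / a) \<le> ((ennreal N * I) powe (a / q) * ennreal ?v powe (1 - a / q)) powe (1 / a)"
    using a by (intro ennreal_powr_mono) auto
  also have "\<dots> = ennreal (?v powr (1 / a - 1 / q)) * (ennreal N * I) powe (1 / q)"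
  proof -
    have 1: "(1 - a / q) * (1 / a) = 1 / a - 1 / q" and 2: "(a / q) * (1 / a) = 1 / q"
      using a by (simp_all add: field_simps)
    have "(ennreal ?v powe (1 - a / q)) powe (1 / a) = ennreal (?v powr (1 / a - 1 / q))"
      unfolding ennreal_powr_powr 1 by (rule ennreal_powr_ennreal) (use v in simp)
    moreover have "((ennreal N * I) powe (a / q)) powe (1 / a) = (ennreal N * I) powe (1 / q)"
      unfolding ennreal_powr_powr 2 ..
    ultimately show ?thesis
      by (subst ennreal_powr_mult) (simp only: mult.commute)
  qed
  finally show ?thesis unfolding dyadic_average_def N_def I_def .
qed

text \<open>The Morrey condition tested on balls of dyadic radius instead of dyadic cubes: L^q means
  at scale l are at most of order 2^(-ln/p). The constant is a parameter, so that restrictions and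
  lower exponents can be tracked through A alone.\<close>

definition morrey_bound :: "real \<Rightarrow> real \<Rightarrow> ennreal \<Rightarrow> ('a::euclidean_space \<Rightarrow> ennreal) \<Rightarrow> bool" where
  "morrey_bound p q A f \<longleftrightarrow> (\<forall>l z. dyadic_average l (\<lambda>w. f w powe q) z powe (1 / q)
      \<le> A * ennreal (2 powr (- (real DIM('a) / p) * real_of_int l)))"

lemma morrey_boundD:
  fixes f :: "'a::euclidean_space \<Rightarrow> ennreal"
  shows "morrey_bound p q A f \<Longrightarrow> dyadic_average l (\<lambda>w. f w powe q) z powe (1 / q)
      \<le> A * ennreal (2 powr (- (real DIM('a) / p) * real_of_int l))"
  by (simp add: morrey_bound_def)

lemma morrey_bound_mono:
  assumes "morrey_bound p q A f" "\<And>x. g x \<le> f x" "q > 0"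
  shows "morrey_bound p q A g"
  unfolding morrey_bound_def
proof (intro allI)
  fix l and z :: 'a
  have "dyadic_average l (\<lambda>w. g w powe q) z powe (1 / q) \<le> dyadic_average l (\<lambda>w. f w powe q) z powe (1 / q)"
    using assms by (intro ennreal_powr_mono dyadic_average_mono) auto
  also have "\<dots> \<le> A * ennreal (2 powr (- (real DIM('a) / p) * real_of_int l))"
    using assms(1) by (simp add: morrey_bound_def)
  finally show "dyadic_average l (\<lambda>w. g w powe q) z powe (1 / q) \<le> \<dots>" .
qed

text \<open>Morrey spaces grow when the second exponent decreases, by Jensen. The lemma brings f1 to
  exponent a and f2 to exponent 1, those of the trilinear Hoelder inequality.\<close>

lemma morrey_bound_lower_exponent:
  fixes f :: "'a::euclidean_space \<Rightarrow> ennreal"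
  assumes "morrey_bound p q A f" and [measurable]: "f \<in> borel_measurable borel" and a: "0 < a" "a \<le> q"
  shows "morrey_bound p a (ennreal (unit_ball_vol (real DIM('a)) powr (1 / a - 1 / q)) * A) f"
  unfolding morrey_bound_def
proof (intro allI)
  fix l and z :: 'a
  have "dyadic_average l (\<lambda>w. f w powe a) z powe (1 / a) \<le> ennreal (unit_ball_vol (real DIM('a)) powr (1 / a - 1 / q)) * dyadic_average l (\<lambda>w. f w powe q) z powe (1 / q)"
    using a by (intro dyadic_average_Jensen) auto
  also have "\<dots> \<le> ennreal (unit_ball_vol (real DIM('a)) powr (1 / a - 1 / q)) * (A * ennreal (2 powr (- (real DIM('a) / p) * real_of_int l)))"
    using assms(1) by (intro mult_left_mono) (simp_all add: morrey_bound_def)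
  finally show "dyadic_average l (\<lambda>w. f w powe a) z powe (1 / a)
    \<le> ennreal (unit_ball_vol (real DIM('a)) powr (1 / a - 1 / q)) * A * ennreal (2 powr (- (real DIM('a) / p) * real_of_int l))"
    by (simp add: mult.assoc)
qed

definition trilinear_scale :: "int \<Rightarrow> ('a::euclidean_space \<Rightarrow> ennreal) \<Rightarrow> ('a \<Rightarrow> ennreal) \<Rightarrow> ('a \<Rightarrow> ennreal) \<Rightarrow> ennreal" where
  "trilinear_scale l f1 f2 g = (\<integral>\<^sup>+x. (\<integral>\<^sup>+y. f1 (x + y) * f2 (x - y) * indicator (cball 0 (2 powr real_of_int l)) y \<partial>lborel) * g x \<partial>lborel)"

text \<open>For x in the support of g and y in the ball of radius 2^l, both x + y and x - y stay in
  the enlarged ball. Morrey bounds are local, so this restriction precedes their use with the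
  trilinear inequality.\<close>

lemma trilinear_scale_localize:
  assumes "\<And>x. x \<notin> cball c R \<Longrightarrow> g x = 0" "R + 2 powr real_of_int l \<le> R'"
  shows "trilinear_scale l f1 f2 g
    = trilinear_scale l (\<lambda>x. f1 x * indicator (cball c R') x) (\<lambda>x. f2 x * indicator (cball c R') x) g"
  unfolding trilinear_scale_def
proof (rule nn_integral_cong)
  fix x :: 'a
  show "(\<integral>\<^sup>+y. f1 (x + y) * f2 (x - y) * indicator (cball 0 (2 powr real_of_int l)) y \<partial>lborel) * g x
    = (\<integral>\<^sup>+y. f1 (x + y) * indicator (cball c R') (x + y) * (f2 (x - y) * indicator (cball c R') (x - y)) * indicator (cball 0 (2 powr real_of_int l)) y \<partial>lborel) * g x"
  proof (cases "x \<in> cball c R")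
    case True
    have "x + y \<in> cball c R' \<and> x - y \<in> cball c R'" if "y \<in> cball 0 (2 powr real_of_int l)" for y
    proof -
      have "dist c (x + y) \<le> dist c x + norm y" "dist c (x - y) \<le> dist c x + norm y"
        using dist_triangle[of c "x + y" x] dist_triangle[of c "x - y" x] by (simp_all add: dist_norm)
      then show ?thesis using True that assms(2) by simp
    qed
    then have "(\<integral>\<^sup>+y. f1 (x + y) * f2 (x - y) * indicator (cball 0 (2 powr real_of_int l)) y \<partial>lborel)
      = (\<integral>\<^sup>+y. f1 (x + y) * indicator (cball c R') (x + y) * (f2 (x - y) * indicator (cball c R') (x - y)) * indicator (cball 0 (2 powr real_of_int l)) y \<partial>lborel)"
      by (intro nn_integral_cong) (auto split: split_indicator)
    then show ?thesis by simp
  qed (use assms in simp)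
qed

text \<open>The restriction on y is simply dropped; this is affordable once the functions have been
  localized to a ball of radius comparable to 2^l.\<close>

lemma trilinear_scale_le:
  fixes f1 f2 g :: "'a::euclidean_space \<Rightarrow> ennreal"
  assumes [measurable]: "f1 \<in> borel_measurable borel" "f2 \<in> borel_measurable borel" "g \<in> borel_measurable borel"
    and a: "1 < a" and b: "1 / a + 1 / b = 1"
  shows "trilinear_scale l f1 f2 g
    \<le> (\<integral>\<^sup>+x. f1 x powe a \<partial>lborel) powe (1 / a) * (\<integral>\<^sup>+x. f2 x \<partial>lborel) * (\<integral>\<^sup>+x. g x powe b \<partial>lborel) powe (1 / b)"
proof -
  have "trilinear_scale l f1 f2 g \<le> (\<integral>\<^sup>+x. (\<integral>\<^sup>+y. f1 (x + y) * f2 (x - y) \<partial>lborel) * g x \<partial>lborel)"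
    unfolding trilinear_scale_def
    by (intro nn_integral_mono mult_right_mono) (auto split: split_indicator)
  also have "\<dots> = (\<integral>\<^sup>+x. \<integral>\<^sup>+y. f1 (x + y) * f2 (x - y) * g x \<partial>lborel \<partial>lborel)"
    by (simp add: nn_integral_multc)
  also note nn_integral_trilinear[OF assms]
  finally show ?thesis .
qed

text \<open>Integrating over all balls of radius 2^l counts each x with weight V, the volume of such
  a ball. On one ball f1 and f2 may be cut to the doubled ball, and the trilinear inequality yields
  three averages over it together with 2^(n(l+1)) to the power 1/a + 1 + 1/b = 2. Dividing by V
  leaves 4^n 2^(nl) over the unit ball volume.\<close>

lemma trilinear_scale_le_averages:
  fixes f1 f2 g :: "'a::euclidean_space \<Rightarrow> ennreal"
  assumes [measurable]: "f1 \<in> borel_measurable borel" "f2 \<in> borel_measurable borel" "g \<in> borel_measurable borel"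
    and a: "1 < a" and b: "1 / a + 1 / b = 1"
  shows "trilinear_scale l f1 f2 g \<le> ennreal (4 ^ DIM('a) / unit_ball_vol (real DIM('a)) * 2 powr (real DIM('a) * real_of_int l)) *
    (\<integral>\<^sup>+z. dyadic_average (l + 1) (\<lambda>w. f1 w powe a) z powe (1 / a) * dyadic_average (l + 1) f2 z
        * dyadic_average (l + 1) (\<lambda>w. g w powe b) z powe (1 / b) \<partial>lborel)"
    (is "_ \<le> _ * (\<integral>\<^sup>+z. ?A z \<partial>lborel)")
proof -
  let ?n = "real DIM('a)" let ?v = "unit_ball_vol ?n"
  let ?R = "2 powr real_of_int l"
  have v: "?v > 0" by simp
  have "1 / a < 1" using a by simp
  then have b0: "1 / b > 0" using b by linarith
  define \<Phi> where "\<Phi> x = (\<integral>\<^sup>+y. f1 (x + y) * f2 (x - y) * indicator (cball 0 ?R) y \<partial>lborel) * g x" for x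
  have [measurable]: "\<Phi> \<in> borel_measurable borel"
  proof -
    have [measurable]: "cball (0::'a) ?R \<in> sets borel" by simp
    show ?thesis unfolding \<Phi>_def using assms(3) by measurable
  qed
  define V where "V = ?v * 2 powr (?n * real_of_int l)"
  have V: "V > 0" using v by (simp add: V_def)
  have local: "(\<integral>\<^sup>+x. \<Phi> x * indicator (cball z ?R) x \<partial>lborel) \<le> ennreal (2 powr (2 * ?n * real_of_int (l + 1))) * ?A z" for z
  proof -
    let ?B = "cball z (2 powr real_of_int (l + 1))"
    let ?c = "\<lambda>f x. f x * indicator ?B x :: ennreal"
    have R: "?R + ?R \<le> 2 powr real_of_int (l + 1)" by (simp add: powr_add)
    have "(\<integral>\<^sup>+x. \<Phi> x * indicator (cball z ?R) x \<partial>lborel) = trilinear_scale l f1 f2 (\<lambda>x. g x * indicator (cball z ?R) x)"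
      by (simp add: trilinear_scale_def \<Phi>_def mult.assoc)
    also have "\<dots> = trilinear_scale l (?c f1) (?c f2) (\<lambda>x. g x * indicator (cball z ?R) x)"
      by (rule trilinear_scale_localize[OF _ R]) simp
    also have "\<dots> \<le> (\<integral>\<^sup>+x. ?c f1 x powe a \<partial>lborel) powe (1 / a) * (\<integral>\<^sup>+x. ?c f2 x \<partial>lborel) * (\<integral>\<^sup>+x. (g x * indicator (cball z ?R) x) powe b \<partial>lborel) powe (1 / b)"
      by (rule trilinear_scale_le[OF _ _ _ a b]) (auto intro!: borel_measurable_times_ennreal borel_measurable_indicator)
    also have "\<dots> \<le> (\<integral>\<^sup>+x. ?c f1 x powe a \<partial>lborel) powe (1 / a) * (\<integral>\<^sup>+x. ?c f2 x \<partial>lborel) * (\<integral>\<^sup>+x. ?c g x powe b \<partial>lborel) powe (1 / b)"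
    \<comment> \<open>The ball carrying g is enlarged as well, so that all three averages are taken
      over the same ball.\<close>
    proof (intro mult_left_mono ennreal_powr_mono nn_integral_mono)
      fix x show "indicator (cball z ?R) x \<le> (indicator ?B x :: ennreal)"
        using R by (auto split: split_indicator intro: order_trans)
    qed (use b0 in auto)
    also have "\<dots> = (ennreal (2 powr (?n * real_of_int (l + 1))) * dyadic_average (l + 1) (\<lambda>w. f1 w powe a) z) powe (1 / a)
       * (ennreal (2 powr (?n * real_of_int (l + 1))) * dyadic_average (l + 1) f2 z)
       * (ennreal (2 powr (?n * real_of_int (l + 1))) * dyadic_average (l + 1) (\<lambda>w. g w powe b) z) powe (1 / b)"
      unfolding ennreal_powr_mult[of _ "indicator _ _"] ennreal_powr_indicator nn_integral_cball_eq_average ..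
    also have "\<dots> = (ennreal (2 powr (?n * real_of_int (l + 1))) powe (1 / a) * ennreal (2 powr (?n * real_of_int (l + 1))) powe (1 / b))
       * ennreal (2 powr (?n * real_of_int (l + 1))) * ?A z"
      by (simp add: ennreal_powr_mult mult_ac)
    also have "ennreal (2 powr (?n * real_of_int (l + 1))) powe (1 / a) * ennreal (2 powr (?n * real_of_int (l + 1))) powe (1 / b)
      = ennreal (2 powr (?n * real_of_int (l + 1)))"
      by (simp add: b flip: ennreal_powr_add)
    also have "\<dots> * \<dots> = ennreal (2 powr (2 * ?n * real_of_int (l + 1)))"
      by (simp add: algebra_simps flip: ennreal_mult powr_add)
    finally show ?thesis .
  qed
  have "ennreal V * trilinear_scale l f1 f2 g = (\<integral>\<^sup>+x. \<Phi> x * ennreal V \<partial>lborel)"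
  proof -
    have "trilinear_scale l f1 f2 g = (\<integral>\<^sup>+x. \<Phi> x \<partial>lborel)" by (simp add: trilinear_scale_def \<Phi>_def)
    then show ?thesis by (subst nn_integral_multc) (auto simp: mult.commute)
  qed
  also have "\<dots> = (\<integral>\<^sup>+x. \<integral>\<^sup>+z. \<Phi> x * (if dist x z \<le> ?R then 1 else 0) \<partial>lborel \<partial>lborel)"
  \<comment> \<open>Membership in the ball is expressed by \<open>dist x z\<close>, which is
    symmetric in x and z and jointly measurable; this allows the two integrals to be
    exchanged.\<close>
  proof (rule nn_integral_cong)
    fix x :: 'a
    have "(\<integral>\<^sup>+z. \<Phi> x * (if dist x z \<le> ?R then 1 else 0) \<partial>lborel) = (\<integral>\<^sup>+z. \<Phi> x * indicator (cball x ?R) z \<partial>lborel)"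
      by (intro nn_integral_cong) (auto split: split_indicator)
    also have "\<dots> = \<Phi> x * ennreal V"
      by (simp add: nn_integral_cmult_indicator emeasure_cball_dyadic V_def)
    finally show "\<Phi> x * ennreal V = (\<integral>\<^sup>+z. \<Phi> x * (if dist x z \<le> ?R then 1 else 0) \<partial>lborel)" ..
  qed
  also have "\<dots> = (\<integral>\<^sup>+z. \<integral>\<^sup>+x. \<Phi> x * (if dist x z \<le> ?R then 1 else 0) \<partial>lborel \<partial>lborel)"
    by (rule lborel_pair.Fubini'[symmetric]) measurable
  also have "\<dots> = (\<integral>\<^sup>+z. \<integral>\<^sup>+x. \<Phi> x * indicator (cball z ?R) x \<partial>lborel \<partial>lborel)"
    by (intro nn_integral_cong) (auto simp: dist_commute split: split_indicator)
  also have "\<dots> \<le> (\<integral>\<^sup>+z. ennreal (2 powr (2 * ?n * real_of_int (l + 1))) * ?A z \<partial>lborel)"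
    by (rule nn_integral_mono) (rule local)
  also have "\<dots> = ennreal (2 powr (2 * ?n * real_of_int (l + 1))) * (\<integral>\<^sup>+z. ?A z \<partial>lborel)"
    by (rule nn_integral_cmult) measurable
  finally have *: "ennreal V * trilinear_scale l f1 f2 g \<le> \<dots>" .
  have "trilinear_scale l f1 f2 g = ennreal (1 / V) * (ennreal V * trilinear_scale l f1 f2 g)"
    using V by (simp add: mult.assoc[symmetric] flip: ennreal_mult)
  also have "\<dots> \<le> ennreal (1 / V) * (ennreal (2 powr (2 * ?n * real_of_int (l + 1))) * (\<integral>\<^sup>+z. ?A z \<partial>lborel))"
    by (intro mult_left_mono *) simp
  also have "\<dots> = ennreal (1 / V * 2 powr (2 * ?n * real_of_int (l + 1))) * (\<integral>\<^sup>+z. ?A z \<partial>lborel)"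
    using V by (simp add: mult.assoc[symmetric] flip: ennreal_mult)
  also have "1 / V * 2 powr (2 * ?n * real_of_int (l + 1)) = 4 ^ DIM('a) / ?v * 2 powr (?n * real_of_int l)"
  proof -
    have "2 powr (2 * ?n * real_of_int (l + 1)) = 2 powr (2 * ?n) * 2 powr (?n * real_of_int l) * 2 powr (?n * real_of_int l)"
      by (simp add: algebra_simps flip: powr_add)
    moreover have "2 powr (2 * ?n) = 4 ^ DIM('a)"
      by (simp add: powr_powr[symmetric] powr_realpow)
    ultimately show ?thesis using v by (simp add: V_def field_simps)
  qed
  finally show ?thesis .
qed

section \<open>Summing the scales\<close>

text \<open>The kernel weight 2^(l(\<alpha>-n)) meets 2^(ln) from the averaging lemma, leaving
  2^(l\<alpha>). Tonelli moves the sum over l inside the z-integral, where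
  \<open>nn_integral_Hedberg\<close> applies for each z: the Morrey bound is the better one at large
  scales, the maximal functions at small ones. The index L + 1 reflects that the averages are over
  doubled balls.\<close>

lemma trilinear_scale_sum_near:
  fixes f1 f2 g :: "'a::euclidean_space \<Rightarrow> ennreal"
  assumes [measurable]: "f1 \<in> borel_measurable borel" "f2 \<in> borel_measurable borel" "g \<in> borel_measurable borel"
    and a: "1 < a" and b: "1 / a + 1 / b = 1"
    and f1: "morrey_bound p1 a A1 f1" and f2: "morrey_bound p2 1 A2 f2" and A: "A1 * A2 < top"
    and \<gamma>: "\<gamma> = real DIM('a) / p1 + real DIM('a) / p2" and \<alpha>: "0 < \<alpha>" "\<alpha> < \<gamma>"
  shows "(\<integral>\<^sup>+l\<in>{..L}. ennreal (2 powr ((\<alpha> - real DIM('a)) * real_of_int l)) * trilinear_scale l f1 f2 g \<partial>count_space UNIV)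
    \<le> ennreal (4 ^ DIM('a) / unit_ball_vol (real DIM('a)) * (1 / (1 - 2 powr (-\<alpha>)) + 1 / (1 - 2 powr (-(\<gamma> - \<alpha>)))))
      * ((A1 * A2) powe (\<alpha> / \<gamma>) *
        (\<integral>\<^sup>+z. (dyadic_maximal (L + 1) (\<lambda>w. f1 w powe a) z powe (1 / a) * dyadic_maximal (L + 1) f2 z) powe (1 - \<alpha> / \<gamma>)
          * dyadic_maximal (L + 1) (\<lambda>w. g w powe b) z powe (1 / b) \<partial>lborel))"
proof -
  let ?n = "real DIM('a)"
  define K where "K = A1 * A2"
  define c where "c = 4 ^ DIM('a) / unit_ball_vol ?n"
  define c' where "c' = 1 / (1 - 2 powr (-\<alpha>)) + 1 / (1 - 2 powr (-(\<gamma> - \<alpha>)))"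
  define D where "D z = dyadic_maximal (L + 1) (\<lambda>w. f1 w powe a) z powe (1 / a) * dyadic_maximal (L + 1) f2 z" for z
  define G where "G z = dyadic_maximal (L + 1) (\<lambda>w. g w powe b) z powe (1 / b)" for z
  have [measurable]: "D \<in> borel_measurable borel" "G \<in> borel_measurable borel"
    unfolding D_def[abs_def] G_def[abs_def] by measurable
  have "1 / a < 1" using a by simp
  then have b0: "1 / b > 0" using b by linarith
  have c: "c \<ge> 0" by (simp add: c_def)
  have c': "c' \<ge> 0"
  proof -
    have "2 powr (-\<alpha>) < 1" "2 powr (-(\<gamma> - \<alpha>)) < 1" using \<alpha> by (auto intro!: powr_less_one)
    then show ?thesis unfolding c'_def by (intro add_nonneg_nonneg) auto
  qed
  let ?h = "\<lambda>l z. ennreal (2 powr (\<alpha> * real_of_int l)) * min (K * ennreal (2 powr (- \<gamma> * real_of_int l))) (D z)"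
  have scale: "ennreal (2 powr ((\<alpha> - ?n) * real_of_int l)) * trilinear_scale l f1 f2 g \<le> ennreal c * (\<integral>\<^sup>+z. ?h l z * G z \<partial>lborel)"
    if "l \<le> L" for l
  proof -
    let ?X1 = "\<lambda>z. dyadic_average (l + 1) (\<lambda>w. f1 w powe a) z powe (1 / a)"
    let ?X2 = "\<lambda>z. dyadic_average (l + 1) f2 z"
    let ?G = "\<lambda>z. dyadic_average (l + 1) (\<lambda>w. g w powe b) z powe (1 / b)"
    have pt: "?X1 z * ?X2 z * ?G z \<le> min (K * ennreal (2 powr (- \<gamma> * real_of_int l))) (D z) * G z" for z
    proof (rule mult_mono)
      have "?X1 z * ?X2 z \<le> (A1 * ennreal (2 powr (- (?n / p1) * real_of_int (l + 1)))) * (A2 * ennreal (2 powr (- (?n / p2) * real_of_int (l + 1))))"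
        using morrey_boundD[OF f1, of "l + 1" z] morrey_boundD[OF f2, of "l + 1" z] by (intro mult_mono) simp_all
      also have "\<dots> = K * ennreal (2 powr (- \<gamma> * real_of_int (l + 1)))"
      proof -
        have "- \<gamma> * real_of_int (l + 1) = - (?n / p1) * real_of_int (l + 1) + - (?n / p2) * real_of_int (l + 1)"
          by (simp only: \<gamma> minus_add_distrib distrib_right)
        then show ?thesis
          by (simp only: K_def powr_add ennreal_mult powr_ge_zero mult_ac)
      qed
      \<comment> \<open>Passing from l + 1 back to l only weakens the bound, since \<gamma> >
        0.\<close>
      also have "\<dots> \<le> K * ennreal (2 powr (- \<gamma> * real_of_int l))"
      proof (rule mult_left_mono[OF ennreal_leI])
        show "2 powr (- \<gamma> * real_of_int (l + 1)) \<le> 2 powr (- \<gamma> * real_of_int l)"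
          using \<alpha> by (simp add: distrib_left)
      qed simp
      finally show "?X1 z * ?X2 z \<le> min (K * ennreal (2 powr (- \<gamma> * real_of_int l))) (D z)"
        unfolding D_def using that a
        by (auto intro!: min.boundedI mult_mono ennreal_powr_mono dyadic_maximal_upper)
      show "?G z \<le> G z"
        unfolding G_def using that b0 by (intro ennreal_powr_mono dyadic_maximal_upper) auto
    qed auto
    have "ennreal (2 powr ((\<alpha> - ?n) * real_of_int l)) * trilinear_scale l f1 f2 g
      \<le> ennreal (2 powr ((\<alpha> - ?n) * real_of_int l)) * (ennreal (c * 2 powr (?n * real_of_int l)) * (\<integral>\<^sup>+z. ?X1 z * ?X2 z * ?G z \<partial>lborel))"
      unfolding c_def using a b by (intro mult_left_mono trilinear_scale_le_averages) auto
    also have "\<dots> = ennreal (2 powr ((\<alpha> - ?n) * real_of_int l) * (c * 2 powr (?n * real_of_int l))) * (\<integral>\<^sup>+z. ?X1 z * ?X2 z * ?G z \<partial>lborel)"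
      using c by (subst ennreal_mult[of "2 powr _"]) (auto simp: mult.assoc)
    also have "2 powr ((\<alpha> - ?n) * real_of_int l) * (c * 2 powr (?n * real_of_int l)) = c * 2 powr (\<alpha> * real_of_int l)"
    proof -
      have "2 powr (\<alpha> * real_of_int l) = 2 powr ((\<alpha> - ?n) * real_of_int l) * 2 powr (?n * real_of_int l)"
        by (simp add: algebra_simps flip: powr_add)
      then show ?thesis by (simp add: mult_ac)
    qed
    also have "ennreal (c * 2 powr (\<alpha> * real_of_int l)) * (\<integral>\<^sup>+z. ?X1 z * ?X2 z * ?G z \<partial>lborel)
       \<le> ennreal (c * 2 powr (\<alpha> * real_of_int l)) * (\<integral>\<^sup>+z. min (K * ennreal (2 powr (- \<gamma> * real_of_int l))) (D z) * G z \<partial>lborel)"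
      by (intro mult_left_mono nn_integral_mono pt) auto
    also have "\<dots> = ennreal c * (\<integral>\<^sup>+z. ennreal (2 powr (\<alpha> * real_of_int l)) * (min (K * ennreal (2 powr (- \<gamma> * real_of_int l))) (D z) * G z) \<partial>lborel)"
      using c by (subst ennreal_mult, simp, simp, subst nn_integral_cmult) (auto simp: mult.assoc)
    finally show ?thesis by (simp add: mult.assoc)
  qed
  have "(\<integral>\<^sup>+l\<in>{..L}. ennreal (2 powr ((\<alpha> - ?n) * real_of_int l)) * trilinear_scale l f1 f2 g \<partial>count_space UNIV)
    \<le> (\<integral>\<^sup>+l. ennreal c * (\<integral>\<^sup>+z. ?h l z * G z \<partial>lborel) \<partial>count_space UNIV)"
  proof (rule nn_integral_mono)
    fix l :: int
    show "ennreal (2 powr ((\<alpha> - ?n) * real_of_int l)) * trilinear_scale l f1 f2 g * indicator {..L} l \<le> ennreal c * (\<integral>\<^sup>+z. ?h l z * G z \<partial>lborel)"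
      using scale[of l] by (cases "l \<le> L") simp_all
  qed
  also have "\<dots> = ennreal c * (\<integral>\<^sup>+z. \<integral>\<^sup>+l. ?h l z * G z \<partial>count_space UNIV \<partial>lborel)"
    by (subst nn_integral_count_space_nn_integral) (auto simp: nn_integral_cmult)
  also have "\<dots> = ennreal c * (\<integral>\<^sup>+z. (\<integral>\<^sup>+l. ?h l z \<partial>count_space UNIV) * G z \<partial>lborel)"
    by (simp add: nn_integral_multc)
  also have "\<dots> \<le> ennreal c * (\<integral>\<^sup>+z. (ennreal c' * (K powe (\<alpha> / \<gamma>) * D z powe (1 - \<alpha> / \<gamma>))) * G z \<partial>lborel)"
    unfolding c'_def using A \<alpha>
    by (intro mult_left_mono nn_integral_mono mult_right_mono nn_integral_Hedberg) (auto simp: K_def)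
  also have "\<dots> = ennreal c * (\<integral>\<^sup>+z. ennreal c' * K powe (\<alpha> / \<gamma>) * (D z powe (1 - \<alpha> / \<gamma>) * G z) \<partial>lborel)"
    by (simp add: mult.assoc)
  also have "\<dots> = ennreal c * (ennreal c' * K powe (\<alpha> / \<gamma>) * (\<integral>\<^sup>+z. D z powe (1 - \<alpha> / \<gamma>) * G z \<partial>lborel))"
    by (subst nn_integral_cmult) auto
  also have "\<dots> = ennreal (c * c') * (K powe (\<alpha> / \<gamma>) * (\<integral>\<^sup>+z. D z powe (1 - \<alpha> / \<gamma>) * G z \<partial>lborel))"
    using c c' by (simp add: ennreal_mult mult.assoc)
  finally show ?thesis unfolding c_def c'_def K_def D_def G_def .
qed

text \<open>At scales above that of the support of g, all relevant points lie in a ball of radius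
  2^(l+m+1), and the L^b norm of g does not depend on l. Morrey bounds for f1 and f2 on this ball,
  together with the kernel weight, leave 2^(-ln(1/s-1/a)), which is summable over l \<ge> L because
  s < a. The parameter m allows a support larger than 2^L by a fixed factor.\<close>

lemma trilinear_scale_sum_far:
  fixes f1 f2 g :: "'a::euclidean_space \<Rightarrow> ennreal"
  assumes [measurable]: "f1 \<in> borel_measurable borel" "f2 \<in> borel_measurable borel" "g \<in> borel_measurable borel"
    and a: "1 < a" and b: "1 / a + 1 / b = 1"
    and f1: "morrey_bound p1 a A1 f1" and f2: "morrey_bound p2 1 A2 f2"
    and m: "0 \<le> m" and g: "\<And>x. x \<notin> cball c (2 powr real_of_int (L + m)) \<Longrightarrow> g x = 0"
    and s: "1 / s = 1 / p1 + 1 / p2 - \<alpha> / real DIM('a)" and sa: "0 < s" "s < a"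
  shows "(\<integral>\<^sup>+l\<in>{L..}. ennreal (2 powr ((\<alpha> - real DIM('a)) * real_of_int l)) * trilinear_scale l f1 f2 g \<partial>count_space UNIV)
    \<le> ennreal (2 powr (real DIM('a) * (1 / a + 1 - 1 / p1 - 1 / p2) * (real_of_int m + 1)) / (1 - 2 powr (- (real DIM('a) * (1 / s - 1 / a)))))
     * (A1 * A2 * ennreal (2 powr (- real DIM('a) * (1 / s - 1 / a) * real_of_int L)) * (\<integral>\<^sup>+x. g x powe b \<partial>lborel) powe (1 / b))"
proof -
  let ?n = "real DIM('a)"
  define \<beta> where "\<beta> = ?n * (1 / s - 1 / a)"
  define e where "e = ?n * (1 / a + 1 - 1 / p1 - 1 / p2)"
  define P where "P = A1 * A2 * (\<integral>\<^sup>+x. g x powe b \<partial>lborel) powe (1 / b)"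
  have \<beta>: "\<beta> > 0" using sa a by (simp add: \<beta>_def field_simps)
  have scale: "ennreal (2 powr ((\<alpha> - ?n) * real_of_int l)) * trilinear_scale l f1 f2 g
     \<le> P * ennreal (2 powr (e * (real_of_int m + 1))) * ennreal (2 powr (- \<beta> * real_of_int l))" if "L \<le> l" for l
  proof -
    \<comment> \<open>2^(l+m) dominates both the support radius 2^(L+m) and the range 2^l of y; one
      more doubling accommodates their sum.\<close>
    define k where "k = l + m + 1"
    let ?B = "cball c (2 powr real_of_int k)"
    let ?N = "2 powr (?n * real_of_int k)"
    have "2 powr real_of_int (L + m) \<le> 2 powr real_of_int (l + m)" "2 powr real_of_int l \<le> 2 powr real_of_int (l + m)"
      using that m by (auto intro!: powr_mono)
    moreover have "2 powr real_of_int (l + m) + 2 powr real_of_int (l + m) = 2 powr real_of_int k"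
      by (simp add: k_def powr_add)
    ultimately have R: "2 powr real_of_int (L + m) + 2 powr real_of_int l \<le> 2 powr real_of_int k"
      by linarith
    have "trilinear_scale l f1 f2 g = trilinear_scale l (\<lambda>x. f1 x * indicator ?B x) (\<lambda>x. f2 x * indicator ?B x) g"
      by (rule trilinear_scale_localize[OF g R])
    also have "\<dots> \<le> (\<integral>\<^sup>+x. (f1 x * indicator ?B x) powe a \<partial>lborel) powe (1 / a) * (\<integral>\<^sup>+x. f2 x * indicator ?B x \<partial>lborel) * (\<integral>\<^sup>+x. g x powe b \<partial>lborel) powe (1 / b)"
      by (rule trilinear_scale_le[OF _ _ _ a b]) (auto intro!: borel_measurable_times_ennreal borel_measurable_indicator)
    also have "\<dots> = (ennreal ?N * dyadic_average k (\<lambda>x. f1 x powe a) c) powe (1 / a) * (ennreal ?N * dyadic_average k f2 c) * (\<integral>\<^sup>+x. g x powe b \<partial>lborel) powe (1 / b)"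
      unfolding ennreal_powr_mult[of _ "indicator _ _"] ennreal_powr_indicator nn_integral_cball_eq_average ..
    also have "\<dots> = ennreal ?N powe (1 / a) * ennreal ?N * (dyadic_average k (\<lambda>x. f1 x powe a) c powe (1 / a) * dyadic_average k f2 c) * (\<integral>\<^sup>+x. g x powe b \<partial>lborel) powe (1 / b)"
      by (simp add: ennreal_powr_mult mult_ac)
    also have "\<dots> \<le> ennreal ?N powe (1 / a) * ennreal ?N * ((A1 * ennreal (2 powr (- (?n / p1) * real_of_int k))) * (A2 * ennreal (2 powr (- (?n / p2) * real_of_int k)))) * (\<integral>\<^sup>+x. g x powe b \<partial>lborel) powe (1 / b)"
      using morrey_boundD[OF f1, of k c] morrey_boundD[OF f2, of k c] by (intro mult_mono) simp_all
    also have "\<dots> = P * (ennreal ?N powe (1 / a) * ennreal ?N * ennreal (2 powr (- (?n / p1) * real_of_int k)) * ennreal (2 powr (- (?n / p2) * real_of_int k)))"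
      by (simp only: P_def mult_ac)
    also have "ennreal ?N powe (1 / a) * ennreal ?N * ennreal (2 powr (- (?n / p1) * real_of_int k)) * ennreal (2 powr (- (?n / p2) * real_of_int k))
       = ennreal (2 powr (e * real_of_int k))"
      by (simp add: ennreal_powr_ennreal powr_powr e_def algebra_simps flip: ennreal_mult powr_add)
    finally have "ennreal (2 powr ((\<alpha> - ?n) * real_of_int l)) * trilinear_scale l f1 f2 g
      \<le> ennreal (2 powr ((\<alpha> - ?n) * real_of_int l)) * (P * ennreal (2 powr (e * real_of_int k)))"
      by (intro mult_left_mono) auto
    also have "\<dots> = P * ennreal (2 powr ((\<alpha> - ?n) * real_of_int l) * 2 powr (e * real_of_int k))"
      by (simp add: ennreal_mult mult_ac)
    also have "2 powr ((\<alpha> - ?n) * real_of_int l) * 2 powr (e * real_of_int k) = 2 powr (e * (real_of_int m + 1)) * 2 powr (- \<beta> * real_of_int l)"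
    proof -
      \<comment> \<open>The relation defining s turns the total exponent of 2^l into the decay rate
        -\<beta>.\<close>
      have "\<alpha> - ?n + e = - \<beta>" using s by (simp add: e_def \<beta>_def field_simps)
      moreover have "(\<alpha> - ?n) * real_of_int l + e * real_of_int k = e * (real_of_int m + 1) + (\<alpha> - ?n + e) * real_of_int l"
        by (simp add: k_def algebra_simps)
      ultimately have "(\<alpha> - ?n) * real_of_int l + e * real_of_int k = e * (real_of_int m + 1) + (- \<beta>) * real_of_int l"
        by simp
      then show ?thesis by (simp flip: powr_add)
    qed
    also have "P * ennreal (2 powr (e * (real_of_int m + 1)) * 2 powr (- \<beta> * real_of_int l))
      = P * ennreal (2 powr (e * (real_of_int m + 1))) * ennreal (2 powr (- \<beta> * real_of_int l))"
      by (simp only: ennreal_mult powr_ge_zero mult.assoc)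
    finally show ?thesis .
  qed
  have "(\<integral>\<^sup>+l\<in>{L..}. ennreal (2 powr ((\<alpha> - ?n) * real_of_int l)) * trilinear_scale l f1 f2 g \<partial>count_space UNIV)
    \<le> (\<integral>\<^sup>+l. P * ennreal (2 powr (e * (real_of_int m + 1))) * (ennreal (2 powr (- \<beta> * real_of_int l)) * indicator {l. 2 powr real_of_int L \<le> 2 powr real_of_int l} l) \<partial>count_space UNIV)"
    using scale by (intro nn_integral_mono) (auto simp: split: split_indicator)
  also have "\<dots> = P * ennreal (2 powr (e * (real_of_int m + 1))) * (\<integral>\<^sup>+l. ennreal (2 powr (- \<beta> * real_of_int l)) * indicator {l. 2 powr real_of_int L \<le> 2 powr real_of_int l} l \<partial>count_space UNIV)"
    by (rule nn_integral_cmult) simp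
  also have "\<dots> \<le> P * ennreal (2 powr (e * (real_of_int m + 1))) * (ennreal (1 / (1 - 2 powr (-\<beta>))) * ennreal ((2 powr real_of_int L) powr (- \<beta>)))"
    using \<beta> by (intro mult_left_mono nn_integral_geometric_ge) auto
  also have "(2 powr real_of_int L) powr (- \<beta>) = 2 powr (- \<beta> * real_of_int L)"
    by (simp add: powr_powr mult.commute)
  also have "P * ennreal (2 powr (e * (real_of_int m + 1))) * (ennreal (1 / (1 - 2 powr (-\<beta>))) * ennreal (2 powr (- \<beta> * real_of_int L)))
    = (ennreal (2 powr (e * (real_of_int m + 1))) * ennreal (1 / (1 - 2 powr (-\<beta>)))) * (P * ennreal (2 powr (- \<beta> * real_of_int L)))"
    by (simp only: mult_ac)
  also have "ennreal (2 powr (e * (real_of_int m + 1))) * ennreal (1 / (1 - 2 powr (-\<beta>))) = ennreal (2 powr (e * (real_of_int m + 1)) / (1 - 2 powr (-\<beta>)))"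
    by (simp flip: ennreal_mult')
  finally show ?thesis by (simp add: P_def e_def \<beta>_def mult_ac)
qed

section \<open>Decomposition of the kernel into dyadic balls\<close>

text \<open>At y = 0 the left-hand side is 0 by division by zero.\<close>

lemma Riesz_kernel_le_scales:
  fixes y :: "'a::euclidean_space"
  assumes "\<alpha> < n"
  shows "ennreal (1 / norm y powr (n - \<alpha>)) \<le> ennreal (2 powr (n - \<alpha>)) *
     (\<integral>\<^sup>+l. ennreal (2 powr ((\<alpha> - n) * real_of_int l)) * indicator (cball 0 (2 powr real_of_int l)) y \<partial>count_space UNIV)"
proof (cases "y = 0")
  case False
  then have y: "norm y > 0" by simp
  \<comment> \<open>The least integer with |y| \<le> 2^l. Its term alone suffices, and |y| \<ge>
    2^(l-1) accounts for the factor 2^(n-\<alpha>).\<close>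
  define l where "l = \<lceil>log 2 (norm y)\<rceil>"
  have "real_of_int l - 1 < log 2 (norm y)" "log 2 (norm y) \<le> real_of_int l"
    unfolding l_def by linarith+
  then have l: "2 powr (real_of_int l - 1) \<le> norm y" "norm y \<le> 2 powr real_of_int l"
    using y by (simp_all add: less_log_iff log_le_iff)
  have "(2 powr (real_of_int l - 1)) powr (n - \<alpha>) \<le> norm y powr (n - \<alpha>)"
    using l assms by (intro powr_mono2) auto
  then have "1 / norm y powr (n - \<alpha>) \<le> 1 / (2 powr (real_of_int l - 1)) powr (n - \<alpha>)"
    using y by (intro divide_left_mono) auto
  also have "\<dots> = 2 powr (n - \<alpha>) * 2 powr ((\<alpha> - n) * real_of_int l)"
    by (simp add: powr_powr powr_minus_divide[symmetric] algebra_simps flip: powr_add)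
  finally have "ennreal (1 / norm y powr (n - \<alpha>)) \<le> ennreal (2 powr (n - \<alpha>)) * (ennreal (2 powr ((\<alpha> - n) * real_of_int l)) * indicator (cball 0 (2 powr real_of_int l)) y)"
    using l by (simp add: ennreal_leI flip: ennreal_mult)
  also have "\<dots> \<le> ennreal (2 powr (n - \<alpha>)) *
     (\<integral>\<^sup>+l. ennreal (2 powr ((\<alpha> - n) * real_of_int l)) * indicator (cball 0 (2 powr real_of_int l)) y \<partial>count_space UNIV)"
    by (intro mult_left_mono nn_integral_ge_point) auto
  finally show ?thesis .
qed simp

lemma fractional_integral_le_scales:
  fixes f1 f2 g :: "'a::euclidean_space \<Rightarrow> ennreal"
  assumes [measurable]: "f1 \<in> borel_measurable borel" "f2 \<in> borel_measurable borel" "g \<in> borel_measurable borel"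
    and "\<alpha> < n"
  shows "(\<integral>\<^sup>+x. (\<integral>\<^sup>+y. f1 (x + y) * f2 (x - y) * ennreal (1 / norm y powr (n - \<alpha>)) \<partial>lborel) * g x \<partial>lborel)
    \<le> ennreal (2 powr (n - \<alpha>)) * (\<integral>\<^sup>+l. ennreal (2 powr ((\<alpha> - n) * real_of_int l)) * trilinear_scale l f1 f2 g \<partial>count_space UNIV)"
proof -
  define \<Phi> where "\<Phi> l x = (\<integral>\<^sup>+y. f1 (x + y) * f2 (x - y) * indicator (cball 0 (2 powr real_of_int l)) y \<partial>lborel)" for l x
  have [measurable]: "cball (0::'a) r \<in> sets borel" for r by simp
  have [measurable]: "\<Phi> l \<in> borel_measurable borel" for l
    unfolding \<Phi>_def[abs_def] by measurable
  have "(\<integral>\<^sup>+y. f1 (x + y) * f2 (x - y) * ennreal (1 / norm y powr (n - \<alpha>)) \<partial>lborel)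
    \<le> ennreal (2 powr (n - \<alpha>)) * (\<integral>\<^sup>+l. ennreal (2 powr ((\<alpha> - n) * real_of_int l)) * \<Phi> l x \<partial>count_space UNIV)" for x
  proof -
    have "(\<integral>\<^sup>+y. f1 (x + y) * f2 (x - y) * ennreal (1 / norm y powr (n - \<alpha>)) \<partial>lborel)
      \<le> (\<integral>\<^sup>+y. f1 (x + y) * f2 (x - y) * (ennreal (2 powr (n - \<alpha>)) *
         (\<integral>\<^sup>+l. ennreal (2 powr ((\<alpha> - n) * real_of_int l)) * indicator (cball 0 (2 powr real_of_int l)) y \<partial>count_space UNIV)) \<partial>lborel)"
      using \<open>\<alpha> < n\<close> by (intro nn_integral_mono mult_left_mono Riesz_kernel_le_scales) auto
    also have "\<dots> = (\<integral>\<^sup>+y. \<integral>\<^sup>+l. ennreal (2 powr (n - \<alpha>)) * (ennreal (2 powr ((\<alpha> - n) * real_of_int l)) *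
         (f1 (x + y) * f2 (x - y) * indicator (cball 0 (2 powr real_of_int l)) y)) \<partial>count_space UNIV \<partial>lborel)"
      by (rule nn_integral_cong, subst nn_integral_cmult[symmetric], simp, subst nn_integral_cmult[symmetric], simp)
        (simp add: mult_ac)
    also have "\<dots> = (\<integral>\<^sup>+l. \<integral>\<^sup>+y. ennreal (2 powr (n - \<alpha>)) * (ennreal (2 powr ((\<alpha> - n) * real_of_int l)) *
         (f1 (x + y) * f2 (x - y) * indicator (cball 0 (2 powr real_of_int l)) y)) \<partial>lborel \<partial>count_space UNIV)"
      by (rule nn_integral_count_space_nn_integral) auto
    also have "\<dots> = ennreal (2 powr (n - \<alpha>)) * (\<integral>\<^sup>+l. ennreal (2 powr ((\<alpha> - n) * real_of_int l)) * \<Phi> l x \<partial>count_space UNIV)"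
      by (simp add: nn_integral_cmult \<Phi>_def)
    finally show ?thesis .
  qed
  then have "(\<integral>\<^sup>+x. (\<integral>\<^sup>+y. f1 (x + y) * f2 (x - y) * ennreal (1 / norm y powr (n - \<alpha>)) \<partial>lborel) * g x \<partial>lborel)
    \<le> (\<integral>\<^sup>+x. ennreal (2 powr (n - \<alpha>)) * (\<integral>\<^sup>+l. ennreal (2 powr ((\<alpha> - n) * real_of_int l)) * \<Phi> l x \<partial>count_space UNIV) * g x \<partial>lborel)"
    by (intro nn_integral_mono mult_right_mono) auto
  also have "\<dots> = (\<integral>\<^sup>+x. \<integral>\<^sup>+l. ennreal (2 powr (n - \<alpha>)) * (ennreal (2 powr ((\<alpha> - n) * real_of_int l)) * (\<Phi> l x * g x)) \<partial>count_space UNIV \<partial>lborel)"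
    by (intro nn_integral_cong, subst nn_integral_cmult[symmetric], simp, subst nn_integral_multc[symmetric]) (auto simp: mult_ac)
  also have "\<dots> = (\<integral>\<^sup>+l. \<integral>\<^sup>+x. ennreal (2 powr (n - \<alpha>)) * (ennreal (2 powr ((\<alpha> - n) * real_of_int l)) * (\<Phi> l x * g x)) \<partial>lborel \<partial>count_space UNIV)"
    by (rule nn_integral_count_space_nn_integral) auto
  also have "\<dots> = ennreal (2 powr (n - \<alpha>)) * (\<integral>\<^sup>+l. ennreal (2 powr ((\<alpha> - n) * real_of_int l)) * trilinear_scale l f1 f2 g \<partial>count_space UNIV)"
    by (simp add: nn_integral_cmult trilinear_scale_def \<Phi>_def[symmetric])
  finally show ?thesis .
qed

section \<open>The maximal operator in the dual estimate\<close>

text \<open>For t = 1 the test function h^(t-1) is \<open>h x powe 0\<close>. For finite h this is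
  the indicator of the set where h is positive, since a zeroth power is 0 at 0; that endpoint is
  treated separately below.\<close>

lemma ennreal_powr_zero_le_one: "x < top \<Longrightarrow> x powe 0 \<le> 1"
  by (cases x) (auto simp: ennreal_powr_ennreal)

lemma ennreal_powr_zero_eq_one: "0 < x \<Longrightarrow> x < top \<Longrightarrow> x powe 0 = 1"
  by (cases x) (auto simp: ennreal_powr_ennreal)

text \<open>The weights \<theta>/q1, \<theta>/q2 and 1 - 1/t sum to 1. Distributing them leaves the
  three maximal functions with exponents q1/a, q2 and t/((t-1)b), all above 1, so that the strong
  type bound removes each of them.\<close>

lemma dyadic_maximal_Hoelder:
  assumes a: "1 < a" "a < q1" and q2: "1 < q2" and b: "1 < b" and t: "1 \<le> t" "(t - 1) * b < t"
    and \<theta>: "0 < \<theta>" "\<theta> / q1 + \<theta> / q2 = 1 / t"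
  obtains C where "0 < C" and
    "\<And>L (f1::'a::euclidean_space \<Rightarrow> ennreal) f2 h.
      f1 \<in> borel_measurable borel \<Longrightarrow> f2 \<in> borel_measurable borel \<Longrightarrow> h \<in> borel_measurable borel \<Longrightarrow>
      (\<And>x. h x < top) \<Longrightarrow> 0 < (\<integral>\<^sup>+x. h x powe t \<partial>lborel) \<Longrightarrow> (\<integral>\<^sup>+x. h x powe t \<partial>lborel) < top \<Longrightarrow>
      (\<integral>\<^sup>+z. (dyadic_maximal L (\<lambda>w. f1 w powe a) z powe (1 / a) * dyadic_maximal L f2 z) powe \<theta>
         * dyadic_maximal L (\<lambda>w. (h w powe (t - 1)) powe b) z powe (1 / b) \<partial>lborel)
      \<le> ennreal C * ((\<integral>\<^sup>+x. f1 x powe q1 \<partial>lborel) powe (\<theta> / q1) * (\<integral>\<^sup>+x. f2 x powe q2 \<partial>lborel) powe (\<theta> / q2)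
           * (\<integral>\<^sup>+x. h x powe t \<partial>lborel) powe (1 - 1 / t))"
proof -
  have u1: "1 < q1 / a" using a by simp
  obtain C1 where C1: "0 < C1" "\<And>L (f::'a \<Rightarrow> ennreal). f \<in> borel_measurable borel \<Longrightarrow>
      (\<integral>\<^sup>+z. dyadic_maximal L f z powe (q1 / a) \<partial>lborel) \<le> ennreal C1 * (\<integral>\<^sup>+z. f z powe (q1 / a) \<partial>lborel)"
    using dyadic_maximal_strong_type[OF u1] by blast
  obtain C2 where C2: "0 < C2" "\<And>L (f::'a \<Rightarrow> ennreal). f \<in> borel_measurable borel \<Longrightarrow>
      (\<integral>\<^sup>+z. dyadic_maximal L f z powe q2 \<partial>lborel) \<le> ennreal C2 * (\<integral>\<^sup>+z. f z powe q2 \<partial>lborel)"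
    using dyadic_maximal_strong_type[OF q2] by blast
  have q1: "1 < q1" using a by simp
  have w: "0 < \<theta> / q1" "0 < \<theta> / q2" using \<theta> q1 q2 by simp_all
  have M1: "(\<integral>\<^sup>+z. dyadic_maximal L (\<lambda>w. f1 w powe a) z powe (q1 / a) \<partial>lborel) powe (\<theta> / q1)
     \<le> ennreal (C1 powr (\<theta> / q1)) * (\<integral>\<^sup>+x. f1 x powe q1 \<partial>lborel) powe (\<theta> / q1)"
    if [measurable]: "f1 \<in> borel_measurable borel" for L and f1 :: "'a \<Rightarrow> ennreal"
  proof -
    have "(\<integral>\<^sup>+z. dyadic_maximal L (\<lambda>w. f1 w powe a) z powe (q1 / a) \<partial>lborel) powe (\<theta> / q1)
       \<le> (ennreal C1 * (\<integral>\<^sup>+x. (f1 x powe a) powe (q1 / a) \<partial>lborel)) powe (\<theta> / q1)"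
      using w by (intro ennreal_powr_mono C1) auto
    also have "\<dots> = ennreal (C1 powr (\<theta> / q1)) * (\<integral>\<^sup>+x. f1 x powe q1 \<partial>lborel) powe (\<theta> / q1)"
      using C1(1) a by (simp add: ennreal_powr_mult ennreal_powr_ennreal ennreal_powr_powr)
    finally show ?thesis .
  qed
  have M2: "(\<integral>\<^sup>+z. dyadic_maximal L f2 z powe q2 \<partial>lborel) powe (\<theta> / q2)
     \<le> ennreal (C2 powr (\<theta> / q2)) * (\<integral>\<^sup>+x. f2 x powe q2 \<partial>lborel) powe (\<theta> / q2)"
    if [measurable]: "f2 \<in> borel_measurable borel" for L and f2 :: "'a \<Rightarrow> ennreal"
  proof -
    have "(\<integral>\<^sup>+z. dyadic_maximal L f2 z powe q2 \<partial>lborel) powe (\<theta> / q2)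
       \<le> (ennreal C2 * (\<integral>\<^sup>+x. f2 x powe q2 \<partial>lborel)) powe (\<theta> / q2)"
      using w by (intro ennreal_powr_mono C2) auto
    also have "\<dots> = ennreal (C2 powr (\<theta> / q2)) * (\<integral>\<^sup>+x. f2 x powe q2 \<partial>lborel) powe (\<theta> / q2)"
      using C2(1) by (simp add: ennreal_powr_mult ennreal_powr_ennreal)
    finally show ?thesis .
  qed
  have eq: "(X powe (1 / a) * Y) powe \<theta> = (X powe (q1 / a)) powe (\<theta> / q1) * (Y powe q2) powe (\<theta> / q2)" for X Y
    using q1 q2 by (simp add: ennreal_powr_mult ennreal_powr_powr)
  show ?thesis
  \<comment> \<open>At t = 1 the third weight is 0. The test function is then at most 1 and its
    maximal function bounded, so two-function Hoelder suffices; positivity and finiteness of the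
    integral of h^t make its zeroth power on the right equal to 1.\<close>
  proof (cases "t = 1")
    case True
    let ?c3 = "unit_ball_vol (real DIM('a)) powr (1 / b)"
    have v: "unit_ball_vol (real DIM('a)) > 0" by simp
    have \<theta>2: "\<theta> / q2 = 1 - \<theta> / q1" "\<theta> / q1 < 1" using \<theta>(2) True w by simp_all
    show ?thesis
    proof (rule that)
      show "0 < C1 powr (\<theta> / q1) * C2 powr (\<theta> / q2) * ?c3" using C1 C2 less_imp_neq[OF v] by simp
      fix L and f1 f2 h :: "'a \<Rightarrow> ennreal"
      assume [measurable]: "f1 \<in> borel_measurable borel" "f2 \<in> borel_measurable borel" "h \<in> borel_measurable borel"
        and h: "\<And>x. h x < top" "0 < (\<integral>\<^sup>+x. h x powe t \<partial>lborel)" "(\<integral>\<^sup>+x. h x powe t \<partial>lborel) < top"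
      let ?X = "dyadic_maximal L (\<lambda>w. f1 w powe a)" let ?Y = "dyadic_maximal L f2"
      let ?Z = "dyadic_maximal L (\<lambda>w. (h w powe (t - 1)) powe b)"
      have Z: "?Z z powe (1 / b) \<le> ennreal ?c3" for z
      proof -
        have "(h w powe (t - 1)) powe b \<le> ennreal 1" for w
          using ennreal_powr_zero_le_one[OF h(1)[of w]] True by (simp add: ennreal_powr_powr)
        then have "?Z z \<le> ennreal (unit_ball_vol (real DIM('a)) * 1)"
          by (rule dyadic_maximal_le_const)
        then have "?Z z powe (1 / b) \<le> ennreal (unit_ball_vol (real DIM('a))) powe (1 / b)"
          using b by (intro ennreal_powr_mono) auto
        then show ?thesis by (simp add: ennreal_powr_ennreal)
      qed
      have "(\<integral>\<^sup>+z. (?X z powe (1 / a) * ?Y z) powe \<theta> * ?Z z powe (1 / b) \<partial>lborel)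
         \<le> (\<integral>\<^sup>+z. (?X z powe (1 / a) * ?Y z) powe \<theta> * ennreal ?c3 \<partial>lborel)"
        by (rule nn_integral_mono, rule mult_left_mono[OF Z]) simp
      also have "\<dots> = (\<integral>\<^sup>+z. (?X z powe (q1 / a)) powe (\<theta> / q1) * (?Y z powe q2) powe (1 - \<theta> / q1) \<partial>lborel) * ennreal ?c3"
        unfolding eq \<theta>2 by (rule nn_integral_multc) measurable
      also have "\<dots> \<le> (\<integral>\<^sup>+z. ?X z powe (q1 / a) \<partial>lborel) powe (\<theta> / q1) * (\<integral>\<^sup>+z. ?Y z powe q2 \<partial>lborel) powe (1 - \<theta> / q1) * ennreal ?c3"
        using w \<theta>2 by (intro mult_right_mono nn_integral_Hoelder) auto
      also have "\<dots> \<le> (ennreal (C1 powr (\<theta> / q1)) * (\<integral>\<^sup>+x. f1 x powe q1 \<partial>lborel) powe (\<theta> / q1))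
         * (ennreal (C2 powr (\<theta> / q2)) * (\<integral>\<^sup>+x. f2 x powe q2 \<partial>lborel) powe (\<theta> / q2)) * ennreal ?c3"
        unfolding \<theta>2(1)[symmetric] by (intro mult_mono M1 M2) auto
      also have "\<dots> = ennreal (C1 powr (\<theta> / q1) * C2 powr (\<theta> / q2) * ?c3) * ((\<integral>\<^sup>+x. f1 x powe q1 \<partial>lborel) powe (\<theta> / q1) * (\<integral>\<^sup>+x. f2 x powe q2 \<partial>lborel) powe (\<theta> / q2)
           * (\<integral>\<^sup>+x. h x powe t \<partial>lborel) powe (1 - 1 / t))"
      proof -
        have "(\<integral>\<^sup>+x. h x powe t \<partial>lborel) powe (1 - 1 / t) = 1"
          using ennreal_powr_zero_eq_one[OF h(2,3)] True by simp
        then show ?thesis by (simp add: ennreal_mult mult_ac)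
      qed
      finally show "(\<integral>\<^sup>+z. (?X z powe (1 / a) * ?Y z) powe \<theta> * ?Z z powe (1 / b) \<partial>lborel) \<le> \<dots>" .
    qed
  next
    case False
    then have t1: "t > 1" using t by simp
    \<comment> \<open>Chosen so that raising (h^(t-1))^b to the power u gives h^t; u > 1 is the
      assumption (t-1)b < t.\<close>
    define u where "u = t / ((t - 1) * b)"
    have u: "1 < u" using t t1 b by (simp add: u_def field_simps)
    obtain C3 where C3: "0 < C3" "\<And>L (f::'a \<Rightarrow> ennreal). f \<in> borel_measurable borel \<Longrightarrow>
      (\<integral>\<^sup>+z. dyadic_maximal L f z powe u \<partial>lborel) \<le> ennreal C3 * (\<integral>\<^sup>+z. f z powe u \<partial>lborel)"
      using dyadic_maximal_strong_type[OF u] by blast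
    have t': "0 < 1 - 1 / t" "u * (1 - 1 / t) = 1 / b" "(t - 1) * b * u = t"
      using t1 b by (simp_all add: u_def field_simps)
    show ?thesis
    proof (rule that)
      show "0 < C1 powr (\<theta> / q1) * C2 powr (\<theta> / q2) * C3 powr (1 - 1 / t)" using C1 C2 C3 by simp
      fix L and f1 f2 h :: "'a \<Rightarrow> ennreal"
      assume [measurable]: "f1 \<in> borel_measurable borel" "f2 \<in> borel_measurable borel" "h \<in> borel_measurable borel"
      let ?X = "dyadic_maximal L (\<lambda>w. f1 w powe a)" let ?Y = "dyadic_maximal L f2"
      let ?Z = "dyadic_maximal L (\<lambda>w. (h w powe (t - 1)) powe b)"
      have M3: "(\<integral>\<^sup>+z. ?Z z powe u \<partial>lborel) powe (1 - 1 / t)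
        \<le> ennreal (C3 powr (1 - 1 / t)) * (\<integral>\<^sup>+x. h x powe t \<partial>lborel) powe (1 - 1 / t)"
      proof -
        have "(\<integral>\<^sup>+z. ?Z z powe u \<partial>lborel) powe (1 - 1 / t)
           \<le> (ennreal C3 * (\<integral>\<^sup>+x. ((h x powe (t - 1)) powe b) powe u \<partial>lborel)) powe (1 - 1 / t)"
          using t' by (intro ennreal_powr_mono C3) auto
        also have "\<dots> = ennreal (C3 powr (1 - 1 / t)) * (\<integral>\<^sup>+x. h x powe t \<partial>lborel) powe (1 - 1 / t)"
          unfolding ennreal_powr_powr t'(3) ennreal_powr_mult using C3(1) by (simp add: ennreal_powr_ennreal)
        finally show ?thesis .
      qed
      have "(\<integral>\<^sup>+z. (?X z powe (1 / a) * ?Y z) powe \<theta> * ?Z z powe (1 / b) \<partial>lborel)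
         = (\<integral>\<^sup>+z. (?X z powe (q1 / a)) powe (\<theta> / q1) * (?Y z powe q2) powe (\<theta> / q2) * (?Z z powe u) powe (1 - 1 / t) \<partial>lborel)"
        by (simp only: eq ennreal_powr_powr[of _ u] t')
      also have "\<dots> \<le> (\<integral>\<^sup>+z. ?X z powe (q1 / a) \<partial>lborel) powe (\<theta> / q1) * (\<integral>\<^sup>+z. ?Y z powe q2 \<partial>lborel) powe (\<theta> / q2)
         * (\<integral>\<^sup>+z. ?Z z powe u \<partial>lborel) powe (1 - 1 / t)"
        using w t' \<theta> by (intro nn_integral_Hoelder3) auto
      also have "\<dots> \<le> (ennreal (C1 powr (\<theta> / q1)) * (\<integral>\<^sup>+x. f1 x powe q1 \<partial>lborel) powe (\<theta> / q1))
         * (ennreal (C2 powr (\<theta> / q2)) * (\<integral>\<^sup>+x. f2 x powe q2 \<partial>lborel) powe (\<theta> / q2))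
         * (ennreal (C3 powr (1 - 1 / t)) * (\<integral>\<^sup>+x. h x powe t \<partial>lborel) powe (1 - 1 / t))"
        by (intro mult_mono M1 M2 M3) auto
      also have "\<dots> = ennreal (C1 powr (\<theta> / q1) * C2 powr (\<theta> / q2) * C3 powr (1 - 1 / t)) * ((\<integral>\<^sup>+x. f1 x powe q1 \<partial>lborel) powe (\<theta> / q1) * (\<integral>\<^sup>+x. f2 x powe q2 \<partial>lborel) powe (\<theta> / q2)
           * (\<integral>\<^sup>+x. h x powe t \<partial>lborel) powe (1 - 1 / t))"
        by (simp add: ennreal_mult mult_ac)
      finally show "(\<integral>\<^sup>+z. (?X z powe (1 / a) * ?Y z) powe \<theta> * ?Z z powe (1 / b) \<partial>lborel) \<le> \<dots>" .
    qed
  qed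
qed

text \<open>Jensen on the support B compares the exponents (t-1)b < t, at the cost of a power of the
  measure of B. For t = 1 the test function is bounded by the indicator of B instead.\<close>

lemma Lb_norm_conjugate_power_le:
  assumes [measurable]: "h \<in> borel_measurable M" "B \<in> sets M"
    and h: "\<And>x. x \<in> space M \<Longrightarrow> h x < top" "\<And>x. x \<notin> B \<Longrightarrow> h x = 0" "0 < (\<integral>\<^sup>+x. h x powe t \<partial>M)" "(\<integral>\<^sup>+x. h x powe t \<partial>M) < top"
    and b: "0 < b" and t: "1 \<le> t" "(t - 1) * b < t"
  shows "(\<integral>\<^sup>+x. (h x powe (t - 1)) powe b \<partial>M) powe (1 / b)
    \<le> (\<integral>\<^sup>+x. h x powe t \<partial>M) powe (1 - 1 / t) * emeasure M B powe (1 / b - 1 + 1 / t)"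
proof (cases "t = 1")
  case True
  have "(\<integral>\<^sup>+x. (h x powe (t - 1)) powe b \<partial>M) \<le> (\<integral>\<^sup>+x. indicator B x \<partial>M)"
    using True h ennreal_powr_zero_le_one
    by (intro nn_integral_mono) (auto simp: ennreal_powr_powr split: split_indicator)
  then have "(\<integral>\<^sup>+x. (h x powe (t - 1)) powe b \<partial>M) powe (1 / b) \<le> emeasure M B powe (1 / b)"
    using b by (intro ennreal_powr_mono) auto
  then show ?thesis using ennreal_powr_zero_eq_one[OF h(3,4)] True by simp
next
  case False
  let ?X = "\<integral>\<^sup>+x. h x powe t \<partial>M"
  have r: "h x powe r = h x powe r * indicator B x" for x r
    using h(2)[of x] by (auto split: split_indicator)
  have "(\<integral>\<^sup>+x. (h x powe (t - 1)) powe b \<partial>M) = (\<integral>\<^sup>+x\<in>B. h x powe ((t - 1) * b) \<partial>M)"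
    unfolding ennreal_powr_powr by (subst r) (rule refl)
  also have "\<dots> \<le> (\<integral>\<^sup>+x\<in>B. h x powe t \<partial>M) powe ((t - 1) * b / t) * emeasure M B powe (1 - (t - 1) * b / t)"
    using t b False by (intro nn_integral_Jensen_restrict) auto
  also have "(\<integral>\<^sup>+x\<in>B. h x powe t \<partial>M) = ?X" by (subst (2) r) (rule refl)
  finally have "(\<integral>\<^sup>+x. (h x powe (t - 1)) powe b \<partial>M) powe (1 / b)
    \<le> (?X powe ((t - 1) * b / t) * emeasure M B powe (1 - (t - 1) * b / t)) powe (1 / b)"
    using b by (intro ennreal_powr_mono) auto
  also have "\<dots> = ?X powe (1 - 1 / t) * emeasure M B powe (1 / b - 1 + 1 / t)"
  proof -
    have e: "(t - 1) * b / t * (1 / b) = 1 - 1 / t" "(1 - (t - 1) * b / t) * (1 / b) = 1 / b - 1 + 1 / t"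
      using b t by (simp_all add: field_simps)
    show ?thesis unfolding ennreal_powr_mult ennreal_powr_powr e ..
  qed
  finally show ?thesis .
qed

text \<open>On a single ball the Morrey bound controls the full L^q norm. The power \<theta>/q is
  the one with which f enters the weighted Hoelder inequality.\<close>

lemma localized_power_norm_le:
  fixes f :: "'a::euclidean_space \<Rightarrow> ennreal"
  assumes f: "morrey_bound p q A f" and "0 < q" "0 < \<theta>"
  shows "(\<integral>\<^sup>+x. (f x * indicator (cball c (2 powr real_of_int k)) x) powe q \<partial>lborel) powe (\<theta> / q)
    \<le> A powe \<theta> * ennreal (2 powr (real DIM('a) * real_of_int k * (\<theta> / q - \<theta> / p)))"
proof -
  let ?n = "real DIM('a)"
  let ?N = "2 powr (?n * real_of_int k)"
  have "(\<integral>\<^sup>+x. (f x * indicator (cball c (2 powr real_of_int k)) x) powe q \<partial>lborel)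
     = ennreal ?N * dyadic_average k (\<lambda>x. f x powe q) c"
    unfolding ennreal_powr_mult ennreal_powr_indicator nn_integral_cball_eq_average ..
  moreover have "\<theta> / q = 1 / q * \<theta>" by simp
  ultimately have "(\<integral>\<^sup>+x. (f x * indicator (cball c (2 powr real_of_int k)) x) powe q \<partial>lborel) powe (\<theta> / q)
     = (ennreal ?N powe (1 / q) * dyadic_average k (\<lambda>x. f x powe q) c powe (1 / q)) powe \<theta>"
    by (simp only: ennreal_powr_powr[symmetric] ennreal_powr_mult)
  also have "\<dots> \<le> (ennreal ?N powe (1 / q) * (A * ennreal (2 powr (- (?n / p) * real_of_int k)))) powe \<theta>"
    using assms by (intro ennreal_powr_mono mult_left_mono morrey_boundD) auto
  also have "\<dots> = A powe \<theta> * (ennreal ?N powe (1 / q) * ennreal (2 powr (- (?n / p) * real_of_int k))) powe \<theta>"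
    by (simp only: ennreal_powr_mult mult_ac)
  also have "ennreal ?N powe (1 / q) * ennreal (2 powr (- (?n / p) * real_of_int k)) = ennreal (2 powr (?n * real_of_int k * (1 / q - 1 / p)))"
    by (simp add: ennreal_powr_ennreal powr_powr algebra_simps flip: ennreal_mult powr_add)
  also have "\<dots> powe \<theta> = ennreal (2 powr (?n * real_of_int k * (\<theta> / q - \<theta> / p)))"
    by (simp add: ennreal_powr_ennreal powr_powr algebra_simps)
  finally show ?thesis .
qed

text \<open>Small and large scales give the same quantity \<open>E\<close>, with different
  constants. Here 2^L stands for the side of the cube and 2^(L+m) for the radius of a ball
  containing it; the constant may depend on m but not on L or c. The last factor is what is
  cancelled later against the integral of h^t.\<close>

lemma fractional_integral_dual_bound:
  fixes \<alpha> p1 p2 q1 q2 p q s t :: real and m :: int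
  assumes \<alpha>: "0 < \<alpha>" "\<alpha> < real DIM('a)" and q1: "q1 \<le> p1" and q2: "1 < q2" "q2 \<le> p2"
    and t: "1 \<le> t" "t \<le> s" and p: "1 / p = 1 / p1 + 1 / p2" and q: "1 / q = 1 / q1 + 1 / q2"
    and s: "1 / s = 1 / p - \<alpha> / real DIM('a)" and qp: "q / p = t / s" and sq: "s < q1" and m: "0 \<le> m"
  obtains C where "0 < C" and
    "\<And>L c (f1::'a::euclidean_space \<Rightarrow> ennreal) f2 h A1 A2.
      f1 \<in> borel_measurable borel \<Longrightarrow> f2 \<in> borel_measurable borel \<Longrightarrow> h \<in> borel_measurable borel \<Longrightarrow>
      morrey_bound p1 q1 A1 f1 \<Longrightarrow> morrey_bound p2 q2 A2 f2 \<Longrightarrow> A1 * A2 < top \<Longrightarrow>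
      (\<And>x. h x < top) \<Longrightarrow> (\<And>x. x \<notin> cball c (2 powr real_of_int (L + m)) \<Longrightarrow> h x = 0) \<Longrightarrow>
      0 < (\<integral>\<^sup>+x. h x powe t \<partial>lborel) \<Longrightarrow> (\<integral>\<^sup>+x. h x powe t \<partial>lborel) < top \<Longrightarrow>
      (\<integral>\<^sup>+x. (\<integral>\<^sup>+y. f1 (x + y) * f2 (x - y) * ennreal (1 / norm y powr (real DIM('a) - \<alpha>)) \<partial>lborel) * h x powe (t - 1) \<partial>lborel)
      \<le> ennreal C * (A1 * A2 * ennreal (2 powr (real DIM('a) * (1 / t - 1 / s) * real_of_int L))
          * (\<integral>\<^sup>+x. h x powe t \<partial>lborel) powe (1 - 1 / t))"
proof -
  let ?n = "real DIM('a)" let ?v = "unit_ball_vol ?n"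
  have v: "?v > 0" by simp
  \<comment> \<open>The midpoint is one choice of a strictly between s and q1: a > s gives decay at
    large scales, a < q1 makes the maximal exponent q1/a exceed 1, and s \<ge> t \<ge> 1 gives a >
    1.\<close>
  define a where "a = (s + q1) / 2"
  define b where "b = a / (a - 1)"
  define \<gamma> where "\<gamma> = ?n / p"
  define \<theta> where "\<theta> = 1 - \<alpha> / \<gamma>"
  have n: "?n > 0" by simp
  have a: "s < a" "a < q1" "1 < a" using sq t by (simp_all add: a_def)
  have b: "1 < b" "1 / a + 1 / b = 1" using a by (simp_all add: b_def field_simps)
  \<comment> \<open>With b = a/(a-1) this is equivalent to t < a, which follows from t \<le> s <
    a.\<close>
  have tb: "(t - 1) * b < t"
  proof -
    have "(t - 1) * a < t * (a - 1)" using a t by (simp add: algebra_simps)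
    then show ?thesis using a by (simp add: b_def field_simps)
  qed
  have q1': "1 < q1" using a by simp
  have "1 / p > 0" unfolding p using q1 q1' q2 by (intro add_pos_pos) auto
  then have p0: "p > 0" by simp
  have s0: "s > 0" using t by simp
  have \<gamma>: "\<gamma> = ?n / p1 + ?n / p2" "\<alpha> < \<gamma>"
  proof -
    show "\<gamma> = ?n / p1 + ?n / p2" unfolding \<gamma>_def using p by (metis distrib_left mult.right_neutral times_divide_eq_right)
    have "1 / s > 0" using s0 by simp
    then have "\<alpha> / ?n < 1 / p" using s by linarith
    then show "\<alpha> < \<gamma>" using n p0 by (simp add: \<gamma>_def field_simps)
  qed
  have \<theta>: "0 < \<theta>" "\<theta> = p / s"
  proof -
    show "0 < \<theta>" using \<gamma> \<alpha> by (simp add: \<theta>_def field_simps)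
    have "p * (1 / s) = p * (1 / p - \<alpha> / ?n)" using s by simp
    then show "\<theta> = p / s" using p0 by (simp add: \<theta>_def \<gamma>_def right_diff_distrib mult.commute)
  qed
  have "q \<noteq> 0" using q q1' q2 by (auto simp: add_nonneg_eq_0_iff)
  \<comment> \<open>The hypothesis q/p = t/s enters here: the weights of f1 and f2 sum to 1/t,
    leaving 1 - 1/t for h. Together with the sum 1/s of \<theta>/p1 and \<theta>/p2, this makes the
    powers of the radius combine to n(1/t - 1/s).\<close>
  have \<theta>q: "\<theta> / q1 + \<theta> / q2 = 1 / t"
  proof -
    have "\<theta> / q1 + \<theta> / q2 = \<theta> * (1 / q)" unfolding q by (simp add: distrib_left)
    also have "\<dots> = 1 / t" using qp p0 s0 t \<open>q \<noteq> 0\<close> by (simp add: \<theta> field_simps)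
    finally show ?thesis .
  qed
  have \<theta>p: "\<theta> / p1 + \<theta> / p2 = 1 / s"
  proof -
    have "\<theta> / p1 + \<theta> / p2 = \<theta> * (1 / p)" unfolding p by (simp add: distrib_left)
    also have "\<dots> = 1 / s" using p0 by (simp add: \<theta>)
    finally show ?thesis .
  qed
  have ts: "0 \<le> 1 / t - 1 / s" using t by (simp add: field_simps)
  obtain CM where CM: "0 < CM" 
    "\<And>L (f1::'a \<Rightarrow> ennreal) f2 h.
      f1 \<in> borel_measurable borel \<Longrightarrow> f2 \<in> borel_measurable borel \<Longrightarrow> h \<in> borel_measurable borel \<Longrightarrow>
      (\<And>x. h x < top) \<Longrightarrow> 0 < (\<integral>\<^sup>+x. h x powe t \<partial>lborel) \<Longrightarrow> (\<integral>\<^sup>+x. h x powe t \<partial>lborel) < top \<Longrightarrow>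
      (\<integral>\<^sup>+z. (dyadic_maximal L (\<lambda>w. f1 w powe a) z powe (1 / a) * dyadic_maximal L f2 z) powe \<theta>
         * dyadic_maximal L (\<lambda>w. (h w powe (t - 1)) powe b) z powe (1 / b) \<partial>lborel)
      \<le> ennreal CM * ((\<integral>\<^sup>+x. f1 x powe q1 \<partial>lborel) powe (\<theta> / q1) * (\<integral>\<^sup>+x. f2 x powe q2 \<partial>lborel) powe (\<theta> / q2)
           * (\<integral>\<^sup>+x. h x powe t \<partial>lborel) powe (1 - 1 / t))"
    using dyadic_maximal_Hoelder[OF a(3,2) q2(1) b(1) t(1) tb \<theta>(1) \<theta>q] by blast
  define v1 where "v1 = ?v powr (1 / a - 1 / q1)"
  define v2 where "v2 = ?v powr (1 / 1 - 1 / q2)"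
  have v12: "v1 > 0" "v2 > 0" using less_imp_neq[OF v] by (simp_all add: v1_def v2_def)
  define cn where "cn = 4 ^ DIM('a) / ?v * (1 / (1 - 2 powr (-\<alpha>)) + 1 / (1 - 2 powr (-(\<gamma> - \<alpha>))))"
  define e where "e = ?n * (1 / t - 1 / s)"
  define Cn where "Cn = cn * (v1 * v2) powr (\<alpha> / \<gamma>) * CM * 2 powr (e * (real_of_int m + 1))"
  define cf where "cf = 2 powr (?n * (1 / a + 1 - 1 / p1 - 1 / p2) * (real_of_int m + 1)) / (1 - 2 powr (- (?n * (1 / s - 1 / a))))"
  define Cf where "Cf = cf * (v1 * v2) * (?v * 2 powr (?n * real_of_int m)) powr (1 / b - 1 + 1 / t)"
  have cn: "cn > 0"
  proof -
    have "2 powr (-\<alpha>) < 1" "2 powr (-(\<gamma> - \<alpha>)) < 1" using \<alpha> \<gamma> by (auto intro!: powr_less_one)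
    then show ?thesis unfolding cn_def using v by (intro mult_pos_pos add_pos_pos) auto
  qed
  have cf: "cf > 0"
  proof -
    have "1 / a < 1 / s" using a s0 by (intro divide_strict_left_mono) auto
    then have "?n * (1 / s - 1 / a) > 0" using n by simp
    then have "2 powr (- (?n * (1 / s - 1 / a))) < 1" by (intro powr_less_one) auto
    then show ?thesis by (simp add: cf_def)
  qed
  have Cn: "Cn > 0" using cn CM(1) v12 by (simp add: Cn_def)
  have Cf: "Cf > 0" using cf v12 less_imp_neq[OF v] by (simp add: Cf_def)
  show ?thesis
  proof (rule that)
    show "0 < 2 powr (?n - \<alpha>) * (Cn + Cf)" using Cn Cf by simp
    fix L :: int and c and f1 f2 h :: "'a \<Rightarrow> ennreal" and A1 A2 :: ennreal
    assume [measurable]: "f1 \<in> borel_measurable borel" "f2 \<in> borel_measurable borel" "h \<in> borel_measurable borel"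
      and f1: "morrey_bound p1 q1 A1 f1" and f2: "morrey_bound p2 q2 A2 f2" and A: "A1 * A2 < top"
      and h: "\<And>x. h x < top" and supp: "\<And>x. x \<notin> cball c (2 powr real_of_int (L + m)) \<Longrightarrow> h x = 0"
      and X: "0 < (\<integral>\<^sup>+x. h x powe t \<partial>lborel)" "(\<integral>\<^sup>+x. h x powe t \<partial>lborel) < top"
    define H where "H = (\<integral>\<^sup>+x. h x powe t \<partial>lborel) powe (1 - 1 / t)"
    define E where "E = A1 * A2 * ennreal (2 powr (e * real_of_int L)) * H"
    define g where "g x = h x powe (t - 1)" for x
    have [measurable]: "g \<in> borel_measurable borel" unfolding g_def[abs_def] by measurable
    have gsupp: "g x = 0" if "x \<notin> cball c (2 powr real_of_int (L + m))" for x
      using supp[OF that] by (simp add: g_def)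
    define k where "k = L + m + 1"
    let ?B = "cball c (2 powr real_of_int k)"
    have [measurable]: "?B \<in> sets borel" by simp
    define F1 where "F1 x = f1 x * indicator ?B x" for x
    define F2 where "F2 x = f2 x * indicator ?B x" for x
    have [measurable]: "F1 \<in> borel_measurable borel" "F2 \<in> borel_measurable borel"
      unfolding F1_def[abs_def] F2_def[abs_def] by measurable
    have b1: "morrey_bound p1 a (ennreal v1 * A1) f1"
      unfolding v1_def using a by (intro morrey_bound_lower_exponent f1) auto
    have b2: "morrey_bound p2 1 (ennreal v2 * A2) f2"
      unfolding v2_def using q2 by (intro morrey_bound_lower_exponent f2) auto
    have B1: "morrey_bound p1 a (ennreal v1 * A1) F1"
      by (rule morrey_bound_mono[OF b1]) (use a in \<open>auto simp: F1_def split: split_indicator\<close>)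
    have B2: "morrey_bound p2 1 (ennreal v2 * A2) F2"
      by (rule morrey_bound_mono[OF b2]) (auto simp: F2_def split: split_indicator)
    have vA: "(ennreal v1 * A1) * (ennreal v2 * A2) = ennreal (v1 * v2) * (A1 * A2)"
      using v12 by (simp add: ennreal_mult mult_ac)
    let ?S = "\<lambda>l. ennreal (2 powr ((\<alpha> - ?n) * real_of_int l)) * trilinear_scale l f1 f2 g"
    have near: "(\<integral>\<^sup>+l\<in>{..L}. ?S l \<partial>count_space UNIV) \<le> ennreal Cn * E"
    proof -
      \<comment> \<open>At scales l \<le> L all arguments stay in the ball of radius 2^k, so f1 and
        f2 may be replaced by cut-off functions whose norms on the whole space are controlled by the
        Morrey bounds.\<close>
      have loc: "trilinear_scale l f1 f2 g = trilinear_scale l F1 F2 g" if "l \<le> L" for l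
        unfolding F1_def[abs_def] F2_def[abs_def]
      proof (rule trilinear_scale_localize[OF gsupp])
        have "2 powr real_of_int l \<le> 2 powr real_of_int (L + m)" using that m by simp
        moreover have "2 powr real_of_int (L + m) + 2 powr real_of_int (L + m) = 2 powr real_of_int k"
          by (simp add: k_def powr_add)
        ultimately show "2 powr real_of_int (L + m) + 2 powr real_of_int l \<le> 2 powr real_of_int k" by linarith
      qed
      have "(\<integral>\<^sup>+l\<in>{..L}. ?S l \<partial>count_space UNIV)
        = (\<integral>\<^sup>+l\<in>{..L}. ennreal (2 powr ((\<alpha> - ?n) * real_of_int l)) * trilinear_scale l F1 F2 g \<partial>count_space UNIV)"
        by (intro nn_integral_cong) (auto simp: loc split: split_indicator)
      also have "\<dots> \<le> ennreal cn * (((ennreal v1 * A1) * (ennreal v2 * A2)) powe (\<alpha> / \<gamma>) *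
        (\<integral>\<^sup>+z. (dyadic_maximal (L + 1) (\<lambda>w. F1 w powe a) z powe (1 / a) * dyadic_maximal (L + 1) F2 z) powe (1 - \<alpha> / \<gamma>)
          * dyadic_maximal (L + 1) (\<lambda>w. g w powe b) z powe (1 / b) \<partial>lborel))"
        unfolding cn_def
        by (rule trilinear_scale_sum_near[OF _ _ _ a(3) b(2) B1 B2 _ \<gamma>(1) \<alpha>(1) \<gamma>(2)])
          (use A vA in \<open>auto simp: ennreal_mult_less_top\<close>)
      also have "\<dots> \<le> ennreal cn * ((ennreal (v1 * v2) * (A1 * A2)) powe (\<alpha> / \<gamma>) *
          (ennreal CM * ((\<integral>\<^sup>+x. F1 x powe q1 \<partial>lborel) powe (\<theta> / q1) * (\<integral>\<^sup>+x. F2 x powe q2 \<partial>lborel) powe (\<theta> / q2) * H)))"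
        unfolding vA \<theta>_def[symmetric] g_def H_def by (intro mult_left_mono CM(2) h X) auto
      also have "\<dots> \<le> ennreal cn * ((ennreal (v1 * v2) * (A1 * A2)) powe (\<alpha> / \<gamma>) *
          (ennreal CM * ((A1 powe \<theta> * ennreal (2 powr (?n * real_of_int k * (\<theta> / q1 - \<theta> / p1))))
             * (A2 powe \<theta> * ennreal (2 powr (?n * real_of_int k * (\<theta> / q2 - \<theta> / p2)))) * H)))"
        unfolding F1_def F2_def
        by (intro mult_left_mono mult_mono localized_power_norm_le f1 f2 \<theta>(1)) (use q1' q2 in auto)
      also have "\<dots> = ennreal cn * (ennreal (v1 * v2) powe (\<alpha> / \<gamma>)) * ennreal CM * ((A1 * A2) powe (\<alpha> / \<gamma>) * (A1 * A2) powe \<theta>)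
         * (ennreal (2 powr (?n * real_of_int k * (\<theta> / q1 - \<theta> / p1))) * ennreal (2 powr (?n * real_of_int k * (\<theta> / q2 - \<theta> / p2)))) * H"
        by (simp only: ennreal_powr_mult mult_ac)
      \<comment> \<open>The power \<alpha>/\<gamma> comes from Hedberg's inequality, the power
        \<theta> from the localized norms; they sum to 1.\<close>
      also have "(A1 * A2) powe (\<alpha> / \<gamma>) * (A1 * A2) powe \<theta> = A1 * A2"
        by (simp add: \<theta>_def flip: ennreal_powr_add)
      also have "ennreal (2 powr (?n * real_of_int k * (\<theta> / q1 - \<theta> / p1))) * ennreal (2 powr (?n * real_of_int k * (\<theta> / q2 - \<theta> / p2)))
        = ennreal (2 powr (e * (real_of_int m + 1))) * ennreal (2 powr (e * real_of_int L))"
      proof -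
        have "?n * real_of_int k * (\<theta> / q1 - \<theta> / p1) + ?n * real_of_int k * (\<theta> / q2 - \<theta> / p2)
          = ?n * real_of_int k * ((\<theta> / q1 + \<theta> / q2) - (\<theta> / p1 + \<theta> / p2))" by (simp add: algebra_simps)
        also have "\<dots> = e * (real_of_int m + 1) + e * real_of_int L"
          unfolding \<theta>q \<theta>p e_def by (simp add: k_def algebra_simps add_divide_distrib)
        finally show ?thesis by (simp add: powr_add[symmetric] flip: ennreal_mult)
      qed
      also have "ennreal (v1 * v2) powe (\<alpha> / \<gamma>) = ennreal ((v1 * v2) powr (\<alpha> / \<gamma>))"
        using v12 by (intro ennreal_powr_ennreal) simp
      also have "ennreal cn * ennreal ((v1 * v2) powr (\<alpha> / \<gamma>)) * ennreal CM * (A1 * A2) * (ennreal (2 powr (e * (real_of_int m + 1))) * ennreal (2 powr (e * real_of_int L))) * H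
        = ennreal Cn * E"
        using cn CM(1) by (simp add: Cn_def E_def ennreal_mult mult_ac)
      finally show ?thesis .
    qed
    have far: "(\<integral>\<^sup>+l\<in>{L..}. ?S l \<partial>count_space UNIV) \<le> ennreal Cf * E"
    proof -
      let ?B0 = "cball c (2 powr real_of_int (L + m))"
      have s': "1 / s = 1 / p1 + 1 / p2 - \<alpha> / ?n" using s p by simp
      have ba: "1 / b - 1 + 1 / t = 1 / t - 1 / a" using b(2) by simp
      have "(\<integral>\<^sup>+l\<in>{L..}. ?S l \<partial>count_space UNIV) \<le> ennreal cf * ((ennreal v1 * A1) * (ennreal v2 * A2)
          * ennreal (2 powr (- ?n * (1 / s - 1 / a) * real_of_int L)) * (\<integral>\<^sup>+x. g x powe b \<partial>lborel) powe (1 / b))"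
        unfolding cf_def
        by (rule trilinear_scale_sum_far[OF _ _ _ a(3) b(2) b1 b2 m gsupp s' s0 a(1)]) auto
      also have "\<dots> \<le> ennreal cf * ((ennreal v1 * A1) * (ennreal v2 * A2)
          * ennreal (2 powr (- ?n * (1 / s - 1 / a) * real_of_int L)) * (H * emeasure lborel ?B0 powe (1 / b - 1 + 1 / t)))"
        unfolding g_def H_def
        by (intro mult_left_mono Lb_norm_conjugate_power_le h supp X t tb) (use b in auto)
      also have "emeasure lborel ?B0 powe (1 / b - 1 + 1 / t)
        = ennreal ((?v * 2 powr (?n * real_of_int m)) powr (1 / b - 1 + 1 / t)) * ennreal (2 powr (?n * (1 / t - 1 / a) * real_of_int L))"
      proof -
        have "emeasure lborel ?B0 = ennreal ((?v * 2 powr (?n * real_of_int m)) * 2 powr (?n * real_of_int L))"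
          unfolding emeasure_cball_dyadic by (simp add: distrib_left powr_add mult_ac)
        then have "emeasure lborel ?B0 powe (1 / b - 1 + 1 / t)
           = ennreal ((?v * 2 powr (?n * real_of_int m)) powr (1 / b - 1 + 1 / t) * (2 powr (?n * real_of_int L)) powr (1 / b - 1 + 1 / t))"
          using v by (simp add: ennreal_powr_ennreal powr_mult)
        then show ?thesis
          unfolding powr_powr ba by (simp add: ennreal_mult mult_ac)
      qed
      also have "ennreal cf * ((ennreal v1 * A1) * (ennreal v2 * A2)
          * ennreal (2 powr (- ?n * (1 / s - 1 / a) * real_of_int L)) * (H * (ennreal ((?v * 2 powr (?n * real_of_int m)) powr (1 / b - 1 + 1 / t)) * ennreal (2 powr (?n * (1 / t - 1 / a) * real_of_int L)))))
        = ennreal cf * (ennreal v1 * ennreal v2) * ennreal ((?v * 2 powr (?n * real_of_int m)) powr (1 / b - 1 + 1 / t))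
          * (A1 * A2 * (ennreal (2 powr (- ?n * (1 / s - 1 / a) * real_of_int L)) * ennreal (2 powr (?n * (1 / t - 1 / a) * real_of_int L))) * H)"
        by (simp only: mult_ac)
      \<comment> \<open>The auxiliary exponent a cancels: the decay n(1/s - 1/a) of the series and
        the volume power n(1/t - 1/a) from the L^b norm combine to n(1/t - 1/s).\<close>
      also have "ennreal (2 powr (- ?n * (1 / s - 1 / a) * real_of_int L)) * ennreal (2 powr (?n * (1 / t - 1 / a) * real_of_int L)) = ennreal (2 powr (e * real_of_int L))"
      proof -
        have "- ?n * (1 / s - 1 / a) * real_of_int L + ?n * (1 / t - 1 / a) * real_of_int L = e * real_of_int L"
          by (simp add: e_def algebra_simps)
        then show ?thesis by (simp only: powr_add[symmetric] ennreal_mult[symmetric] powr_ge_zero)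
      qed
      also have "ennreal cf * (ennreal v1 * ennreal v2) * ennreal ((?v * 2 powr (?n * real_of_int m)) powr (1 / b - 1 + 1 / t)) = ennreal Cf"
        using cf v12 by (simp add: Cf_def ennreal_mult)
      finally show ?thesis unfolding E_def .
    qed
    have "(\<integral>\<^sup>+x. (\<integral>\<^sup>+y. f1 (x + y) * f2 (x - y) * ennreal (1 / norm y powr (?n - \<alpha>)) \<partial>lborel) * g x \<partial>lborel)
      \<le> ennreal (2 powr (?n - \<alpha>)) * (\<integral>\<^sup>+l. ?S l \<partial>count_space UNIV)"
      using \<alpha> by (intro fractional_integral_le_scales) auto
    \<comment> \<open>The scale L belongs to both ranges; counting it twice is harmless in an upper
      bound.\<close>
    also have "\<dots> \<le> ennreal (2 powr (?n - \<alpha>)) * (\<integral>\<^sup>+l. ?S l * indicator {..L} l + ?S l * indicator {L..} l \<partial>count_space UNIV)"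
      by (intro mult_left_mono nn_integral_mono) (auto split: split_indicator)
    also have "\<dots> = ennreal (2 powr (?n - \<alpha>)) * ((\<integral>\<^sup>+l\<in>{..L}. ?S l \<partial>count_space UNIV) + (\<integral>\<^sup>+l\<in>{L..}. ?S l \<partial>count_space UNIV))"
      by (simp add: nn_integral_add)
    also have "\<dots> \<le> ennreal (2 powr (?n - \<alpha>)) * (ennreal Cn * E + ennreal Cf * E)"
      by (intro mult_left_mono add_mono near far) simp
    also have "\<dots> = ennreal (2 powr (?n - \<alpha>) * (Cn + Cf)) * E"
      using Cn Cf by (simp add: ennreal_mult ennreal_plus distrib_right mult.assoc)
    finally show "(\<integral>\<^sup>+x. (\<integral>\<^sup>+y. f1 (x + y) * f2 (x - y) * ennreal (1 / norm y powr (?n - \<alpha>)) \<partial>lborel) * h x powe (t - 1) \<partial>lborel)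
      \<le> ennreal (2 powr (?n - \<alpha>) * (Cn + Cf)) * (A1 * A2 * ennreal (2 powr (?n * (1 / t - 1 / s) * real_of_int L))
          * (\<integral>\<^sup>+x. h x powe t \<partial>lborel) powe (1 - 1 / t))"
      by (simp only: E_def H_def e_def g_def)
  qed
qed

section \<open>Dyadic cubes and the Morrey norm\<close>

lemma powi_eq_powr: "2 powi j = 2 powr real_of_int j"
  by (simp add: powr_real_of_int')

text \<open>The half-open cube is squeezed between an open and a closed box of equal volume, which
  determines its measure.\<close>

lemma dyadic_cube_between_boxes:
  fixes k :: "int ^ 'n" and j :: int
  defines "r \<equiv> 2 powr (- real_of_int j)"
  shows "box (\<chi> i. r * real_of_int (k $ i)) (\<chi> i. r * (real_of_int (k $ i) + 1)) \<subseteq> dyadic_cube j k"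
    and "dyadic_cube j k \<subseteq> cbox (\<chi> i. r * real_of_int (k $ i)) (\<chi> i. r * (real_of_int (k $ i) + 1))"
  by (auto simp: dyadic_cube_def mem_box_cart powi_eq_powr r_def less_imp_le)

lemma dyadic_cube_borel [measurable]: "dyadic_cube j k \<in> sets borel"
  unfolding dyadic_cube_def by measurable

lemma emeasure_dyadic_cube:
  fixes k :: "int ^ 'n"
  shows "emeasure lborel (dyadic_cube j k) = ennreal (2 powr (- real CARD('n) * real_of_int j))"
proof -
  define r where "r = 2 powr (- real_of_int j)"
  define l u :: "real ^ 'n" where "l = (\<chi> i. r * real_of_int (k $ i))" and "u = (\<chi> i. r * (real_of_int (k $ i) + 1))"
  have r: "r > 0" by (simp add: r_def)
  have le: "l \<bullet> b \<le> u \<bullet> b" if "b \<in> Basis" for b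
    using that r by (auto simp: Basis_vec_def inner_axis l_def u_def)
  have "u - l = (\<chi> i. r)" by (simp add: l_def u_def vec_eq_iff algebra_simps)
  then have "(\<Prod>b\<in>Basis. (u - l) \<bullet> b) = (\<Prod>b\<in>(Basis :: (real ^ 'n) set). r)"
    by (intro prod.cong) (auto simp: Basis_vec_def inner_axis)
  also have "\<dots> = 2 powr (- real CARD('n) * real_of_int j)"
    by (simp add: r_def powr_power mult.commute)
  finally have p: "(\<Prod>b\<in>Basis. (u - l) \<bullet> b) = \<dots>" .
  have "emeasure lborel (box l u) \<le> emeasure lborel (dyadic_cube j k)"
    using dyadic_cube_between_boxes(1)[of j k] by (intro emeasure_mono) (auto simp: l_def u_def r_def)
  moreover have "emeasure lborel (dyadic_cube j k) \<le> emeasure lborel (cbox l u)"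
    using dyadic_cube_between_boxes(2)[of j k] by (intro emeasure_mono) (auto simp: l_def u_def r_def)
  ultimately show ?thesis
    using le by (simp add: emeasure_lborel_box emeasure_lborel_cbox p)
qed

lemma measure_lebesgue_dyadic_cube:
  fixes k :: "int ^ 'n"
  shows "measure lebesgue (dyadic_cube j k) = 2 powr (- real CARD('n) * real_of_int j)"
  by (simp add: measure_def emeasure_dyadic_cube)

text \<open>With a corner as centre, the Euclidean distance is at most the sum of the coordinates'
  distances, hence at most n times the side. The crude bound n < 2^n gives a radius that is again an
  integer power of 2.\<close>

lemma dyadic_cube_subset_cball:
  fixes k :: "int ^ 'n"
  shows "\<exists>c. dyadic_cube j k \<subseteq> cball c (2 powr real_of_int (- j + int CARD('n)))"
proof
  define r where "r = 2 powr (- real_of_int j)"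
  define c :: "real ^ 'n" where "c = (\<chi> i. r * real_of_int (k $ i))"
  show "dyadic_cube j k \<subseteq> cball c (2 powr real_of_int (- j + int CARD('n)))"
  proof
    fix x assume "x \<in> dyadic_cube j k"
    then have x: "\<bar>(x - c) $ i\<bar> \<le> r" for i
      by (simp add: dyadic_cube_def powi_eq_powr c_def r_def abs_le_iff algebra_simps) (smt (verit))
    have "norm (x - c) \<le> (\<Sum>i\<in>UNIV. \<bar>(x - c) $ i\<bar>)" by (rule norm_le_l1_cart)
    also have "\<dots> \<le> (\<Sum>i\<in>(UNIV::'n set). r)" by (intro sum_mono x)
    also have "\<dots> \<le> 2 ^ CARD('n) * r"
      using of_nat_less_two_power[of "CARD('n)", where 'a=real] by (simp add: r_def mult_right_mono less_imp_le)
    also have "\<dots> = 2 powr real_of_int (- j + int CARD('n))"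
      by (simp add: r_def powr_add powr_diff powr_minus powr_realpow field_simps)
    finally show "x \<in> cball c (2 powr real_of_int (- j + int CARD('n)))"
      by (simp add: dist_norm norm_minus_commute)
  qed
qed

text \<open>In each coordinate the ball extends over a length 2^(l+1), equal to the side of the
  chosen cubes, so it meets at most two consecutive intervals. The vectors in
  \<open>bool ^ 'n\<close> record the choice between them in every coordinate.\<close>

lemma cball_subset_dyadic_cubes:
  fixes z :: "real ^ 'n"
  shows "\<exists>k :: int ^ 'n. cball z (2 powr real_of_int l) \<subseteq> (\<Union>b\<in>(UNIV :: (bool ^ 'n) set). dyadic_cube (- (l + 1)) (\<chi> i. k $ i + of_bool (b $ i)))"
proof
  define r where "r = 2 powr real_of_int l"
  have r: "r > 0" "2 powr real_of_int (l + 1) = 2 * r" by (simp_all add: r_def powr_add)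
  \<comment> \<open>The dyadic interval containing the lower end of the projection of the
    ball.\<close>
  define k :: "int ^ 'n" where "k = (\<chi> i. \<lfloor>(z $ i - r) / (2 * r)\<rfloor>)"
  show "cball z (2 powr real_of_int l) \<subseteq> (\<Union>b\<in>(UNIV :: (bool ^ 'n) set). dyadic_cube (- (l + 1)) (\<chi> i. k $ i + of_bool (b $ i)))"
  proof
    fix x assume "x \<in> cball z (2 powr real_of_int l)"
    then have "norm (x - z) \<le> r" by (simp add: r_def dist_norm norm_minus_commute)
    then have x: "\<bar>x $ i - z $ i\<bar> \<le> r" for i
      using component_le_norm_cart[of "x - z" i] by simp
    define b :: "bool ^ 'n" where "b = (\<chi> i. 2 * r * (real_of_int (k $ i) + 1) \<le> x $ i)"
    have k: "2 * r * real_of_int (k $ i) \<le> z $ i - r" "z $ i - r < 2 * r * (real_of_int (k $ i) + 1)" for i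
    proof -
      have "real_of_int (k $ i) \<le> (z $ i - r) / (2 * r)" "(z $ i - r) / (2 * r) < real_of_int (k $ i) + 1"
        by (simp_all add: k_def)
      then show "2 * r * real_of_int (k $ i) \<le> z $ i - r" "z $ i - r < 2 * r * (real_of_int (k $ i) + 1)"
        using r(1) by (simp_all add: field_simps)
    qed
    have "2 * r * real_of_int (k $ i + of_bool (b $ i)) \<le> x $ i \<and> x $ i < 2 * r * (real_of_int (k $ i + of_bool (b $ i)) + 1)" for i
      using k[of i] x[of i] by (cases "b $ i") (auto simp: b_def abs_le_iff algebra_simps)
    then have "x \<in> dyadic_cube (- (l + 1)) (\<chi> i. k $ i + of_bool (b $ i))"
      by (simp only: dyadic_cube_def powi_eq_powr minus_minus r(2) mem_Collect_eq vec_lambda_beta simp_thms)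
    then show "x \<in> (\<Union>b\<in>(UNIV :: (bool ^ 'n) set). dyadic_cube (- (l + 1)) (\<chi> i. k $ i + of_bool (b $ i)))" by auto
  qed
qed

lemma nn_integral_dyadic_cube_le_morrey_norm:
  fixes F :: "real ^ 'n \<Rightarrow> ennreal"
  assumes q: "0 < q"
  shows "(\<integral>\<^sup>+x\<in>dyadic_cube j k. F x powe q \<partial>lborel)
    \<le> (morrey_norm p q F * ennreal (2 powr (- real CARD('n) * real_of_int j * (1 / q - 1 / p)))) powe q"
proof -
  let ?I = "\<integral>\<^sup>+x\<in>dyadic_cube j k. F x powe q \<partial>lborel"
  let ?e = "- real CARD('n) * real_of_int j * (1 / q - 1 / p)"
  have "ennreal (measure lebesgue (dyadic_cube j k) powr (1 / p - 1 / q)) * Lq_norm_on q (dyadic_cube j k) F \<le> morrey_norm p q F"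
    unfolding morrey_norm_def by (rule SUP_upper) (auto simp: dyadic_cubes_def)
  also have "measure lebesgue (dyadic_cube j k) powr (1 / p - 1 / q) = 2 powr (- ?e)"
    by (simp add: measure_lebesgue_dyadic_cube powr_powr algebra_simps)
  also have "Lq_norm_on q (dyadic_cube j k) F = ?I powe (1 / q)"
    by (simp add: Lq_norm_on_def nn_integral_completion)
  finally have "ennreal (2 powr ?e) * (ennreal (2 powr (- ?e)) * ?I powe (1 / q)) \<le> ennreal (2 powr ?e) * morrey_norm p q F"
    by (rule mult_left_mono) simp
  moreover have "ennreal (2 powr ?e) * ennreal (2 powr (- ?e)) = 1"
    by (simp only: ennreal_mult[symmetric] powr_add[symmetric] powr_ge_zero) simp
  ultimately have "?I powe (1 / q) \<le> ennreal (2 powr ?e) * morrey_norm p q F"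
    by (simp only: mult.assoc[symmetric]) simp
  then have "(?I powe (1 / q)) powe q \<le> (ennreal (2 powr ?e) * morrey_norm p q F) powe q"
    using q by (intro ennreal_powr_mono) auto
  then show ?thesis using q by (simp add: ennreal_powr_powr mult.commute)
qed

text \<open>The constant has two sources: the number of cubes covering a ball, raised to 1/q, and
  the ratio 2 between the side 2^(l+1) of these cubes and the radius 2^l.\<close>

lemma morrey_bound_morrey_norm:
  fixes F :: "real ^ 'n \<Rightarrow> ennreal"
  assumes [measurable]: "F \<in> borel_measurable borel" and q: "0 < q"
  shows "morrey_bound p q (ennreal (real CARD(bool ^ 'n) powr (1 / q) * 2 powr (real CARD('n) * (1 / q - 1 / p))) * morrey_norm p q F) F"
  unfolding morrey_bound_def
proof (intro allI)
  fix l :: int and z :: "real ^ 'n"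
  let ?n = "real CARD('n)" let ?K = "real CARD(bool ^ 'n)"
  let ?N = "morrey_norm p q F * ennreal (2 powr (?n * real_of_int (l + 1) * (1 / q - 1 / p)))"
  obtain k :: "int ^ 'n" where k: "cball z (2 powr real_of_int l) \<subseteq> (\<Union>b\<in>(UNIV :: (bool ^ 'n) set). dyadic_cube (- (l + 1)) (\<chi> i. k $ i + of_bool (b $ i)))"
    using cball_subset_dyadic_cubes by blast
  have "(\<integral>\<^sup>+x\<in>cball z (2 powr real_of_int l). F x powe q \<partial>lborel)
    \<le> (\<integral>\<^sup>+x. (\<Sum>b\<in>(UNIV :: (bool ^ 'n) set). F x powe q * indicator (dyadic_cube (- (l + 1)) (\<chi> i. k $ i + of_bool (b $ i))) x) \<partial>lborel)"
  proof (rule nn_integral_mono)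
    fix x
    show "F x powe q * indicator (cball z (2 powr real_of_int l)) x
      \<le> (\<Sum>b\<in>(UNIV :: (bool ^ 'n) set). F x powe q * indicator (dyadic_cube (- (l + 1)) (\<chi> i. k $ i + of_bool (b $ i))) x)"
    proof (cases "x \<in> cball z (2 powr real_of_int l)")
      case True
      then obtain b :: "bool ^ 'n" where b: "x \<in> dyadic_cube (- (l + 1)) (\<chi> i. k $ i + of_bool (b $ i))"
        using k by blast
      have "F x powe q * indicator (cball z (2 powr real_of_int l)) x = F x powe q * indicator (dyadic_cube (- (l + 1)) (\<chi> i. k $ i + of_bool (b $ i))) x"
        using True b by simp
      also have "\<dots> \<le> (\<Sum>b\<in>(UNIV :: (bool ^ 'n) set). F x powe q * indicator (dyadic_cube (- (l + 1)) (\<chi> i. k $ i + of_bool (b $ i))) x)"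
        by (rule member_le_sum) auto
      finally show ?thesis .
    qed simp
  qed
  also have "\<dots> = (\<Sum>b\<in>(UNIV :: (bool ^ 'n) set). \<integral>\<^sup>+x\<in>dyadic_cube (- (l + 1)) (\<chi> i. k $ i + of_bool (b $ i)). F x powe q \<partial>lborel)"
    by (rule nn_integral_sum) measurable
  also have "\<dots> \<le> (\<Sum>b\<in>(UNIV :: (bool ^ 'n) set). ?N powe q)"
    using nn_integral_dyadic_cube_le_morrey_norm[OF q, where j = "- (l + 1)" and F = F and p = p]
    by (intro sum_mono) (simp only: of_int_minus minus_mult_minus)
  also have "\<dots> = ennreal ?K * ?N powe q" by (simp add: ennreal_of_nat_eq_real_of_nat)
  finally have "dyadic_average l (\<lambda>w. F w powe q) z \<le> ennreal (2 powr (- real DIM(real ^ 'n) * real_of_int l)) * (ennreal ?K * ?N powe q)"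
    unfolding dyadic_average_def by (rule mult_left_mono) simp
  then have "dyadic_average l (\<lambda>w. F w powe q) z powe (1 / q) \<le> (ennreal (2 powr (- ?n * real_of_int l)) * (ennreal ?K * ?N powe q)) powe (1 / q)"
    using q by (intro ennreal_powr_mono) auto
  also have "\<dots> = ennreal (2 powr (- ?n * real_of_int l)) powe (1 / q) * (ennreal ?K powe (1 / q) * ?N)"
    using q by (simp only: ennreal_powr_mult ennreal_powr_powr) simp
  also have "\<dots> = ennreal (?K powr (1 / q)) * morrey_norm p q F * (ennreal (2 powr (- ?n * real_of_int l)) powe (1 / q) * ennreal (2 powr (?n * real_of_int (l + 1) * (1 / q - 1 / p))))"
    by (simp only: ennreal_powr_ennreal of_nat_0_le_iff mult_ac)
  also have "ennreal (2 powr (- ?n * real_of_int l)) powe (1 / q) * ennreal (2 powr (?n * real_of_int (l + 1) * (1 / q - 1 / p)))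
     = ennreal (2 powr (?n * (1 / q - 1 / p))) * ennreal (2 powr (- (real DIM(real ^ 'n) / p) * real_of_int l))"
    by (simp add: ennreal_powr_ennreal powr_powr algebra_simps flip: ennreal_mult powr_add)
  finally show "dyadic_average l (\<lambda>w. F w powe q) z powe (1 / q)
    \<le> ennreal (?K powr (1 / q) * 2 powr (?n * (1 / q - 1 / p))) * morrey_norm p q F * ennreal (2 powr (- (real DIM(real ^ 'n) / p) * real_of_int l))"
    by (simp add: ennreal_mult mult_ac)
qed

section \<open>Null sets and Borel representatives\<close>

lemma morrey_norm_cong_AE:
  assumes "AE x in lborel. F x = G x"
  shows "morrey_norm p q F = morrey_norm p q G"
proof -
  have "(\<integral>\<^sup>+x\<in>Q. F x powe q \<partial>lebesgue) = (\<integral>\<^sup>+x\<in>Q. G x powe q \<partial>lebesgue)" for Q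
    by (rule nn_integral_cong_AE) (use AE_completion[OF assms] in \<open>auto elim: eventually_mono\<close>)
  then show ?thesis by (simp add: morrey_norm_def Lq_norm_on_def)
qed

lemma AE_lborel_shift_reflect:
  fixes x :: "'a::euclidean_space"
  assumes "AE y in lborel. P y"
  shows "AE y in lborel. P (x + y)" "AE y in lborel. P (x - y)"
proof -
  obtain N where N: "{y. \<not> P y} \<subseteq> N" "N \<in> null_sets lborel"
    using assms by (auto elim!: AE_E simp: null_sets_def)
  then have [measurable]: "N \<in> sets borel" and N0: "emeasure lborel N = 0" by auto
  have "(\<integral>\<^sup>+y. indicator N (y + x) \<partial>lborel) = 0" "(\<integral>\<^sup>+y. indicator N (x - y) \<partial>lborel) = 0"
    using nn_integral_lborel_shift[of "indicator N" x] nn_integral_lborel_reflect[of "indicator N" x] N0 by simp_all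
  then have "AE y in lborel. indicator N (y + x) = (0::ennreal)" "AE y in lborel. indicator N (x - y) = (0::ennreal)"
    by (simp_all add: nn_integral_0_iff_AE)
  moreover have "P (x + y)" if "indicator N (y + x) = (0::ennreal)" for y
    using that N(1) by (auto simp: add.commute split: split_indicator_asm)
  moreover have "P (x - y)" if "indicator N (x - y) = (0::ennreal)" for y
    using that N(1) by (auto split: split_indicator_asm)
  ultimately show "AE y in lborel. P (x + y)" "AE y in lborel. P (x - y)"
    by (auto elim: eventually_mono)
qed

text \<open>Members of the Morrey spaces are only Lebesgue measurable, whereas the composites with x
  + y and x - y are handled by Tonelli on products of Borel spaces.\<close>

lemma borel_representative:
  assumes "f \<in> borel_measurable lebesgue"
  obtains F :: "'a::euclidean_space \<Rightarrow> ennreal" where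
    "F \<in> borel_measurable borel" "AE x in lborel. ennreal \<bar>f x\<bar> = F x"
proof -
  obtain f' where f': "f' \<in> borel_measurable lborel" "AE x in lborel. f x = f' x"
    using completion_ex_borel_measurable_real[OF assms] by blast
  show ?thesis
    by (rule that[of "\<lambda>x. ennreal \<bar>f' x\<bar>"]) (use f' in \<open>auto elim: eventually_mono\<close>)
qed

text \<open>The equality holds at every x: translation and reflection preserve null sets, so for
  each x the integrands agree for almost every y. In particular the fractional integral becomes
  Borel measurable in x.\<close>

lemma bilinear_frac_int_cong_AE:
  fixes f1 f2 :: "real ^ 'n \<Rightarrow> real"
  assumes nonneg: "\<And>x. 0 \<le> f1 x" "\<And>x. 0 \<le> f2 x"
    and AE: "AE x in lborel. ennreal \<bar>f1 x\<bar> = F1 x" "AE x in lborel. ennreal \<bar>f2 x\<bar> = F2 x"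
  shows "bilinear_frac_int \<alpha> f1 f2 x
    = (\<integral>\<^sup>+y. F1 (x + y) * F2 (x - y) * ennreal (1 / norm y powr (real CARD('n) - \<alpha>)) \<partial>lborel)"
  unfolding bilinear_frac_int_def nn_integral_completion
proof (rule nn_integral_cong_AE)
  show "AE y in lborel. ennreal (f1 (x + y) * f2 (x - y) / norm y powr (real CARD('n) - \<alpha>))
     = F1 (x + y) * F2 (x - y) * ennreal (1 / norm y powr (real CARD('n) - \<alpha>))"
    using AE_lborel_shift_reflect(1)[OF AE(1), of x] AE_lborel_shift_reflect(2)[OF AE(2), of x]
  proof eventually_elim
    case (elim y)
    have "ennreal (f1 (x + y) * f2 (x - y) / norm y powr (real CARD('n) - \<alpha>))
      = ennreal (f1 (x + y) * f2 (x - y) * (1 / norm y powr (real CARD('n) - \<alpha>)))" by simp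
    also have "\<dots> = ennreal (f1 (x + y)) * ennreal (f2 (x - y)) * ennreal (1 / norm y powr (real CARD('n) - \<alpha>))"
      using nonneg by (simp only: ennreal_mult mult_nonneg_nonneg divide_nonneg_nonneg powr_ge_zero zero_le_one)
    finally show ?case using elim nonneg by simp
  qed
qed

section \<open>Truncation heights and the final estimate\<close>

lemma SUP_min_of_nat_powr:
  assumes t: "1 \<le> t"
  shows "(SUP k. min x (of_nat k) powe t) = x powe t"
proof (rule antisym)
  show "(SUP k. min x (of_nat k) powe t) \<le> x powe t"
    using t by (intro SUP_least ennreal_powr_mono) auto
  show "x powe t \<le> (SUP k. min x (of_nat k) powe t)"
  proof (cases x)
    case (real r)
    obtain k :: nat where "r \<le> real k" using real_arch_simple by blast
    then have "min x (of_nat k) = x"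
      using real by (simp add: min_absorb1 ennreal_of_nat_eq_real_of_nat)
    then show ?thesis by (metis SUP_upper UNIV_I)
  next
    case top
    have "of_nat k \<le> min x (of_nat k) powe t" for k
    proof (cases "k = 0")
      case False
      then have "real k powr 1 \<le> real k powr t" using t by (intro powr_mono) auto
      then show ?thesis using top False by (simp add: ennreal_of_nat_eq_real_of_nat ennreal_powr_ennreal ennreal_leI)
    qed simp
    then have "(SUP k. of_nat k) \<le> (SUP k. min x (of_nat k) powe t)"
      by (intro SUP_mono) blast
    then have "(SUP k. min x (of_nat k) powe t) = top"
      by (simp only: ennreal_SUP_of_nat_eq_top top_unique)
    then show ?thesis by (simp only: top_greatest)
  qed
qed

theorem theorem1p2:
  fixes \<alpha> p1 p2 q1 q2 p q s t :: real
  assumes "0 < \<alpha>" and "\<alpha> < real CARD('n::finite)"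
    and "1 < q1" and "q1 \<le> p1"
    and "1 < q2" and "q2 \<le> p2"
    and "1 \<le> t" and "t \<le> s"
    and "1 / p = 1 / p1 + 1 / p2"
    and "1 / q = 1 / q1 + 1 / q2"
    and "1 / s = 1 / p - \<alpha> / real CARD('n)"
    and "q / p = t / s"
    and "s < min q1 q2"
  shows "\<exists>C::real. C > 0 \<and>
    (\<forall>(f1 :: real ^ 'n \<Rightarrow> real) \<in> morrey_space p1 q1. \<forall>(f2 :: real ^ 'n \<Rightarrow> real) \<in> morrey_space p2 q2.
       (\<forall>x. 0 \<le> f1 x) \<longrightarrow> (\<forall>x. 0 \<le> f2 x) \<longrightarrow>
       morrey_norm s t (bilinear_frac_int \<alpha> f1 f2)
         \<le> ennreal C * morrey_norm p1 q1 (\<lambda>x. ennreal \<bar>f1 x\<bar>)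
                     * morrey_norm p2 q2 (\<lambda>x. ennreal \<bar>f2 x\<bar>))"
proof -
  \<comment> \<open>The enlargement exponent \<open>?m\<close> is that of
    \<open>dyadic_cube_subset_cball\<close>.\<close>
  let ?n = "real CARD('n)" let ?m = "int CARD('n)"
  obtain C where C: "0 < C"
    "\<And>L c (f1::real ^ 'n \<Rightarrow> ennreal) f2 h A1 A2.
      f1 \<in> borel_measurable borel \<Longrightarrow> f2 \<in> borel_measurable borel \<Longrightarrow> h \<in> borel_measurable borel \<Longrightarrow>
      morrey_bound p1 q1 A1 f1 \<Longrightarrow> morrey_bound p2 q2 A2 f2 \<Longrightarrow> A1 * A2 < top \<Longrightarrow>
      (\<And>x. h x < top) \<Longrightarrow> (\<And>x. x \<notin> cball c (2 powr real_of_int (L + ?m)) \<Longrightarrow> h x = 0) \<Longrightarrow>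
      0 < (\<integral>\<^sup>+x. h x powe t \<partial>lborel) \<Longrightarrow> (\<integral>\<^sup>+x. h x powe t \<partial>lborel) < top \<Longrightarrow>
      (\<integral>\<^sup>+x. (\<integral>\<^sup>+y. f1 (x + y) * f2 (x - y) * ennreal (1 / norm y powr (?n - \<alpha>)) \<partial>lborel) * h x powe (t - 1) \<partial>lborel)
      \<le> ennreal C * (A1 * A2 * ennreal (2 powr (?n * (1 / t - 1 / s) * real_of_int L))
          * (\<integral>\<^sup>+x. h x powe t \<partial>lborel) powe (1 - 1 / t))"
    using fractional_integral_dual_bound[where 'a="real ^ 'n", of \<alpha> q1 p1 q2 p2 t s p q ?m] assms by auto
  define c1 where "c1 = real CARD(bool ^ 'n) powr (1 / q1) * 2 powr (?n * (1 / q1 - 1 / p1))"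
  define c2 where "c2 = real CARD(bool ^ 'n) powr (1 / q2) * 2 powr (?n * (1 / q2 - 1 / p2))"
  have c: "c1 > 0" "c2 > 0" by (simp_all add: c1_def c2_def)
  show ?thesis
  proof (intro exI conjI ballI impI)
    show "C * c1 * c2 > 0" using C(1) c by simp
    fix f1 f2 :: "real ^ 'n \<Rightarrow> real"
    assume f1: "f1 \<in> morrey_space p1 q1" "\<forall>x. 0 \<le> f1 x" and f2: "f2 \<in> morrey_space p2 q2" "\<forall>x. 0 \<le> f2 x"
    define N1 where "N1 = morrey_norm p1 q1 (\<lambda>x. ennreal \<bar>f1 x\<bar>)"
    define N2 where "N2 = morrey_norm p2 q2 (\<lambda>x. ennreal \<bar>f2 x\<bar>)"
    have N: "N1 < top" "N2 < top" using f1 f2 by (simp_all add: morrey_space_def N1_def N2_def)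
    obtain F1 where F1[measurable]: "F1 \<in> borel_measurable borel" "AE x in lborel. ennreal \<bar>f1 x\<bar> = F1 x"
      using borel_representative[of f1] f1 unfolding morrey_space_def by blast
    obtain F2 where F2[measurable]: "F2 \<in> borel_measurable borel" "AE x in lborel. ennreal \<bar>f2 x\<bar> = F2 x"
      using borel_representative[of f2] f2 unfolding morrey_space_def by blast
    have B1: "morrey_bound p1 q1 (ennreal c1 * N1) F1"
      using morrey_bound_morrey_norm[OF F1(1), of q1 p1] assms
      by (simp add: c1_def N1_def morrey_norm_cong_AE[OF F1(2)])
    have B2: "morrey_bound p2 q2 (ennreal c2 * N2) F2"
      using morrey_bound_morrey_norm[OF F2(1), of q2 p2] assms
      by (simp add: c2_def N2_def morrey_norm_cong_AE[OF F2(2)])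
    have fin: "(ennreal c1 * N1) * (ennreal c2 * N2) < top"
      using N by (simp add: ennreal_mult_less_top)
    define J where "J = bilinear_frac_int \<alpha> f1 f2"
    have J: "J x = (\<integral>\<^sup>+y. F1 (x + y) * F2 (x - y) * ennreal (1 / norm y powr (?n - \<alpha>)) \<partial>lborel)" for x
      unfolding J_def using f1 f2 by (intro bilinear_frac_int_cong_AE F1 F2) auto
    have [measurable]: "J \<in> borel_measurable borel"
      unfolding J[abs_def] by measurable
    define E where "E = ennreal (C * c1 * c2) * N1 * N2"
    have cube: "(\<integral>\<^sup>+x\<in>dyadic_cube j k. J x powe t \<partial>lborel) \<le> (E * ennreal (2 powr (?n * (1 / t - 1 / s) * real_of_int (- j)))) powe t" for j k
    proof -
      let ?Q = "dyadic_cube j k"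
      let ?R = "E * ennreal (2 powr (?n * (1 / t - 1 / s) * real_of_int (- j)))"
      obtain c where c': "?Q \<subseteq> cball c (2 powr real_of_int (- j + ?m))"
        using dyadic_cube_subset_cball by blast
      define h where "h i x = min (J x) (of_nat i) * indicator ?Q x" for i x
      have hm[measurable]: "h i \<in> borel_measurable borel" for i
        unfolding h_def[abs_def] by measurable
      have X_le: "(\<integral>\<^sup>+x. h i x powe t \<partial>lborel) \<le> ?R powe t" for i
      proof (cases "(\<integral>\<^sup>+x. h i x powe t \<partial>lborel) = 0")
        case False
        let ?X = "\<integral>\<^sup>+x. h i x powe t \<partial>lborel"
        have X0: "0 < ?X" using False by (simp add: zero_less_iff_neq_zero)
        \<comment> \<open>Finiteness comes from the truncation height i together with the finite
          volume of the cube.\<close>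
        have "?X \<le> (\<integral>\<^sup>+x. of_nat i powe t * indicator ?Q x \<partial>lborel)"
          using assms by (intro nn_integral_mono) (auto simp: h_def intro!: ennreal_powr_mono split: split_indicator)
        also have "\<dots> = of_nat i powe t * ennreal (2 powr (- ?n * real_of_int j))"
          by (simp add: nn_integral_cmult_indicator emeasure_dyadic_cube)
        also have "\<dots> < top" by (simp add: ennreal_mult_less_top of_nat_less_top)
        finally have X1: "?X < top" .
        have "h i x < top" for x
          by (auto simp: h_def min_less_iff_disj of_nat_less_top split: split_indicator)
        moreover have "h i x = 0" if "x \<notin> cball c (2 powr real_of_int (- j + ?m))" for x
          using that c' by (auto simp: h_def split: split_indicator)
        ultimately have dual: "(\<integral>\<^sup>+x. J x * h i x powe (t - 1) \<partial>lborel)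
          \<le> ennreal C * ((ennreal c1 * N1) * (ennreal c2 * N2) * ennreal (2 powr (?n * (1 / t - 1 / s) * real_of_int (- j))) * ?X powe (1 - 1 / t))"
          unfolding J by (intro C(2)[OF F1(1) F2(1) hm B1 B2 fin _ _ X0 X1])
        have "?X \<le> (\<integral>\<^sup>+x. J x * h i x powe (t - 1) \<partial>lborel)"
        proof (rule nn_integral_mono)
          fix x
          \<comment> \<open>Since h is at most J, one of the t factors may be replaced by the
            untruncated J.\<close>
          have "h i x powe t = h i x powe 1 * h i x powe (t - 1)" by (simp del: ennreal_powr_one flip: ennreal_powr_add)
          also have "\<dots> \<le> J x * h i x powe (t - 1)"
            by (intro mult_right_mono) (auto simp: h_def split: split_indicator)
          finally show "h i x powe t \<le> J x * h i x powe (t - 1)" .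
        qed
        also note dual
        also have "ennreal C * ((ennreal c1 * N1) * (ennreal c2 * N2) * ennreal (2 powr (?n * (1 / t - 1 / s) * real_of_int (- j))) * ?X powe (1 - 1 / t))
          = ?R * ?X powe (1 - 1 / t)"
          using C(1) c by (simp add: E_def ennreal_mult mult_ac)
        \<comment> \<open>Multiplying by the inverse power turns X \<le> R X^(1-1/t) into X^(1/t)
          \<le> R.\<close>
        finally have "?X powe (- (1 - 1 / t)) * ?X \<le> ?X powe (- (1 - 1 / t)) * (?R * ?X powe (1 - 1 / t))"
          by (rule mult_left_mono) simp
        also have "\<dots> = ?R * (?X powe (- (1 - 1 / t)) * ?X powe (1 - 1 / t))" by (simp only: mult_ac)
        also have "?X powe (- (1 - 1 / t)) * ?X powe (1 - 1 / t) = 1"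
          by (rule ennreal_powr_cmult_inverse[OF X0 X1])
        also have "?X powe (- (1 - 1 / t)) * ?X = ?X powe (1 / t)"
          using ennreal_powr_add[of ?X "- (1 - 1 / t)" 1] by simp
        finally have "(?X powe (1 / t)) powe t \<le> ?R powe t"
          using assms by (intro ennreal_powr_mono) auto
        then show ?thesis using assms by (simp add: ennreal_powr_powr)
      qed simp
      have "(\<integral>\<^sup>+x\<in>?Q. J x powe t \<partial>lborel) = (\<integral>\<^sup>+x. (SUP i. h i x powe t) \<partial>lborel)"
      proof (rule nn_integral_cong)
        fix x
        show "J x powe t * indicator ?Q x = (SUP i. h i x powe t)"
          using SUP_min_of_nat_powr[of t "J x"] assms by (cases "x \<in> ?Q") (simp_all add: h_def)
      qed
      \<comment> \<open>The bound does not depend on the height i, so monotone convergence transfers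
        it to J.\<close>
      also have "\<dots> = (SUP i. \<integral>\<^sup>+x. h i x powe t \<partial>lborel)"
      proof (rule nn_integral_monotone_convergence_SUP)
        show "incseq (\<lambda>i x. h i x powe t)"
          using assms
          by (auto simp: incseq_def le_fun_def h_def intro!: ennreal_powr_mono mult_right_mono min.mono)
      qed measurable
      also have "\<dots> \<le> ?R powe t" by (intro SUP_least X_le)
      finally show ?thesis .
    qed
    have "morrey_norm s t J \<le> E"
      unfolding morrey_norm_def
    proof (rule SUP_least)
      fix Q :: "(real ^ 'n) set"
      assume "Q \<in> dyadic_cubes"
      then obtain j k where Q: "Q = dyadic_cube j k" by (auto simp: dyadic_cubes_def)
      let ?e = "?n * (1 / t - 1 / s) * real_of_int (- j)"
      have "Lq_norm_on t Q J \<le> ((E * ennreal (2 powr ?e)) powe t) powe (1 / t)"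
        unfolding Lq_norm_on_def nn_integral_completion Q using cube assms by (intro ennreal_powr_mono) auto
      also have "\<dots> = E * ennreal (2 powr ?e)" using assms by (simp add: ennreal_powr_powr)
      finally have "ennreal (measure lebesgue Q powr (1 / s - 1 / t)) * Lq_norm_on t Q J
        \<le> ennreal (measure lebesgue Q powr (1 / s - 1 / t)) * (E * ennreal (2 powr ?e))"
        by (rule mult_left_mono) simp
      \<comment> \<open>With L = -j, the power of the volume in the Morrey norm is exactly the
        inverse of the growth factor in the estimate on the cube.\<close>
      also have Q_powr: "measure lebesgue Q powr (1 / s - 1 / t) = 2 powr (- ?e)"
        unfolding Q measure_lebesgue_dyadic_cube powr_powr by (simp add: algebra_simps)
      also have "ennreal (2 powr (- ?e)) * (E * ennreal (2 powr ?e)) = E * (ennreal (2 powr (- ?e)) * ennreal (2 powr ?e))"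
        by (simp only: mult_ac)
      also have "ennreal (2 powr (- ?e)) * ennreal (2 powr ?e) = 1"
        by (simp only: ennreal_mult[symmetric] powr_add[symmetric] powr_ge_zero) simp
      finally show "ennreal (measure lebesgue Q powr (1 / s - 1 / t)) * Lq_norm_on t Q J \<le> E"
        by (simp only: Q_powr mult_1_right)
    qed
    then show "morrey_norm s t (bilinear_frac_int \<alpha> f1 f2)
      \<le> ennreal (C * c1 * c2) * morrey_norm p1 q1 (\<lambda>x. ennreal \<bar>f1 x\<bar>) * morrey_norm p2 q2 (\<lambda>x. ennreal \<bar>f2 x\<bar>)"
      unfolding J_def E_def N1_def N2_def .
  qed
qed

end
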